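(* Let $N,p,q$ be real numbers with $q>p-1>0$, $N\neq p$, and let $\sigma=-N$. Consider the positive solutions of $$-(|w'|^{p-2}w')'-\frac{N-1}{r}|w'|^{p-2}w'=\varepsilon r^{-N}w^{q},\qquad \varepsilon=\pm1 .$$ (1) Assume $N>p$. • For $\varepsilon=\pm1$ there exist local solutions near $\infty$ such that $\lim_{r\to\infty}r^{\frac{N-p}{p-1}}w=k>0$ and $\lim_{r\to\infty}r^{\frac{N-1}{p-1}}w'=-c(k)<0$. • For $\varepsilon=\pm1$ there exists an infinity with 2 parameters of local solutions near $\infty$ such that $\lim_{r\to\infty}w=C>0$ and $\lim_{r\to\infty}r^{\frac{N-1}{p-1}}(\ln r)^{-\frac1{p-1}}w'=-\varepsilon c(C)$. • For $\varepsilon=-1$ there exists the $C^0$-regular solution $w^*=a^*r^{\frac{N-p}{q+1-p}}$. There exist local solutions near $0$ such that $w\sim w^*$ as $r\to0$, and local ones near $\infty$ such that $w\sim w^*$ as $r\to\infty$. There exists an infinity of solutions such that $$w\sim w^*\ \text{ as } r\to0,\qquad \lim_{r\to\infty}w=C>0,\qquad \lim_{r\to\infty}r^{\frac{N-1}{p-1}}(\ln r)^{-\frac1{p-1}}w'=\Bigl(\frac{q+1-p}{N-p}\Bigr)^{\frac{q}{q+1-p}} .$$ (2) Assume $p>N$. Then the behaviour is deduced from (1) by changing $r$ into $1/r$, namely: • For $\varepsilon=\pm1$ there exist local solutions near $0$ such that $\lim_{r\to0}r^{\frac{N-p}{p-1}}w=k>0$ and $\lim_{r\to0}r^{\frac{N-1}{p-1}}w'=c(k)>0$.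 • For $\varepsilon=\pm1$ there exists an infinity with 2 parameters of local solutions near $0$ such that $\lim_{r\to0}w=C>0$ and $\lim_{r\to0}r^{\frac{N-1}{p-1}}|\ln r|^{-\frac1{p-1}}w'=\varepsilon c(C)$. • For $\varepsilon=-1$ there exists the solution $w^*=a^*r^{\frac{N-p}{q+1-p}}$, which has a finite limit as $r\to\infty$. There exist local solutions near $\infty$ such that $w\sim w^*$ as $r\to\infty$, and local ones near $0$ such that $w\sim w^*$ as $r\to0$. There exists an infinity of solutions such that $$w\sim w^*\ \text{ as } r\to\infty,\qquad \lim_{r\to0}w=C>0,\qquad \lim_{r\to0}r^{\frac{N-1}{p-1}}|\ln r|^{-\frac1{p-1}}w'=-\Bigl(\frac{q+1-p}{p-N}\Bigr)^{\frac{q}{q+1-p}} .$$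
   Context: $N$ is not necessarily an integer. A positive solution $w$ on an interval $(0,\rho)$ is called $C^0$-regular if $w\in C^2(0,\rho)\cap C^0([0,\rho))$, that is, $\lim_{r\to0}w=c\ge0$. With $\gamma=\frac{p-N}{q+1-p}$, $a^*>0$ is defined by $(a^* )^{q-p+1}=\varepsilon|\gamma|^{p-2}\gamma\,(N-p-(p-1)\gamma)$ with $\varepsilon=-1$. A local solution near $0$ (resp. near $\infty$) is a positive solution on $(0,r_0)$ (resp. $(r_0,\infty)$) for some $r_0>0$. $c(k)$, $c(C)$ denote positive constants depending on their argument. $f\sim g$ means $f/g\to1$. The change of $r$ into $1/r$ refers to the substitution $\widehat w(\widehat r)=w(r)$, $\widehat r=1/r$, which turns the equation with $(N,\sigma)$ into the same equation with $(2p-N,-2p-\sigma)$.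
   Formalization: In the last item of (1) and (2), the limit of w' fixes C, so only one solution has the displayed value. Proved instead: for every C>0 a solution with w∼w* at one end, w→C at the other and derivative limit c(C) (−c(C) in (2)), and one solution having the displayed limit. *)

theory Defs
  imports "HOL-Analysis.Analysis" "HOL-Library.Landau_Symbols"
begin

definition p_flux :: "real \<Rightarrow> real \<Rightarrow> real" where
  "p_flux p x = \<bar>x\<bar> powr (p - 2) * x"

text \<open>Positive classical solutions on an open set \<open>I\<close> of positive reals. Only \<open>w\<close> and the flux
  are required to be differentiable: for \<open>p > 2\<close> a solution is not \<open>C\<^sup>2\<close> at a zero of \<open>w'\<close>.
  Since \<open>p_flux p\<close> is a homeomorphism for \<open>p > 1\<close>, the equation forces \<open>w'\<close> and the derivative
  of the flux to be continuous.\<close>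

definition positive_solution_on ::
    "real \<Rightarrow> real \<Rightarrow> real \<Rightarrow> real \<Rightarrow> real \<Rightarrow> real set \<Rightarrow> (real \<Rightarrow> real) \<Rightarrow> bool" where
  "positive_solution_on N \<sigma> p q \<epsilon> I w \<longleftrightarrow>
     (\<forall>r\<in>I. w r > 0 \<and>
        w differentiable (at r) \<and>
        (\<lambda>s. p_flux p (deriv w s)) differentiable (at r) \<and>
        - deriv (\<lambda>s. p_flux p (deriv w s)) r - (N - 1) / r * p_flux p (deriv w r)
          = \<epsilon> * r powr \<sigma> * w r powr q)"

definition local_solution_at_0 ::
    "real \<Rightarrow> real \<Rightarrow> real \<Rightarrow> real \<Rightarrow> real \<Rightarrow> (real \<Rightarrow> real) \<Rightarrow> bool" where
  "local_solution_at_0 N \<sigma> p q \<epsilon> w \<longleftrightarrow>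
     (\<exists>r0>0. positive_solution_on N \<sigma> p q \<epsilon> {0<..<r0} w)"

definition local_solution_at_infinity ::
    "real \<Rightarrow> real \<Rightarrow> real \<Rightarrow> real \<Rightarrow> real \<Rightarrow> (real \<Rightarrow> real) \<Rightarrow> bool" where
  "local_solution_at_infinity N \<sigma> p q \<epsilon> w \<longleftrightarrow>
     (\<exists>r0>0. positive_solution_on N \<sigma> p q \<epsilon> {r0<..} w)"

definition C2_on :: "real set \<Rightarrow> (real \<Rightarrow> real) \<Rightarrow> bool" where
  "C2_on I w \<longleftrightarrow>
     (\<forall>r\<in>I. w differentiable (at r) \<and> deriv w differentiable (at r)) \<and>
     continuous_on I (deriv (deriv w))"

text \<open>Membership in \<open>C\<^sup>0([0,\<rho>))\<close> is understood after extending \<open>w\<close> by its limit, so the value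
  \<open>w 0\<close> is irrelevant.\<close>

definition C0_regular_solution ::
    "real \<Rightarrow> real \<Rightarrow> real \<Rightarrow> real \<Rightarrow> real \<Rightarrow> real \<Rightarrow> (real \<Rightarrow> real) \<Rightarrow> bool" where
  "C0_regular_solution N \<sigma> p q \<epsilon> \<rho> w \<longleftrightarrow>
     positive_solution_on N \<sigma> p q \<epsilon> {0<..<\<rho>} w \<and> C2_on {0<..<\<rho>} w \<and>
     (\<exists>c\<ge>0. (w \<longlongrightarrow> c) (at_right 0))"

definition scaling_exponent :: "real \<Rightarrow> real \<Rightarrow> real \<Rightarrow> real" where
  "scaling_exponent N p q = (p - N) / (q + 1 - p)"

text \<open>The constant \<open>a\<^sup>*\<close> for \<open>\<epsilon> = -1\<close>.\<close>

definition a_star :: "real \<Rightarrow> real \<Rightarrow> real \<Rightarrow> real" where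
  "a_star N p q =
     (THE a. a > 0 \<and>
        a powr (q - p + 1) =
          (-1) * \<bar>scaling_exponent N p q\<bar> powr (p - 2) * scaling_exponent N p q *
            (N - p - (p - 1) * scaling_exponent N p q))"

lemma a_star:
  assumes "p - 1 > 0" "q > p - 1" "N \<noteq> p"
  shows "a_star N p q > 0"
    and "a_star N p q powr (q - p + 1) =
          (-1) * \<bar>scaling_exponent N p q\<bar> powr (p - 2) * scaling_exponent N p q *
            (N - p - (p - 1) * scaling_exponent N p q)" (is "_ = ?X")
proof -
  define g where "g = scaling_exponent N p q"
  have "g * (N - p - (p - 1) * g) < 0"
  proof (cases "N > p")
    case True
    then have "g < 0" using assms by (simp add: g_def scaling_exponent_def divide_neg_pos)
    moreover from this have "(p - 1) * g < 0" using assms by (simp add: mult_pos_neg)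
    ultimately show ?thesis using True by (intro mult_neg_pos) auto
  next
    case False
    then have "g > 0" using assms by (simp add: g_def scaling_exponent_def)
    moreover from this have "(p - 1) * g > 0" using assms by simp
    ultimately show ?thesis using False by (intro mult_pos_neg) auto
  qed
  moreover from this have "g \<noteq> 0" by auto
  ultimately have "\<bar>g\<bar> powr (p - 2) * (- (g * (N - p - (p - 1) * g))) > 0"
    by (intro mult_pos_pos) auto
  then have X: "?X > 0" unfolding g_def[symmetric] by (simp add: algebra_simps)
  have "\<exists>!a::real. a > 0 \<and> a powr (q - p + 1) = Y" if "Y > 0" for Y
  proof (rule ex1I[of _ "Y powr (1 / (q - p + 1))"])
    show "Y powr (1 / (q - p + 1)) > 0 \<and> (Y powr (1 / (q - p + 1))) powr (q - p + 1) = Y"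
      using that assms by (simp add: powr_powr)
  next
    fix a :: real assume "a > 0 \<and> a powr (q - p + 1) = Y"
    then show "a = Y powr (1 / (q - p + 1))"
      using assms by (auto simp: powr_powr)
  qed
  from theI'[OF this[OF X]] show "a_star N p q > 0" "a_star N p q powr (q - p + 1) = ?X"
    unfolding a_star_def by blast+
qed

definition w_star :: "real \<Rightarrow> real \<Rightarrow> real \<Rightarrow> real \<Rightarrow> real" where
  "w_star N p q r = a_star N p q * r powr ((N - p) / (q + 1 - p))"

text \<open>An infinity with two parameters: a family \<open>W C d\<close>, with \<open>C > 0\<close> and \<open>d\<close> real, depending
  continuously on its parameters, in which distinct parameters give distinct germs. The member
  \<open>W C d\<close> lives on \<open>(R C d, \<infinity>)\<close>, respectively on \<open>(0, R C d)\<close>; as \<open>R\<close> is continuous, the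
  domain in the variables \<open>(C, d, r)\<close> is open. Comparing germs avoids counting one solution
  several times because of its values outside its domain.\<close>

definition two_parameter_family_at_infinity ::
    "(real \<Rightarrow> real \<Rightarrow> real \<Rightarrow> real) \<Rightarrow> (real \<Rightarrow> real \<Rightarrow> real) \<Rightarrow> bool" where
  "two_parameter_family_at_infinity W R \<longleftrightarrow>
     (\<forall>C>0. \<forall>d. R C d > 0) \<and>
     continuous_on {(C, d). C > 0} (\<lambda>(C, d). R C d) \<and>
     continuous_on {(C, d, r). C > 0 \<and> R C d < r} (\<lambda>(C, d, r). W C d r) \<and>
     (\<forall>C>0. \<forall>C'>0. \<forall>d d'. (C, d) \<noteq> (C', d') \<longrightarrow>
        \<not> (\<forall>\<^sub>F r in at_top. W C d r = W C' d' r))"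

definition two_parameter_family_at_0 ::
    "(real \<Rightarrow> real \<Rightarrow> real \<Rightarrow> real) \<Rightarrow> (real \<Rightarrow> real \<Rightarrow> real) \<Rightarrow> bool" where
  "two_parameter_family_at_0 W R \<longleftrightarrow>
     (\<forall>C>0. \<forall>d. R C d > 0) \<and>
     continuous_on {(C, d). C > 0} (\<lambda>(C, d). R C d) \<and>
     continuous_on {(C, d, r). C > 0 \<and> 0 < r \<and> r < R C d} (\<lambda>(C, d, r). W C d r) \<and>
     (\<forall>C>0. \<forall>C'>0. \<forall>d d'. (C, d) \<noteq> (C', d') \<longrightarrow>
        \<not> (\<forall>\<^sub>F r in at_right 0. W C d r = W C' d' r))"

end

theory Submission
  imports Defs "HOL-Real_Asymp.Real_Asymp"
begin

text \<open>
Put \<open>t = ln r\<close>, \<open>m = 1 / (p - 1)\<close>, \<open>\<beta> = (N - p) / (p - 1)\<close> and let \<open>F\<close> be \<open>r powr (N - 1)\<close> times the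
\<open>p\<close>-flux of \<open>w\<close>. Because \<open>\<sigma> = - N\<close>, the equation becomes the first order system
\<open>dw/dt = exp (- \<beta> t) \<psi>(F)\<close>, \<open>dF/dt = - \<epsilon> w powr q\<close>, where \<open>\<psi>\<close> is the inverse of the \<open>p\<close>-flux. All solutions
below have an \<open>F\<close> of constant sign, \<open>F = - a G\<close> with \<open>G > 0\<close> and \<open>a = 1\<close> or \<open>a = -1\<close>, so that
\<open>dw/dt = - a exp (- \<beta> t) G powr m\<close> and \<open>dG/dt = a \<epsilon> w powr q\<close> (lemma \<open>log_solution\<close>). The inversion of the
radius exchanges \<open>N\<close> and \<open>2 p - N\<close> (lemma \<open>inversion\<close>), hence everything is reduced to \<open>N > p\<close>, that is, \<open>\<beta> > 0\<close>.

For \<open>\<beta> > 0\<close> the weight \<open>exp (- \<beta> t)\<close> is integrable at infinity, and solutions can be prescribed there.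
Either \<open>w\<close> tends to \<open>0\<close> and \<open>F\<close> to a nonzero constant, and then \<open>w\<close> is asymptotic to a multiple of
\<open>exp (- \<beta> t)\<close> (lemma \<open>decaying_solution\<close>); or \<open>w\<close> tends to \<open>C > 0\<close>, and then \<open>F\<close> grows linearly in \<open>t\<close>,
whence the logarithm in the statement (lemma \<open>constant_limit_family\<close>). In the second case \<open>F\<close> carries a
free additive constant, the second parameter of the family. Both constructions are fixed points of a
contraction that integrates from infinity (lemma \<open>tail_fixed_point\<close>). The additive constant enters it as a
translation, which gives continuity with respect to it; the value of \<open>C\<close> is adjusted by scaling.

For \<open>\<epsilon> = -1\<close> and \<open>F > 0\<close>, rescaling time and the unknowns gives the normal form
\<open>u' = exp (- (q m - 1) t) v powr m\<close>, \<open>v' = q u powr q\<close>, in which \<open>w_star\<close> is the solution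
\<open>(exp t, exp (q t))\<close>. In the variables \<open>u exp (- t)\<close>, \<open>v exp (- q t)\<close> this is an autonomous cooperative planar
system, with a saddle at \<open>(1, 1)\<close> because \<open>q m > 1\<close>. The solutions asymptotic to \<open>w_star\<close> at \<open>0\<close> and at
infinity form its unstable and its stable manifold. Integrating from minus infinity is a monotone operation
on \<open>(u, v)\<close>, and integrating from infinity is one on \<open>(u, - v)\<close>; therefore points of both manifolds are
obtained by monotone iteration, as soon as there are ordered barriers whose distance vanishes in the limit
(lemma \<open>solution_between_barriers\<close>). The barriers are explicit: in logarithmic coordinates they are multiples
of \<open>s\<close>, \<open>ln (1 + k s) / k\<close> or \<open>- ln (1 - k s) / k\<close>, where \<open>s\<close> is the exponential given by an eigenvalue of the
saddle, and the required inequalities follow from the convexity of \<open>exp\<close>. On the unstable side the upper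
barrier stays bounded for \<open>u\<close>; hence \<open>w\<close> has a positive limit (lemma \<open>connecting_orbit\<close>), and a translation in
time turns this limit into any prescribed \<open>C\<close>.
\<close>

section \<open>Integrals from infinity\<close>

definition tail :: "(real \<Rightarrow> real) \<Rightarrow> real \<Rightarrow> real" where
  "tail h t = (LINT s:{t..}|lborel. h s)"

text \<open>The integrals \<open>tail h t\<close> are controlled by a continuous majorant \<open>E\<close> of \<open>\<bar>h\<bar>\<close> whose tail \<open>P\<close>
is known in closed form. Giving \<open>P\<close> explicitly reduces every estimate of an improper integral to a
pointwise comparison of integrands. The set \<open>I\<close> is a half-line or the whole line.\<close>

locale tail_majorant =
  fixes I :: "real set" and E P :: "real \<Rightarrow> real"
  assumes open_I: "open I"
    and up_I: "t \<in> I \<Longrightarrow> t \<le> s \<Longrightarrow> s \<in> I"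
    and cont_E: "continuous_on I E"
    and nonneg_E: "t \<in> I \<Longrightarrow> 0 \<le> E t"
    and deriv_P: "t \<in> I \<Longrightarrow> (P has_real_derivative - E t) (at t)"
    and lim_P: "(P \<longlongrightarrow> 0) at_top"
begin

text \<open>Since \<open>E\<close> is nonnegative and \<open>- P\<close> is an antiderivative with limit \<open>0\<close>, the fundamental
theorem for nonnegative integrands gives integrability and the value at once.\<close>

lemma majorant_integral:
  assumes t: "t \<in> I"
  shows "set_integrable lborel {t..} E" and "tail E t = P t"
proof -
  define f where "f = (\<lambda>x. indicat_real {t..} x *\<^sub>R E x)"
  have f: "f x = E x" if "t \<le> x" for x
    using that by (simp add: f_def)
  have meas: "f \<in> borel_measurable borel"
    unfolding f_def
    by (intro borel_measurable_continuous_on_indicator continuous_on_subset[OF cont_E])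
       (use up_I[OF t] in auto)
  have nn: "0 \<le> f x" for x
    using nonneg_E up_I[OF t] by (auto simp: f_def indicator_def)
  have "(\<integral>\<^sup>+x. ennreal (f x) * indicator {t..} x \<partial>lborel) = ennreal (0 - (- P t))"
  proof (rule nn_integral_FTC_atLeast[OF meas])
    fix x assume "t \<le> x"
    then have "((\<lambda>x. - P x) has_real_derivative - (- E x)) (at x)"
      using up_I t by (intro DERIV_minus deriv_P) auto
    then show "((\<lambda>x. - P x) has_real_derivative f x) (at x)"
      using f \<open>t \<le> x\<close> by simp
  next
    show "((\<lambda>x. - P x) \<longlongrightarrow> 0) at_top"
      using tendsto_minus[OF lim_P] by simp
  qed (use nn in auto)
  also have "(\<integral>\<^sup>+x. ennreal (f x) * indicator {t..} x \<partial>lborel) = (\<integral>\<^sup>+x. ennreal (f x) \<partial>lborel)"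
    by (intro nn_integral_cong) (auto simp: f_def indicator_def)
  finally have nnint: "(\<integral>\<^sup>+x. ennreal (f x) \<partial>lborel) = ennreal (P t)" by simp
  have "P t \<ge> 0"
  proof (rule tendsto_upperbound[OF lim_P])
    show "\<forall>\<^sub>F x in at_top. P x \<le> P t"
    proof (rule eventually_mono[OF eventually_ge_at_top[of t]])
      fix x assume "t \<le> x"
      then show "P x \<le> P t"
      proof (rule DERIV_nonpos_imp_nonincreasing)
        fix y assume "t \<le> y" "y \<le> x"
        then have "y \<in> I" using up_I t by blast
        then show "\<exists>y'. (P has_real_derivative y') (at y) \<and> y' \<le> 0"
          using deriv_P nonneg_E by (intro exI[of _ "- E y"]) auto
      qed
    qed
  qed simp
  have hb: "has_bochner_integral lborel f (P t)"
    by (rule has_bochner_integral_nn_integral) (use meas nn nnint \<open>P t \<ge> 0\<close> in auto)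
  show "set_integrable lborel {t..} E"
    using has_bochner_integral_iff[THEN iffD1, OF hb] unfolding set_integrable_def f_def by blast
  show "tail E t = P t"
    using has_bochner_integral_iff[THEN iffD1, OF hb]
    unfolding tail_def set_lebesgue_integral_def f_def by blast
qed

lemma majorant_integrable_on:
  assumes "t \<in> I" "continuous_on I h" "\<And>s. s \<in> I \<Longrightarrow> \<bar>h s\<bar> \<le> E s"
  shows "set_integrable lborel {t..} h"
proof (rule set_integrable_bound[OF majorant_integral(1)[OF assms(1)]])
  show "set_borel_measurable lborel {t..} h"
    unfolding set_borel_measurable_def
    using borel_measurable_continuous_on_indicator[of "{t..}" h]
      continuous_on_subset[OF assms(2), of "{t..}"] up_I[OF assms(1)] by auto
  show "AE x in lborel. x \<in> {t..} \<longrightarrow> norm (h x) \<le> norm (E x)"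
    using assms up_I[OF assms(1)] nonneg_E by (auto intro!: AE_I2)
qed

lemma tail_mono:
  assumes "t \<in> I" "continuous_on I h" "\<And>s. s \<in> I \<Longrightarrow> \<bar>h s\<bar> \<le> E s"
    "continuous_on I g" "\<And>s. s \<in> I \<Longrightarrow> \<bar>g s\<bar> \<le> E s"
    and le: "\<And>s. t \<le> s \<Longrightarrow> h s \<le> g s"
  shows "tail h t \<le> tail g t"
  unfolding tail_def
  by (rule set_integral_mono)
     (use assms majorant_integrable_on[OF assms(1-3)] majorant_integrable_on[OF assms(1,4,5)] in auto)

lemma tail_abs:
  assumes "t \<in> I" "continuous_on I h" "\<And>s. s \<in> I \<Longrightarrow> \<bar>h s\<bar> \<le> E s"
  shows "\<bar>tail h t\<bar> \<le> P t"
proof -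
  have "tail h t \<le> tail E t"
    by (rule tail_mono)
       (use assms(3) cont_E nonneg_E up_I[OF assms(1)] in \<open>auto simp: abs_le_iff assms(1,2)\<close>)
  moreover have "tail (\<lambda>s. - E s) t \<le> tail h t"
    by (rule tail_mono)
       (use assms(3) continuous_on_minus[OF cont_E] nonneg_E up_I[OF assms(1)]
        in \<open>auto simp: abs_le_iff minus_le_iff assms(1,2)\<close>)
  moreover have "tail (\<lambda>s. - E s) t = - tail E t"
    unfolding tail_def by (rule set_integral_uminus[OF majorant_integral(1)[OF assms(1)]])
  ultimately show ?thesis using majorant_integral(2)[OF assms(1)] by auto
qed

lemma tail_diff:
  assumes "t \<in> I" "continuous_on I h" "\<And>s. s \<in> I \<Longrightarrow> \<bar>h s\<bar> \<le> E s"
    "continuous_on I g" "\<And>s. s \<in> I \<Longrightarrow> \<bar>g s\<bar> \<le> E s"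
  shows "tail h t - tail g t = tail (\<lambda>s. h s - g s) t"
  unfolding tail_def
  by (rule set_integral_diff(2)[symmetric])
     (use majorant_integrable_on[OF assms(1-3)] majorant_integrable_on[OF assms(1,4,5)] in auto)

text \<open>Near \<open>t\<close> the tail differs by a constant from an integral over a compact interval.\<close>

lemma tail_has_derivative:
  assumes t: "t \<in> I" and h: "continuous_on I h" "\<And>s. s \<in> I \<Longrightarrow> \<bar>h s\<bar> \<le> E s"
  shows "(tail h has_real_derivative - h t) (at t)"
proof -
  obtain e where e: "e > 0" "cball t e \<subseteq> I"
    using open_I t open_contains_cball by blast
  define a b where "a = t - e" and "b = t + e"
  have ab: "a < t" "t < b" "{a..b} \<subseteq> I"
    using e by (auto simp: a_def b_def cball_eq_atLeastAtMost)
  have aI: "x \<in> I" if "a \<le> x" for x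
  proof -
    have "a \<in> I" using ab by auto
    then show ?thesis using up_I that by blast
  qed
  have HK: "h integrable_on {x..}" "tail h x = integral {x..} h" if "a \<le> x" for x
    using set_borel_integral_eq_integral[OF majorant_integrable_on[OF aI[OF that] h]]
    by (auto simp: tail_def)
  have eq: "tail h x = tail h a - integral {a..x} h" if "x \<in> {a..b}" for x
  proof -
    have cx: "continuous_on {a..x} h"
      by (rule continuous_on_subset[OF h(1)]) (use aI in auto)
    have "integral ({a..x} \<union> {x..}) h = integral {a..x} h + integral {x..} h"
      by (rule integral_Un)
         (use that HK cx in \<open>auto intro!: integrable_continuous_real negligible_subset[of "{x}"]\<close>)
    moreover have "{a..x} \<union> {x..} = {a..}" using that by auto
    ultimately show ?thesis using HK that by auto
  qed
  have "((\<lambda>x. integral {a..x} h) has_real_derivative h t) (at t within {a..b})"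
    by (rule integral_has_real_derivative[OF continuous_on_subset[OF h(1)]]) (use ab in auto)
  then have "((\<lambda>x. integral {a..x} h) has_real_derivative h t) (at t)"
    using at_within_Icc_at[of a t b] ab by simp
  then have "((\<lambda>x. tail h a - integral {a..x} h) has_real_derivative 0 - h t) (at t)"
    by (intro DERIV_diff) auto
  then have "((\<lambda>x. tail h a - integral {a..x} h) has_real_derivative - h t) (at t)" by simp
  then show ?thesis
  proof (rule has_field_derivative_transform_within_open)
    show "tail h a - integral {a..x} h = tail h x" if "x \<in> {a<..<b}" for x
      using eq[of x] that by simp
  qed (use ab in auto)
qed

lemma tail_continuous_on:
  assumes "continuous_on I h" "\<And>s. s \<in> I \<Longrightarrow> \<bar>h s\<bar> \<le> E s"
  shows "continuous_on I (tail h)"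
  by (rule DERIV_continuous_on[of I _ "\<lambda>t. - h t"])
     (use tail_has_derivative[OF _ assms] in \<open>auto intro: has_field_derivative_at_within\<close>)

lemma tail_lim:
  assumes "I \<noteq> {}" "continuous_on I h" "\<And>s. s \<in> I \<Longrightarrow> \<bar>h s\<bar> \<le> E s"
  shows "(tail h \<longlongrightarrow> 0) at_top"
proof (rule Lim_null_comparison[OF _ lim_P])
  obtain t where "t \<in> I" using assms(1) by blast
  show "\<forall>\<^sub>F x in at_top. norm (tail h x) \<le> P x"
    by (rule eventually_mono[OF eventually_ge_at_top[of t]])
       (use tail_abs[OF _ assms(2,3)] up_I[OF \<open>t \<in> I\<close>] in auto)
qed

lemma tail_dominated_convergence:
  assumes t: "t \<in> I"
    and hn: "\<And>n. continuous_on I (h n)" "\<And>n s. s \<in> I \<Longrightarrow> \<bar>h n s\<bar> \<le> E s"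
    and conv: "\<And>s. s \<in> I \<Longrightarrow> (\<lambda>n. h n s) \<longlonglongrightarrow> g s" and g: "continuous_on I g"
  shows "(\<lambda>n. tail (h n) t) \<longlonglongrightarrow> tail g t"
  unfolding tail_def set_lebesgue_integral_def
proof (rule integral_dominated_convergence[where w = "\<lambda>s. indicat_real {t..} s *\<^sub>R E s"])
  have m: "(\<lambda>x. indicat_real {t..} x *\<^sub>R f x) \<in> borel_measurable lborel" if "continuous_on I f"
    for f :: "real \<Rightarrow> real"
    using borel_measurable_continuous_on_indicator[of "{t..}" f]
      continuous_on_subset[OF that, of "{t..}"] up_I[OF t] by auto
  show "(\<lambda>x. indicat_real {t..} x *\<^sub>R g x) \<in> borel_measurable lborel"
    "\<And>n. (\<lambda>x. indicat_real {t..} x *\<^sub>R h n x) \<in> borel_measurable lborel"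
    using m g hn by auto
  show "integrable lborel (\<lambda>s. indicat_real {t..} s *\<^sub>R E s)"
    using majorant_integral(1)[OF t] unfolding set_integrable_def .
  show "AE x in lborel. (\<lambda>n. indicat_real {t..} x *\<^sub>R h n x) \<longlonglongrightarrow> indicat_real {t..} x *\<^sub>R g x"
    using conv up_I[OF t] by (auto intro!: AE_I2 simp: indicator_def)
  show "AE x in lborel. norm (indicat_real {t..} x *\<^sub>R h n x) \<le> indicat_real {t..} x *\<^sub>R E x" for n
    using hn(2) up_I[OF t] by (auto intro!: AE_I2 simp: indicator_def)
qed

end

section \<open>Monotone iteration between barriers\<close>

text \<open>One half of a monotone system \<open>U' = - f(t, V)\<close>, \<open>V' = - g(t, U)\<close>, integrated from infinity. The
functions \<open>lower\<close> and \<open>upper\<close> bound \<open>U\<close>, while \<open>below\<close> and \<open>above\<close> bound \<open>V\<close>. The gap between the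
barriers tends to \<open>0\<close>, which replaces a boundary condition at infinity: the barriers themselves may be
unbounded there. The derivatives carry a minus sign, so that \<open>lower'\<close> and \<open>upper'\<close> are
compared with \<open>f\<close> directly.\<close>

locale barrier =
  fixes I :: "real set" and f :: "real \<Rightarrow> real \<Rightarrow> real"
    and lower upper lower' upper' below above :: "real \<Rightarrow> real"
  assumes open_domain: "open I"
    and up_domain: "t \<in> I \<Longrightarrow> t \<le> s \<Longrightarrow> s \<in> I"
    and deriv_lower: "t \<in> I \<Longrightarrow> (lower has_real_derivative - lower' t) (at t)"
    and deriv_upper: "t \<in> I \<Longrightarrow> (upper has_real_derivative - upper' t) (at t)"
    and cont_lower': "continuous_on I lower'" and cont_upper': "continuous_on I upper'"
    and gap: "((\<lambda>t. upper t - lower t) \<longlongrightarrow> 0) at_top"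
    and below_above: "t \<in> I \<Longrightarrow> below t \<le> above t"
    and sub: "t \<in> I \<Longrightarrow> lower' t \<le> f t (below t)"
    and super: "t \<in> I \<Longrightarrow> f t (above t) \<le> upper' t"
    and mono: "t \<in> I \<Longrightarrow> below t \<le> x \<Longrightarrow> x \<le> y \<Longrightarrow> y \<le> above t \<Longrightarrow> f t x \<le> f t y"
    and cont_f: "continuous_on {(t, y). t \<in> I \<and> below t \<le> y \<and> y \<le> above t} (\<lambda>(t, y). f t y)"
begin

sublocale tail_majorant I "\<lambda>t. upper' t - lower' t" "\<lambda>t. upper t - lower t"
proof
  show "open I" by (rule open_domain)
  show "continuous_on I (\<lambda>t. upper' t - lower' t)"
    by (intro continuous_intros cont_upper' cont_lower')
  show "((\<lambda>t. upper t - lower t) \<longlongrightarrow> 0) at_top" by (rule gap)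
  fix t assume t: "t \<in> I"
  show "s \<in> I" if "t \<le> s" for s using up_domain t that .
  show "0 \<le> upper' t - lower' t"
    using sub[OF t] super[OF t] mono[OF t, of "below t" "above t"] below_above[OF t] by auto
  show "((\<lambda>t. upper t - lower t) has_real_derivative - (upper' t - lower' t)) (at t)"
    using DERIV_diff[OF deriv_upper[OF t] deriv_lower[OF t]] by (simp add: algebra_simps)
qed

definition admissible :: "(real \<Rightarrow> real) \<Rightarrow> bool" where
  "admissible V \<longleftrightarrow> continuous_on I V \<and> (\<forall>t\<in>I. below t \<le> V t \<and> V t \<le> above t)"

text \<open>Only the difference to the lower barrier is integrated, because \<open>f s (V s)\<close> alone may fail to be
integrable at infinity. The difference lies between \<open>0\<close> and \<open>upper' - lower'\<close>, whose tail is the gap.\<close>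

definition integrate :: "(real \<Rightarrow> real) \<Rightarrow> real \<Rightarrow> real" where
  "integrate V t = lower t + tail (\<lambda>s. f s (V s) - lower' s) t"

lemma continuous_integrand:
  assumes "admissible V"
  shows "continuous_on I (\<lambda>s. f s (V s) - lower' s)"
proof -
  have "continuous_on I (\<lambda>s. (s, V s))"
    using assms by (intro continuous_intros) (auto simp: admissible_def)
  moreover have "(\<lambda>s. (s, V s)) ` I \<subseteq> {(t, y). t \<in> I \<and> below t \<le> y \<and> y \<le> above t}"
    using assms by (auto simp: admissible_def)
  ultimately have "continuous_on I (\<lambda>s. case (s, V s) of (t, y) \<Rightarrow> f t y)"
    by (rule continuous_on_compose2[OF cont_f])
  then show ?thesis using cont_lower' by (auto intro: continuous_on_diff)
qed

lemma integrand_bounds: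
  assumes "admissible V" "t \<in> I"
  shows "0 \<le> f t (V t) - lower' t" "f t (V t) - lower' t \<le> upper' t - lower' t"
    "\<bar>f t (V t) - lower' t\<bar> \<le> upper' t - lower' t"
proof -
  have "below t \<le> V t" "V t \<le> above t" using assms by (auto simp: admissible_def)
  then show "0 \<le> f t (V t) - lower' t" "f t (V t) - lower' t \<le> upper' t - lower' t"
    using mono[OF assms(2), of "below t" "V t"] mono[OF assms(2), of "V t" "above t"]
      sub[OF assms(2)] super[OF assms(2)] by auto
  then show "\<bar>f t (V t) - lower' t\<bar> \<le> upper' t - lower' t" by simp
qed

lemma integrate_has_derivative:
  assumes "admissible V" "t \<in> I"
  shows "(integrate V has_real_derivative - f t (V t)) (at t)"
proof -
  have "(integrate V has_real_derivative - lower' t + - (f t (V t) - lower' t)) (at t)"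
    unfolding integrate_def
    by (intro DERIV_add deriv_lower tail_has_derivative continuous_integrand integrand_bounds assms)
  then show ?thesis by simp
qed

lemma integrate_continuous: "admissible V \<Longrightarrow> continuous_on I (integrate V)"
  by (rule DERIV_continuous_on[of I _ "\<lambda>t. - f t (V t)"])
     (auto intro: has_field_derivative_at_within integrate_has_derivative)

text \<open>Both \<open>integrate V - lower\<close> and \<open>upper - integrate V\<close> are nonincreasing. As they tend to \<open>0\<close>, this
yields the bounds by the barriers; it also gives a modulus of continuity independent of \<open>V\<close>,
which survives in pointwise limits.\<close>

lemma integrate_increment:
  assumes "admissible V" "s \<in> I" "s \<le> t"
  shows "0 \<le> (integrate V s - lower s) - (integrate V t - lower t)"
    "(integrate V s - lower s) - (integrate V t - lower t) \<le> (upper s - lower s) - (upper t - lower t)"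
proof -
  have I: "x \<in> I" if "s \<le> x" for x using up_domain assms(2) that by blast
  have d: "((\<lambda>t. integrate V t - lower t) has_real_derivative - f x (V x) - - lower' x) (at x)"
    if "s \<le> x" for x
    by (intro DERIV_diff deriv_lower integrate_has_derivative I assms that)
  have "integrate V t - lower t \<le> integrate V s - lower s"
  proof (rule DERIV_nonpos_imp_nonincreasing[OF assms(3)])
    fix x assume "s \<le> x" "x \<le> t"
    then show "\<exists>y. ((\<lambda>t. integrate V t - lower t) has_real_derivative y) (at x) \<and> y \<le> 0"
      using d[of x] integrand_bounds(1)[OF assms(1) I[of x]] by (intro exI conjI) auto
  qed
  then show "0 \<le> (integrate V s - lower s) - (integrate V t - lower t)" by simp
  have "upper t - lower t - (integrate V t - lower t) \<le> upper s - lower s - (integrate V s - lower s)"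
  proof (rule DERIV_nonpos_imp_nonincreasing[OF assms(3)])
    fix x assume x: "s \<le> x" "x \<le> t"
    have "((\<lambda>t. upper t - lower t - (integrate V t - lower t)) has_real_derivative
        - (upper' x - lower' x) - (- f x (V x) - - lower' x)) (at x)"
      by (intro DERIV_diff[OF deriv_P d] I x)
    then show "\<exists>y. ((\<lambda>t. upper t - lower t - (integrate V t - lower t)) has_real_derivative y) (at x)
        \<and> y \<le> 0"
      using integrand_bounds(2)[OF assms(1) I[of x]] x by (intro exI conjI) auto
  qed
  then show "(integrate V s - lower s) - (integrate V t - lower t)
      \<le> (upper s - lower s) - (upper t - lower t)"
    by simp
qed

lemma integrate_mono:
  assumes "admissible V" "admissible W" "\<And>s. s \<in> I \<Longrightarrow> V s \<le> W s" "t \<in> I"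
  shows "integrate V t \<le> integrate W t"
proof -
  have "f s (V s) \<le> f s (W s)" if "t \<le> s" for s
    using assms up_domain[OF assms(4) that] by (intro mono) (auto simp: admissible_def)
  then have "tail (\<lambda>s. f s (V s) - lower' s) t \<le> tail (\<lambda>s. f s (W s) - lower' s) t"
    by (intro tail_mono continuous_integrand integrand_bounds assms) simp_all
  then show ?thesis by (simp add: integrate_def)
qed

lemma integrate_bounds:
  assumes "admissible V" "t \<in> I"
  shows "lower t \<le> integrate V t" "integrate V t \<le> upper t"
proof -
  have lim: "((\<lambda>t. integrate V t - lower t) \<longlongrightarrow> 0) at_top"
    using tail_lim[OF _ continuous_integrand[OF assms(1)] integrand_bounds(3)[OF assms(1)]] assms(2)
    by (auto simp: integrate_def)
  have "0 \<le> integrate V t - lower t"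
    by (rule tendsto_upperbound[OF lim])
       (use integrate_increment(1)[OF assms] in \<open>auto intro!: eventually_mono[OF eventually_ge_at_top[of t]]\<close>)
  then show "lower t \<le> integrate V t" by simp
  have "((\<lambda>x. (upper x - lower x) - (integrate V x - lower x)) \<longlongrightarrow> 0 - 0) at_top"
    by (intro tendsto_diff gap lim)
  then have lim2: "((\<lambda>x. (upper x - lower x) - (integrate V x - lower x)) \<longlongrightarrow> 0) at_top" by simp
  have "0 \<le> (upper t - lower t) - (integrate V t - lower t)"
  proof (rule tendsto_upperbound[OF lim2])
    show "\<forall>\<^sub>F x in at_top. upper x - lower x - (integrate V x - lower x)
        \<le> upper t - lower t - (integrate V t - lower t)"
    proof (rule eventually_mono[OF eventually_ge_at_top[of t]])
      fix x assume "t \<le> x"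
      then show "upper x - lower x - (integrate V x - lower x)
          \<le> upper t - lower t - (integrate V t - lower t)"
        using integrate_increment(2)[OF assms, of x] by linarith
    qed
  qed simp
  then show "integrate V t \<le> upper t" by simp
qed

lemma integrate_limit:
  assumes "\<And>n. admissible (V n)" "admissible W" "\<And>s. s \<in> I \<Longrightarrow> (\<lambda>n. V n s) \<longlonglongrightarrow> W s" "t \<in> I"
  shows "(\<lambda>n. integrate (V n) t) \<longlonglongrightarrow> integrate W t"
  unfolding integrate_def
proof (intro tendsto_add tendsto_const tail_dominated_convergence)
  fix s assume s: "s \<in> I"
  have "continuous_on {y. below s \<le> y \<and> y \<le> above s} (\<lambda>y. case (s, y) of (t, y) \<Rightarrow> f t y)"
    by (rule continuous_on_compose2[OF cont_f, of _ "\<lambda>y. (s, y)"]) (auto intro!: continuous_intros s)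
  then have c: "continuous_on {y. below s \<le> y \<and> y \<le> above s} (f s)" by simp
  have "(\<lambda>n. f s (V n s)) \<longlonglongrightarrow> f s (W s)"
    by (rule continuous_on_tendsto_compose[OF c])
       (use assms s in \<open>auto simp: admissible_def intro!: always_eventually\<close>)
  then show "(\<lambda>n. f s (V n s) - lower' s) \<longlonglongrightarrow> f s (W s) - lower' s"
    by (intro tendsto_intros)
qed (use assms integrand_bounds continuous_integrand in auto)

text \<open>The uniform modulus of continuity makes pointwise limits of iterates continuous. Hence the limit is
again an admissible argument, and dominated convergence can be applied to it.\<close>

lemma limit_of_integrals_continuous:
  assumes "\<And>n. admissible (V n)" "\<And>t. t \<in> I \<Longrightarrow> (\<lambda>n. integrate (V n) t) \<longlonglongrightarrow> U t"
  shows "continuous_on I U"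
proof -
  define P where "P t = upper t - lower t" for t
  have cP: "continuous_on I P"
    unfolding P_def
    by (rule DERIV_continuous_on[of I _ "\<lambda>t. - (upper' t - lower' t)"])
       (rule has_field_derivative_at_within, rule deriv_P)
  have c_lower: "continuous_on I lower"
    by (rule DERIV_continuous_on[of I _ "\<lambda>t. - lower' t"])
       (auto intro: has_field_derivative_at_within deriv_lower)
  have inc: "\<bar>(U s - lower s) - (U t - lower t)\<bar> \<le> \<bar>P s - P t\<bar>" if "s \<in> I" "t \<in> I" "s \<le> t" for s t
  proof -
    have lim: "(\<lambda>n. (integrate (V n) s - lower s) - (integrate (V n) t - lower t))
        \<longlonglongrightarrow> (U s - lower s) - (U t - lower t)"
      by (intro tendsto_intros assms that)
    have "0 \<le> (U s - lower s) - (U t - lower t)"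
      by (rule LIMSEQ_le_const[OF lim]) (use integrate_increment(1) assms(1) that in blast)
    moreover have "(U s - lower s) - (U t - lower t) \<le> P s - P t"
      unfolding P_def
      by (rule LIMSEQ_le_const2[OF lim]) (use integrate_increment(2) assms(1) that in blast)
    ultimately show ?thesis by linarith
  qed
  have "continuous_on I (\<lambda>t. U t - lower t)"
    unfolding continuous_on_def
  proof
    fix t assume t: "t \<in> I"
    have "((\<lambda>s. (U s - lower s) - (U t - lower t)) \<longlongrightarrow> 0) (at t within I)"
    proof (rule Lim_null_comparison)
      show "\<forall>\<^sub>F s in at t within I. norm ((U s - lower s) - (U t - lower t)) \<le> \<bar>P s - P t\<bar>"
        unfolding eventually_at_filter
      proof (intro always_eventually allI impI)
        fix s assume "s \<in> I"
        then show "norm ((U s - lower s) - (U t - lower t)) \<le> \<bar>P s - P t\<bar>"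
          using inc[of s t] inc[of t s] t by (cases "s \<le> t") auto
      qed
      have "(P \<longlongrightarrow> P t) (at t within I)" using cP t by (simp add: continuous_on_def)
      then show "((\<lambda>s. \<bar>P s - P t\<bar>) \<longlongrightarrow> 0) (at t within I)"
        by (simp add: LIM_zero tendsto_rabs_zero)
    qed
    then show "((\<lambda>t. U t - lower t) \<longlongrightarrow> U t - lower t) (at t within I)"
      by (rule LIM_zero_cancel)
  qed
  from continuous_on_add[OF this c_lower] show ?thesis by simp
qed

end

text \<open>Starting from the lower barriers, the two integral operators are applied simultaneously. Both
sequences increase and are bounded by the upper barriers; their limits form a fixed point, which
solves the system.\<close>

lemma solution_between_barriers:
  assumes U: "barrier I f Um Up um up Vm Vp" and V: "barrier I g Vm Vp vm vp Um Up"
  obtains U V where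
    "\<And>t. t \<in> I \<Longrightarrow> (U has_real_derivative - f t (V t)) (at t)"
    "\<And>t. t \<in> I \<Longrightarrow> (V has_real_derivative - g t (U t)) (at t)"
    "\<And>t. t \<in> I \<Longrightarrow> Um t \<le> U t \<and> U t \<le> Up t"
    "\<And>t. t \<in> I \<Longrightarrow> Vm t \<le> V t \<and> V t \<le> Vp t"
proof -
  interpret U: barrier I f Um Up um up Vm Vp by (rule U)
  interpret V: barrier I g Vm Vp vm vp Um Up by (rule V)
  define X where "X = rec_nat (Um, Vm) (\<lambda>_ Z. (U.integrate (snd Z), V.integrate (fst Z)))"
  define A B where "A n = fst (X n)" and "B n = snd (X n)" for n
  have zero: "A 0 = Um" "B 0 = Vm" by (simp_all add: A_def B_def X_def)
  have step: "A (Suc n) = U.integrate (B n)" "B (Suc n) = V.integrate (A n)" for n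
    by (simp_all add: A_def B_def X_def)
  have cont_Um: "continuous_on I Um"
    by (rule DERIV_continuous_on[of I _ "\<lambda>t. - um t"])
       (auto intro: has_field_derivative_at_within U.deriv_lower)
  have cont_Vm: "continuous_on I Vm"
    by (rule DERIV_continuous_on[of I _ "\<lambda>t. - vm t"])
       (auto intro: has_field_derivative_at_within V.deriv_lower)
  have adm: "V.admissible (A n) \<and> U.admissible (B n)" for n
  proof (induction n)
    case 0
    then show ?case
      using cont_Um cont_Vm U.below_above V.below_above
      by (auto simp: U.admissible_def V.admissible_def zero)
  next
    case (Suc n)
    then show ?case
      using U.integrate_continuous V.integrate_continuous U.integrate_bounds V.integrate_bounds
      by (simp add: U.admissible_def[of "V.integrate (A n)"] V.admissible_def[of "U.integrate (B n)"] step)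
  qed
  have incr: "\<forall>t\<in>I. A n t \<le> A (Suc n) t \<and> B n t \<le> B (Suc n) t" for n
  proof (induction n)
    case 0
    then show ?case
      using U.integrate_bounds(1)[of "B 0"] V.integrate_bounds(1)[of "A 0"] adm[of 0]
      by (auto simp: step zero)
  next
    case (Suc n)
    then show ?case
      using U.integrate_mono[of "B n" "B (Suc n)"] V.integrate_mono[of "A n" "A (Suc n)"]
        adm[of n] adm[of "Suc n"] by (simp add: step)
  qed
  have bA: "Um t \<le> A n t" "A n t \<le> Up t" if "t \<in> I" for n t
    using adm[of n] that by (auto simp: V.admissible_def)
  have bB: "Vm t \<le> B n t" "B n t \<le> Vp t" if "t \<in> I" for n t
    using adm[of n] that by (auto simp: U.admissible_def)
  have "\<exists>l. (\<lambda>n. A n t) \<longlonglongrightarrow> l" if "t \<in> I" for t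
    by (rule incseq_convergent[of "\<lambda>n. A n t" "Up t"])
       (use incr bA that in \<open>auto intro: incseq_SucI\<close>)
  then obtain Uf where Uf: "\<And>t. t \<in> I \<Longrightarrow> (\<lambda>n. A n t) \<longlonglongrightarrow> Uf t" by metis
  have "\<exists>l. (\<lambda>n. B n t) \<longlonglongrightarrow> l" if "t \<in> I" for t
    by (rule incseq_convergent[of "\<lambda>n. B n t" "Vp t"])
       (use incr bB that in \<open>auto intro: incseq_SucI\<close>)
  then obtain Vf where Vf: "\<And>t. t \<in> I \<Longrightarrow> (\<lambda>n. B n t) \<longlonglongrightarrow> Vf t" by metis
  have bU: "Um t \<le> Uf t" "Uf t \<le> Up t" if "t \<in> I" for t
    using LIMSEQ_le_const[OF Uf[OF that]] LIMSEQ_le_const2[OF Uf[OF that]] bA[OF that] by blast+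
  have bV: "Vm t \<le> Vf t" "Vf t \<le> Vp t" if "t \<in> I" for t
    using LIMSEQ_le_const[OF Vf[OF that]] LIMSEQ_le_const2[OF Vf[OF that]] bB[OF that] by blast+
  have SU: "(\<lambda>n. U.integrate (B n) t) \<longlonglongrightarrow> Uf t" if "t \<in> I" for t
    using LIMSEQ_Suc[OF Uf[OF that]] by (simp add: step)
  have SV: "(\<lambda>n. V.integrate (A n) t) \<longlonglongrightarrow> Vf t" if "t \<in> I" for t
    using LIMSEQ_Suc[OF Vf[OF that]] by (simp add: step)
  have admV: "U.admissible Vf"
    using V.limit_of_integrals_continuous[of A Vf] SV adm bV by (auto simp: U.admissible_def)
  have admU: "V.admissible Uf"
    using U.limit_of_integrals_continuous[of B Uf] SU adm bU by (auto simp: V.admissible_def)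
  have eqU: "Uf t = U.integrate Vf t" if "t \<in> I" for t
    using LIMSEQ_unique[OF SU[OF that] U.integrate_limit[of B Vf]] adm admV Vf that by blast
  have eqV: "Vf t = V.integrate Uf t" if "t \<in> I" for t
    using LIMSEQ_unique[OF SV[OF that] V.integrate_limit[of A Uf]] adm admU Uf that by blast
  show thesis
  proof
    fix t assume t: "t \<in> I"
    show "(Uf has_real_derivative - f t (Vf t)) (at t)"
      by (rule has_field_derivative_transform_within_open[OF U.integrate_has_derivative[OF admV t]
            U.open_domain t]) (simp add: eqU)
    show "(Vf has_real_derivative - g t (Uf t)) (at t)"
      by (rule has_field_derivative_transform_within_open[OF V.integrate_has_derivative[OF admU t]
            V.open_domain t]) (simp add: eqV)
  qed (use bU bV in auto)
qed

section \<open>Fixed points of contractions integrated from infinity\<close>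

lemma exponential_majorant:
  fixes T L \<theta> :: real
  assumes "\<theta> > 0" "L \<ge> 0"
  shows "tail_majorant {T<..} (\<lambda>s. L * exp (- \<theta> * s)) (\<lambda>s. L / \<theta> * exp (- \<theta> * s))"
proof
  show "((\<lambda>s. L / \<theta> * exp (- \<theta> * s)) \<longlongrightarrow> 0) at_top"
    using assms by real_asymp
qed (use assms in \<open>auto intro!: continuous_intros derivative_eq_intros\<close>)

lemma tail_exp_Lipschitz:
  fixes h g :: "real \<Rightarrow> real"
  assumes "\<theta> > 0" "T < t" "continuous_on {T<..} h" "continuous_on {T<..} g"
    and h: "\<And>s. T < s \<Longrightarrow> \<bar>h s\<bar> \<le> M * exp (- \<theta> * s)"
    and g: "\<And>s. T < s \<Longrightarrow> \<bar>g s\<bar> \<le> M * exp (- \<theta> * s)"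
    and \<omega>: "\<omega> > 0" and diff: "\<And>s. T < s \<Longrightarrow> \<bar>h s - g s\<bar> \<le> L * exp (- \<omega> * s)"
  shows "\<bar>tail h t - tail g t\<bar> \<le> L / \<omega> * exp (- \<omega> * t)"
proof -
  have "0 \<le> M * exp (- \<theta> * t)" "0 \<le> L * exp (- \<omega> * t)"
    using h[OF assms(2)] diff[OF assms(2)] by (auto intro: order_trans[OF abs_ge_zero])
  then have "M \<ge> 0" "L \<ge> 0" by (simp_all add: zero_le_mult_iff)
  interpret M: tail_majorant "{T<..}" "\<lambda>s. M * exp (- \<theta> * s)" "\<lambda>s. M / \<theta> * exp (- \<theta> * s)"
    by (rule exponential_majorant) fact+
  interpret L: tail_majorant "{T<..}" "\<lambda>s. L * exp (- \<omega> * s)" "\<lambda>s. L / \<omega> * exp (- \<omega> * s)"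
    by (rule exponential_majorant) fact+
  have "tail h t - tail g t = tail (\<lambda>s. h s - g s) t"
    by (rule M.tail_diff) (use assms in auto)
  also have "\<bar>\<dots>\<bar> \<le> L / \<omega> * exp (- \<omega> * t)"
    by (rule L.tail_abs) (use assms in \<open>auto intro!: continuous_on_diff\<close>)
  finally show ?thesis .
qed

text \<open>Banach's theorem in the ball of bounded continuous functions around the constant \<open>d\<close>. The exponential
bounds make the operator \<open>H \<mapsto> d + tail (J H)\<close> a contraction on a half-line that starts late enough.
Functions are kept on the whole line by freezing the value at \<open>T + 1\<close> to its left; the margin of length \<open>1\<close>
keeps the closed half-line of the fixed point equation inside the open one of the estimates.\<close>

lemma tail_fixed_point:
  fixes J :: "(real \<Rightarrow> real) \<Rightarrow> real \<Rightarrow> real"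
  defines "\<B> d \<rho> \<equiv> {H. continuous_on UNIV H \<and> (\<forall>t. \<bar>H t - d\<bar> \<le> \<rho>)}"
  assumes pos: "\<theta> > 0" "L \<ge> 0" "\<rho> \<ge> 0"
    and cont: "\<And>H. H \<in> \<B> d \<rho> \<Longrightarrow> continuous_on {T<..} (J H)"
    and bound: "\<And>H s. H \<in> \<B> d \<rho> \<Longrightarrow> T < s \<Longrightarrow> \<bar>J H s\<bar> \<le> L * exp (- \<theta> * s)"
    and lip: "\<And>H H' D s. H \<in> \<B> d \<rho> \<Longrightarrow> H' \<in> \<B> d \<rho> \<Longrightarrow> (\<And>t. \<bar>H t - H' t\<bar> \<le> D) \<Longrightarrow> T < s \<Longrightarrow>
        \<bar>J H s - J H' s\<bar> \<le> L * D * exp (- \<theta> * s)"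
    and small: "L / \<theta> * exp (- \<theta> * (T + 1)) \<le> \<rho>" "L / \<theta> * exp (- \<theta> * (T + 1)) \<le> 1 / 2"
  obtains H where "H \<in> \<B> d \<rho>" "\<And>t. T + 1 \<le> t \<Longrightarrow> H t = d + tail (J H) t"
proof -
  define S where "S = {H :: real \<Rightarrow>\<^sub>C real. \<forall>t. \<bar>apply_bcontfun H t - d\<bar> \<le> \<rho>}"
  define F where "F H = (\<lambda>t. d + tail (J H) (max t (T + 1)))" for H
  define \<Phi> where "\<Phi> H = Bcontfun (F (apply_bcontfun H))" for H
  have S_B: "H \<in> S \<longleftrightarrow> apply_bcontfun H \<in> \<B> d \<rho>" for H
    by (auto simp: S_def \<B>_def)
  interpret E: tail_majorant "{T<..}" "\<lambda>s. L * exp (- \<theta> * s)" "\<lambda>s. L / \<theta> * exp (- \<theta> * s)"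
    by (rule exponential_majorant) (use pos in auto)
  have decay: "M / \<theta> * exp (- \<theta> * max t (T + 1)) \<le> M / \<theta> * exp (- \<theta> * (T + 1))" if "M \<ge> 0" for M t
    using that pos by (intro mult_left_mono) auto
  have FB: "F H \<in> \<B> d \<rho>" if "H \<in> \<B> d \<rho>" for H
  proof -
    have "continuous_on UNIV (\<lambda>t. tail (J H) (max t (T + 1)))"
      by (rule continuous_on_compose2[OF E.tail_continuous_on[OF cont bound]])
         (use that in \<open>auto intro!: continuous_intros\<close>)
    moreover have "\<bar>tail (J H) (max t (T + 1))\<bar> \<le> \<rho>" for t
    proof -
      have "\<bar>tail (J H) (max t (T + 1))\<bar> \<le> L / \<theta> * exp (- \<theta> * max t (T + 1))"
        by (rule E.tail_abs) (use cont bound that in auto)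
      also have "\<dots> \<le> L / \<theta> * exp (- \<theta> * (T + 1))" by (rule decay) (use pos in auto)
      finally show ?thesis using small(1) by linarith
    qed
    ultimately show ?thesis
      by (auto simp: \<B>_def F_def intro!: continuous_intros)
  qed
  have bc: "F H \<in> bcontfun" if "H \<in> \<B> d \<rho>" for H
  proof (rule bcontfun_normI[where b = "\<bar>d\<bar> + \<rho>"])
    show "norm (F H x) \<le> \<bar>d\<bar> + \<rho>" for x
    proof -
      have "\<bar>F H x - d\<bar> \<le> \<rho>" using FB[OF that] by (auto simp: \<B>_def)
      then show ?thesis by simp
    qed
  qed (use FB[OF that] in \<open>auto simp: \<B>_def\<close>)
  have app: "apply_bcontfun (\<Phi> H) = F (apply_bcontfun H)" if "H \<in> S" for H
    unfolding \<Phi>_def using bc that by (simp add: S_B Bcontfun_inverse)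
  have "\<exists>!H\<in>S. \<Phi> H = H"
  proof (rule Banach_fix[where c = "1 / 2"])
    have "S = PiC UNIV (\<lambda>_. cball d \<rho>)"
      by (auto simp: S_def mem_PiC_iff dist_real_def abs_minus_commute Pi_iff)
    then show "complete S"
      by (simp add: complete_eq_closed closed_PiC)
    have "const_bcontfun d \<in> S" using pos by (simp add: S_def)
    then show "S \<noteq> {}" by blast
    show "\<Phi> ` S \<subseteq> S"
      using FB app by (auto simp: S_B)
    show "dist (\<Phi> H) (\<Phi> H') \<le> 1 / 2 * dist H H'" if H: "H \<in> S" "H' \<in> S" for H H'
    proof (rule dist_bound)
      fix t
      define D where "D = dist H H'"
      have D: "\<bar>apply_bcontfun H s - apply_bcontfun H' s\<bar> \<le> D" for s
        using dist_bounded[of H s H'] by (simp add: D_def dist_real_def)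
      let ?m = "max t (T + 1)" and ?J = "J (apply_bcontfun H)" and ?J' = "J (apply_bcontfun H')"
      have B: "apply_bcontfun H \<in> \<B> d \<rho>" "apply_bcontfun H' \<in> \<B> d \<rho>" using H by (auto simp: S_B)
      have "\<bar>tail ?J ?m - tail ?J' ?m\<bar> \<le> L * D / \<theta> * exp (- \<theta> * ?m)"
        by (rule tail_exp_Lipschitz[where T = T and M = L and \<theta> = \<theta>]) (use pos cont bound lip[OF B D] B in auto)
      also have "\<dots> \<le> L * D / \<theta> * exp (- \<theta> * (T + 1))"
        by (rule decay) (use pos in \<open>auto simp: D_def\<close>)
      also have "\<dots> = (L / \<theta> * exp (- \<theta> * (T + 1))) * D" by simp
      also have "\<dots> \<le> 1 / 2 * D"
        by (rule mult_right_mono[OF small(2)]) (simp add: D_def)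
      finally show "dist (apply_bcontfun (\<Phi> H) t) (apply_bcontfun (\<Phi> H') t) \<le> 1 / 2 * dist H H'"
        unfolding app[OF H(1)] app[OF H(2)] by (simp add: F_def dist_real_def D_def)
    qed
  qed auto
  then obtain H where H: "H \<in> S" "\<Phi> H = H" by auto
  show thesis
  proof
    show "apply_bcontfun H \<in> \<B> d \<rho>" using H by (simp add: S_B)
    show "apply_bcontfun H t = d + tail (J (apply_bcontfun H)) t" if "T + 1 \<le> t" for t
    proof -
      have "apply_bcontfun H t = F (apply_bcontfun H) t"
        using app[OF H(1)] H(2) by simp
      then show ?thesis using that by (simp add: F_def max_absorb1)
    qed
  qed
qed

lemma powr_Lipschitz_on_interval:
  fixes m lo hi :: real
  assumes "0 < lo"
  obtains K where "K > 0"
    "\<And>x y. lo \<le> x \<Longrightarrow> x \<le> hi \<Longrightarrow> lo \<le> y \<Longrightarrow> y \<le> hi \<Longrightarrow> \<bar>x powr m - y powr m\<bar> \<le> K * \<bar>x - y\<bar>"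
proof -
  have "compact ((\<lambda>z. m * z powr (m - 1)) ` {lo..hi})"
    by (intro compact_continuous_image continuous_intros) (use assms in auto)
  then have "bounded ((\<lambda>z. m * z powr (m - 1)) ` {lo..hi})" by (rule compact_imp_bounded)
  then obtain K where K: "K > 0" "\<And>z. lo \<le> z \<Longrightarrow> z \<le> hi \<Longrightarrow> \<bar>m * z powr (m - 1)\<bar> \<le> K"
    unfolding bounded_pos by auto
  show thesis
  proof
    fix x y assume xy: "lo \<le> x" "x \<le> hi" "lo \<le> y" "y \<le> hi"
    have "norm (x powr m - y powr m) \<le> K * norm (x - y)"
    proof (rule field_differentiable_bound[of "{lo..hi}"])
      show "((\<lambda>z. z powr m) has_field_derivative m * z powr (m - 1)) (at z within {lo..hi})"
        if "z \<in> {lo..hi}" for z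
        using that assms by (auto intro!: has_field_derivative_at_within has_real_derivative_powr)
    qed (use K xy in auto)
    then show "\<bar>x powr m - y powr m\<bar> \<le> K * \<bar>x - y\<bar>" by simp
  qed (rule K)
qed

lemma tail_exp:
  assumes "\<theta> > 0"
  shows "tail (\<lambda>s. L * exp (- \<theta> * s)) t = L / \<theta> * exp (- \<theta> * t)"
proof -
  interpret A: tail_majorant "{t - 1<..}" "\<lambda>s. 1 * exp (- \<theta> * s)" "\<lambda>s. 1 / \<theta> * exp (- \<theta> * s)"
    by (rule exponential_majorant) (use assms in auto)
  have "tail (\<lambda>s. L * (1 * exp (- \<theta> * s))) t = L * tail (\<lambda>s. 1 * exp (- \<theta> * s)) t"
    unfolding tail_def by (rule set_integral_mult_right)
  then show ?thesis using A.majorant_integral(2)[of t] by simp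
qed

section \<open>The equation in logarithmic time\<close>

abbreviation (input) solution_on where
  "solution_on N p q \<epsilon> I w \<equiv> positive_solution_on N (- N) p q \<epsilon> I w"

text \<open>The normalised derivatives: \<open>slope\<close> is bounded when the flux has a finite limit, and the two variants with
the logarithm when it grows linearly in \<open>ln r\<close>.\<close>

abbreviation (input) slope :: "real \<Rightarrow> real \<Rightarrow> (real \<Rightarrow> real) \<Rightarrow> real \<Rightarrow> real" where
  "slope N p w r \<equiv> r powr ((N - 1) / (p - 1)) * deriv w r"

abbreviation (input) log_slope :: "real \<Rightarrow> real \<Rightarrow> (real \<Rightarrow> real) \<Rightarrow> real \<Rightarrow> real" where
  "log_slope N p w r \<equiv> r powr ((N - 1) / (p - 1)) * ln r powr (- (1 / (p - 1))) * deriv w r"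

abbreviation (input) abs_log_slope :: "real \<Rightarrow> real \<Rightarrow> (real \<Rightarrow> real) \<Rightarrow> real \<Rightarrow> real" where
  "abs_log_slope N p w r \<equiv> r powr ((N - 1) / (p - 1)) * \<bar>ln r\<bar> powr (- (1 / (p - 1))) * deriv w r"

lemma p_flux_eq:
  assumes "y > 0" "a = 1 \<or> a = -1"
  shows "p_flux p (a * y) = a * y powr (p - 1)"
proof -
  have "y powr (p - 2) * y = y powr (p - 1)"
    using assms(1) powr_add[of y "p - 2" 1] by simp
  then show ?thesis using assms by (auto simp: p_flux_def abs_mult)
qed

text \<open>With \<open>t = ln r\<close> one has \<open>w'(r) = (dw/dt) / r\<close>, and \<open>\<beta> + 1 = (N - 1) m\<close> turns the flux of
\<open>w \<circ> ln\<close> into \<open>- a r powr (1 - N) G (ln r)\<close>. Differentiating the factor \<open>r powr (1 - N)\<close> produces the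
first order term of the equation.\<close>

lemma log_solution:
  fixes N p q \<epsilon> a :: real
  defines "m \<equiv> 1 / (p - 1)" and "\<beta> \<equiv> (N - p) / (p - 1)"
  assumes p: "p > 1" and a: "a = 1 \<or> a = -1" and I: "open I"
    and pos: "\<And>t. t \<in> I \<Longrightarrow> 0 < w t \<and> 0 < G t"
    and dw: "\<And>t. t \<in> I \<Longrightarrow> (w has_real_derivative - a * exp (- \<beta> * t) * G t powr m) (at t)"
    and dG: "\<And>t. t \<in> I \<Longrightarrow> (G has_real_derivative a * \<epsilon> * w t powr q) (at t)"
  shows "solution_on N p q \<epsilon> {r. 0 < r \<and> ln r \<in> I} (\<lambda>r. w (ln r))"
    and "\<And>r. 0 < r \<Longrightarrow> ln r \<in> I \<Longrightarrow>
      r powr ((N - 1) / (p - 1)) * deriv (\<lambda>r. w (ln r)) r = - a * G (ln r) powr m"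
proof -
  define v where "v = (\<lambda>r. w (ln r))"
  define J where "J = {r. 0 < r \<and> ln r \<in> I}"
  have "open ({0<..} \<inter> ln -` I)"
    by (rule continuous_open_preimage[OF _ _ I]) (auto intro!: continuous_intros)
  moreover have "{0<..} \<inter> ln -` I = J" by (auto simp: J_def)
  ultimately have J: "open J" by simp
  have \<beta>1: "\<beta> + 1 = (N - 1) * m" using p by (simp add: \<beta>_def m_def field_simps)
  have exp_ln: "exp (- \<beta> * ln r) = r powr (- \<beta>)" if "r > 0" for r
    using that by (simp add: powr_def)
  have dv: "(v has_real_derivative - a * r powr (- ((N - 1) * m)) * G (ln r) powr m) (at r)"
    if "r \<in> J" for r
  proof -
    have r: "r > 0" "ln r \<in> I" using that by (auto simp: J_def)
    have "(v has_real_derivative (- a * exp (- \<beta> * ln r) * G (ln r) powr m) * (1 / r)) (at r)"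
      unfolding v_def using DERIV_chain2[OF dw[OF r(2)] DERIV_ln_divide[OF r(1)]] .
    also have "(- a * exp (- \<beta> * ln r) * G (ln r) powr m) * (1 / r)
        = - a * r powr (- ((N - 1) * m)) * G (ln r) powr m"
      unfolding \<beta>1[symmetric] exp_ln[OF r(1)] using r powr_diff[of r "-\<beta>" 1] by simp
    finally show ?thesis .
  qed
  have deriv_v: "deriv v r = - a * (r powr (- ((N - 1) * m)) * G (ln r) powr m)" if "r \<in> J" for r
    using DERIV_imp_deriv[OF dv[OF that]] by simp
  have flux: "p_flux p (deriv v r) = - a * (r powr (1 - N) * G (ln r))" if "r \<in> J" for r
  proof -
    have r: "r > 0" "G (ln r) > 0" using that pos by (auto simp: J_def)
    have "p_flux p (deriv v r) = - a * (r powr (- ((N - 1) * m)) * G (ln r) powr m) powr (p - 1)"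
      unfolding deriv_v[OF that] by (rule p_flux_eq) (use r a in auto)
    also have "(r powr (- ((N - 1) * m)) * G (ln r) powr m) powr (p - 1) = r powr (1 - N) * G (ln r)"
      using r p by (simp add: powr_mult powr_powr m_def)
    finally show ?thesis .
  qed
  have dflux: "((\<lambda>s. p_flux p (deriv v s)) has_real_derivative
      - a * ((1 - N) * r powr (- N) * G (ln r) + (a * \<epsilon> * v r powr q) * (1 / r) * r powr (1 - N))) (at r)"
    if "r \<in> J" for r
  proof -
    have r: "r > 0" "ln r \<in> I" using that by (auto simp: J_def)
    have "((\<lambda>s. s powr (1 - N)) has_real_derivative (1 - N) * r powr (1 - N - 1)) (at r)"
      by (rule has_real_derivative_powr[OF r(1)])
    then have 1: "((\<lambda>s. s powr (1 - N)) has_real_derivative (1 - N) * r powr (- N)) (at r)" by simp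
    have "((\<lambda>s. - a * (s powr (1 - N) * G (ln s))) has_real_derivative
      - a * ((1 - N) * r powr (- N) * G (ln r) + (a * \<epsilon> * v r powr q) * (1 / r) * r powr (1 - N))) (at r)"
      unfolding v_def
      by (intro DERIV_cmult DERIV_mult[OF 1] DERIV_chain2[OF dG[OF r(2)] DERIV_ln_divide[OF r(1)]])
    then show ?thesis
      by (rule has_field_derivative_transform_within_open[OF _ J that]) (simp add: flux)
  qed
  have "solution_on N p q \<epsilon> J v"
    unfolding positive_solution_on_def
  proof (intro ballI conjI)
    fix r assume r: "r \<in> J"
    then have r0: "r > 0" and wr: "v r > 0" using pos by (auto simp: J_def v_def)
    then show "0 < v r" by simp
    show "v differentiable at r"
      using dv[OF r] real_differentiable_def by blast
    show "(\<lambda>s. p_flux p (deriv v s)) differentiable at r"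
      using dflux[OF r] real_differentiable_def by blast
    have aa: "a * a = 1" using a by auto
    have "r powr (1 - N) = r * r powr (- N)" using r0 powr_add[of r 1 "-N"] by simp
    moreover have "- (- a * ((1 - N) * R * g + (a * \<epsilon> * y) * (1 / r) * (r * R)))
      - (N - 1) / r * (- a * (r * R * g)) = (a * a) * \<epsilon> * R * y" for R g y
      using r0 by (simp add: field_simps)
    ultimately show "- deriv (\<lambda>s. p_flux p (deriv v s)) r - (N - 1) / r * p_flux p (deriv v r)
        = \<epsilon> * r powr (- N) * v r powr q"
      unfolding DERIV_imp_deriv[OF dflux[OF r]] flux[OF r] using aa by simp
  qed
  then show "solution_on N p q \<epsilon> {r. 0 < r \<and> ln r \<in> I} (\<lambda>r. w (ln r))"
    by (simp add: J_def v_def)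
  show "r powr ((N - 1) / (p - 1)) * deriv (\<lambda>r. w (ln r)) r = - a * G (ln r) powr m"
    if "0 < r" "ln r \<in> I" for r
  proof -
    have "r powr ((N - 1) * m) * r powr (- ((N - 1) * m)) = 1"
      using that(1) by (simp flip: powr_add)
    then show ?thesis
      using deriv_v[of r] that unfolding v_def J_def by (simp add: m_def)
  qed
qed

text \<open>Inverting the radius multiplies the flux by \<open>- r powr (2 - 2 p)\<close>, which changes the coefficient \<open>N - 1\<close> of the
first order term into \<open>2 p - N - 1\<close> and the weight \<open>r powr (- N)\<close> into \<open>r powr (- (2 p - N))\<close>; the sign \<open>\<epsilon>\<close> is
preserved.\<close>

lemma inversion:
  assumes sol: "solution_on N p q \<epsilon> I w" and I: "open I" and p: "p > 1"
  shows "solution_on (2 * p - N) p q \<epsilon> {r. 0 < r \<and> 1 / r \<in> I} (\<lambda>r. w (1 / r))"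
    and "\<And>r. 0 < r \<Longrightarrow> 1 / r \<in> I \<Longrightarrow> slope (2 * p - N) p (\<lambda>r. w (1 / r)) r
      = - (slope N p w (1 / r))"
proof -
  define v where "v = (\<lambda>r. w (1 / r))"
  define J where "J = {r. 0 < r \<and> 1 / r \<in> I}"
  define \<phi> where "\<phi> = (\<lambda>s. p_flux p (deriv w s))"
  have "open ({0<..} \<inter> (\<lambda>r. 1 / r) -` I)"
    by (rule continuous_open_preimage[OF _ _ I]) (auto intro!: continuous_intros)
  moreover have "{0<..} \<inter> (\<lambda>r. 1 / r) -` I = J" by (auto simp: J_def)
  ultimately have J: "open J" by simp
  have w: "w s > 0" "(w has_real_derivative deriv w s) (at s)"
    "(\<phi> has_real_derivative - (N - 1) / s * \<phi> s - \<epsilon> * s powr (- N) * w s powr q) (at s)"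
    if "s \<in> I" for s
  proof -
    have "w differentiable (at s)" "\<phi> differentiable (at s)" and pos: "w s > 0" and
      eq: "- deriv \<phi> s - (N - 1) / s * \<phi> s = \<epsilon> * s powr (- N) * w s powr q"
      using sol that unfolding positive_solution_on_def \<phi>_def by auto
    then have 1: "(w has_real_derivative deriv w s) (at s)" "(\<phi> has_real_derivative deriv \<phi> s) (at s)"
      by (auto simp: DERIV_deriv_iff_real_differentiable)
    show "w s > 0" "(w has_real_derivative deriv w s) (at s)" using pos 1 by auto
    have "deriv \<phi> s = - ((N - 1) / s * \<phi> s) - \<epsilon> * s powr (- N) * w s powr q"
      using eq by linarith
    also have "- ((N - 1) / s * \<phi> s) = - (N - 1) / s * \<phi> s"
      by (simp only: minus_divide_left[symmetric] mult_minus_left)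
    finally have "deriv \<phi> s = - (N - 1) / s * \<phi> s - \<epsilon> * s powr (- N) * w s powr q" .
    from 1(2)[unfolded this]
    show "(\<phi> has_real_derivative - (N - 1) / s * \<phi> s - \<epsilon> * s powr (- N) * w s powr q) (at s)" .
  qed
  have dinv: "((\<lambda>r. 1 / r) has_real_derivative - (1 / r ^ 2)) (at r)" if "r > 0" for r :: real
    using that by (auto intro!: derivative_eq_intros simp: power2_eq_square)
  have dv: "(v has_real_derivative deriv w (1 / r) * (- (1 / r ^ 2))) (at r)" if "r \<in> J" for r
    unfolding v_def using that by (intro DERIV_chain2[OF w(2) dinv]) (auto simp: J_def)
  have deriv_v: "deriv v r = - (deriv w (1 / r) / r ^ 2)" if "r \<in> J" for r
    using DERIV_imp_deriv[OF dv[OF that]] by simp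
  have flux: "p_flux p (deriv v r) = - (r powr (2 - 2 * p) * \<phi> (1 / r))" if "r \<in> J" for r
  proof -
    have r: "r > 0" using that by (simp add: J_def)
    have "\<bar>deriv v r\<bar> = r powr (- 2) * \<bar>deriv w (1 / r)\<bar>"
      using r by (simp add: deriv_v[OF that] abs_mult powr_minus powr_numeral divide_inverse)
    then have "\<bar>deriv v r\<bar> powr (p - 2) = r powr (4 - 2 * p) * \<bar>deriv w (1 / r)\<bar> powr (p - 2)"
      using r by (simp add: powr_mult powr_powr algebra_simps)
    moreover have "r powr (4 - 2 * p) = r powr (2 - 2 * p) * r ^ 2"
      using r powr_add[of r "2 - 2 * p" 2] by (simp add: powr_numeral)
    ultimately show ?thesis
      using r by (simp add: p_flux_def \<phi>_def deriv_v[OF that])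
  qed
  have dflux: "((\<lambda>s. p_flux p (deriv v s)) has_real_derivative
      - ((2 - 2 * p) * r powr (1 - 2 * p) * \<phi> (1 / r)
        + ((- (N - 1) / (1 / r) * \<phi> (1 / r) - \<epsilon> * (1 / r) powr (- N) * v r powr q) * (- (1 / r ^ 2)))
          * r powr (2 - 2 * p))) (at r)"
    if "r \<in> J" for r
  proof -
    have r: "r > 0" "1 / r \<in> I" using that by (auto simp: J_def)
    have "((\<lambda>s. s powr (2 - 2 * p)) has_real_derivative (2 - 2 * p) * r powr (2 - 2 * p - 1)) (at r)"
      by (rule has_real_derivative_powr[OF r(1)])
    then have 1: "((\<lambda>s. s powr (2 - 2 * p)) has_real_derivative (2 - 2 * p) * r powr (1 - 2 * p)) (at r)"
      by (simp add: algebra_simps)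
    have "((\<lambda>s. - (s powr (2 - 2 * p) * \<phi> (1 / s))) has_real_derivative
      - ((2 - 2 * p) * r powr (1 - 2 * p) * \<phi> (1 / r)
        + ((- (N - 1) / (1 / r) * \<phi> (1 / r) - \<epsilon> * (1 / r) powr (- N) * v r powr q) * (- (1 / r ^ 2)))
          * r powr (2 - 2 * p))) (at r)"
      unfolding v_def
      by (intro DERIV_minus DERIV_mult[OF 1] DERIV_chain2[OF w(3)[OF r(2)] dinv[OF r(1)]])
    then show ?thesis
      by (rule has_field_derivative_transform_within_open[OF _ J that]) (simp add: flux)
  qed
  have "solution_on (2 * p - N) p q \<epsilon> J v"
    unfolding positive_solution_on_def
  proof (intro ballI conjI)
    fix r assume r: "r \<in> J"
    then have r0: "r > 0" and wr: "v r > 0" using w(1) by (auto simp: J_def v_def)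
    then show "0 < v r" by simp
    show "v differentiable at r"
      using dv[OF r] real_differentiable_def by blast
    show "(\<lambda>s. p_flux p (deriv v s)) differentiable at r"
      using dflux[OF r] real_differentiable_def by blast
    define R where "R = r powr (- (2 * p))"
    have R: "r powr (1 - 2 * p) = r * R" "r powr (2 - 2 * p) = r ^ 2 * R"
      "r powr (- (2 * p - N)) = R * (1 / r) powr (- N)"
      using r0 powr_add[of r 1 "- 2 * p"] powr_add[of r 2 "- 2 * p"] powr_add[of r "- (2 * p)" N]
      by (simp_all add: R_def powr_numeral powr_divide powr_minus_divide)
    have "- (- ((2 - 2 * p) * (r * R) * f + ((- (N - 1) / (1 / r) * f - \<epsilon> * S * y) * (- (1 / r ^ 2)))
          * (r ^ 2 * R))) - (2 * p - N - 1) / r * (- (r ^ 2 * R * f)) = \<epsilon> * (R * S) * y" for f S y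
      using r0 by (simp add: field_simps power2_eq_square)
    then show "- deriv (\<lambda>s. p_flux p (deriv v s)) r - (2 * p - N - 1) / r * p_flux p (deriv v r)
        = \<epsilon> * r powr (- (2 * p - N)) * v r powr q"
      unfolding DERIV_imp_deriv[OF dflux[OF r]] flux[OF r] R .
  qed
  then show "solution_on (2 * p - N) p q \<epsilon> {r. 0 < r \<and> 1 / r \<in> I} (\<lambda>r. w (1 / r))"
    by (simp add: J_def v_def)
  show "slope (2 * p - N) p (\<lambda>r. w (1 / r)) r
      = - (slope N p w (1 / r))"
    if "0 < r" "1 / r \<in> I" for r
  proof -
    have "(2 * p - N - 1) / (p - 1) = 2 + - ((N - 1) / (p - 1))"
      using p by (simp add: field_simps)
    then have "r powr ((2 * p - N - 1) / (p - 1)) = r ^ 2 * (1 / r) powr ((N - 1) / (p - 1))"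
      using that(1) by (simp only: powr_add) (simp add: powr_numeral powr_divide powr_minus_divide)
    then show ?thesis
      using deriv_v[of r] that unfolding v_def J_def by simp
  qed
qed

section \<open>Solutions with a finite limit of the flux\<close>

lemma abs_exp_mult_diff: "\<bar>exp u * a - exp u * b\<bar> = exp u * \<bar>a - b\<bar>" for u a b :: real
  by (simp add: abs_mult flip: right_diff_distrib)

text \<open>If \<open>G\<close> tends to \<open>d\<close>, then \<open>w\<close> is the tail of \<open>exp (- \<beta> t) G powr m\<close>, of the order of \<open>exp (- \<beta> t)\<close>, and \<open>G\<close> solves a
fixed point equation whose integrand \<open>w powr q\<close> is of the order of \<open>exp (- q \<beta> t)\<close>. For \<open>q < 1\<close> this power is not
Lipschitz near \<open>w = 0\<close>; therefore the Lipschitz estimate is made for \<open>exp (\<beta> t) w\<close>, which stays in a compact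
interval of positive numbers.\<close>

lemma decaying_solution:
  fixes \<beta> m q \<epsilon> d :: real
  assumes pos: "\<beta> > 0" "m > 0" "q > 0" "d > 0" and \<epsilon>: "\<epsilon> = 1 \<or> \<epsilon> = -1"
  obtains T w G where
    "\<And>t. T < t \<Longrightarrow> 0 < w t \<and> 0 < G t"
    "\<And>t. T < t \<Longrightarrow> (w has_real_derivative - exp (- \<beta> * t) * G t powr m) (at t)"
    "\<And>t. T < t \<Longrightarrow> (G has_real_derivative \<epsilon> * w t powr q) (at t)"
    "((\<lambda>t. exp (\<beta> * t) * w t) \<longlongrightarrow> d powr m / \<beta>) at_top"
    "(G \<longlongrightarrow> d) at_top"
proof -
  \<comment> \<open>The ball of radius \<open>d / 2\<close> around \<open>d\<close> stays away from \<open>0\<close>, where \<open>x powr m\<close> may fail to be Lipschitz.\<close>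
  define lo hi where "lo = d / 2" and "hi = 3 * d / 2"
  have lohi: "0 < lo" "lo < hi" using pos by (auto simp: lo_def hi_def)
  obtain K where K: "K > 0"
    "\<And>x y. lo \<le> x \<Longrightarrow> x \<le> hi \<Longrightarrow> lo \<le> y \<Longrightarrow> y \<le> hi \<Longrightarrow> \<bar>x powr m - y powr m\<bar> \<le> K * \<bar>x - y\<bar>"
    using powr_Lipschitz_on_interval[OF lohi(1)] by metis
  define c1 c2 where "c1 = lo powr m / \<beta>" and "c2 = hi powr m / \<beta>"
  have c: "0 < c1" "c1 \<le> c2" using pos lohi by (auto simp: c1_def c2_def divide_right_mono powr_mono2)
  obtain K' where K': "K' > 0"
    "\<And>x y. c1 \<le> x \<Longrightarrow> x \<le> c2 \<Longrightarrow> c1 \<le> y \<Longrightarrow> y \<le> c2 \<Longrightarrow> \<bar>x powr q - y powr q\<bar> \<le> K' * \<bar>x - y\<bar>"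
    using powr_Lipschitz_on_interval[OF c(1)] by metis
  define \<theta> L where "\<theta> = q * \<beta>" and "L = c2 powr q + K' * K / \<beta>"
  have \<theta>L: "\<theta> > 0" "L \<ge> 0" using pos K K' by (auto simp: \<theta>_def L_def)
  define W where "W H = tail (\<lambda>s. exp (- \<beta> * s) * H s powr m)" for H
  define J where "J H s = - \<epsilon> * W H s powr q" for H s
  define B where "B = {H :: real \<Rightarrow> real. continuous_on UNIV H \<and> (\<forall>t. \<bar>H t - d\<bar> \<le> d / 2)}"
  have B: "lo \<le> H s" "H s \<le> hi" "H s > 0" "continuous_on A H" if "H \<in> B" for H s A
  proof -
    have h: "\<bar>H s - d\<bar> \<le> d / 2" "continuous_on UNIV H" using that by (auto simp: B_def)
    from h(1) show "lo \<le> H s" "H s \<le> hi" "H s > 0"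
      unfolding lo_def hi_def using pos(4) by linarith+
    show "continuous_on A H" by (rule continuous_on_subset[OF h(2)]) simp
  qed
  have contk: "continuous_on A (\<lambda>s. exp (- \<beta> * s) * H s powr m)" if "H \<in> B" for A H
    using B(3)[OF that] by (intro continuous_intros B(4)[OF that]) (auto simp: less_imp_neq[symmetric])
  interpret M: tail_majorant "{T<..}" "\<lambda>s. hi powr m * exp (- \<beta> * s)"
      "\<lambda>s. hi powr m / \<beta> * exp (- \<beta> * s)" for T
    by (rule exponential_majorant) (use pos in auto)
  have abs_k: "\<bar>exp (- \<beta> * s) * H s powr m\<bar> \<le> hi powr m * exp (- \<beta> * s)" if "H \<in> B" for H s
    using B(1-3)[OF that, of s] lohi pos by (simp add: powr_mono2 abs_mult)
  have W_deriv: "(W H has_real_derivative - (exp (- \<beta> * s) * H s powr m)) (at s)" if "H \<in> B" for H s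
    unfolding W_def
    by (rule M.tail_has_derivative[where T = "s - 1"]) (use contk abs_k that in auto)
  have W_lo: "c1 * exp (- \<beta> * s) \<le> W H s" if "H \<in> B" for H s
  proof -
    have "tail (\<lambda>s. lo powr m * exp (- \<beta> * s)) s \<le> W H s"
      unfolding W_def
      by (rule M.tail_mono[where T = "s - 1"])
         (use contk abs_k B that lohi pos in \<open>auto intro!: continuous_intros powr_mono2\<close>)
    then show ?thesis using tail_exp[OF pos(1), of "lo powr m" s] by (simp add: c1_def)
  qed
  have W_hi: "W H s \<le> c2 * exp (- \<beta> * s)" if "H \<in> B" for H s
    using M.tail_abs[where T = "s - 1" and t = s, OF _ contk[OF that] abs_k[OF that]]
    by (simp add: W_def c2_def abs_le_iff)
  have W_lip: "\<bar>W H s - W H' s\<bar> \<le> K * D / \<beta> * exp (- \<beta> * s)"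
    if H: "H \<in> B" "H' \<in> B" and D: "\<And>t. \<bar>H t - H' t\<bar> \<le> D" for H H' D s
  proof -
    have "\<bar>W H s - W H' s\<bar> \<le> K * D / \<beta> * exp (- \<beta> * s)"
      unfolding W_def
    proof (rule tail_exp_Lipschitz[OF pos(1), where T = "s - 1" and M = "hi powr m"])
      fix x
      have "\<bar>H x powr m - H' x powr m\<bar> \<le> K * D"
        using K(2)[of "H x" "H' x"] B(1-3)[OF H(1), of x] B(1-3)[OF H(2), of x] mult_left_mono[OF D[of x], of K] K(1)
        by linarith
      then have "exp (- \<beta> * x) * \<bar>H x powr m - H' x powr m\<bar> \<le> exp (- \<beta> * x) * (K * D)"
        by (rule mult_left_mono) simp
      then show "\<bar>exp (- \<beta> * x) * H x powr m - exp (- \<beta> * x) * H' x powr m\<bar> \<le> K * D * exp (- \<beta> * x)"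
        unfolding abs_exp_mult_diff by (simp only: ac_simps)
    qed (use pos contk abs_k H in auto)
    then show ?thesis .
  qed
  have W_powr: "W H s powr q = exp (- \<theta> * s) * (exp (\<beta> * s) * W H s) powr q" if "H \<in> B" for H s
  proof -
    have "exp (\<beta> * s) powr q = exp (\<theta> * s)" by (simp add: powr_def \<theta>_def)
    moreover have "exp (- \<theta> * s) * exp (\<theta> * s) = 1" by (simp flip: exp_add)
    ultimately show ?thesis by (simp add: powr_mult)
  qed
  have y: "c1 \<le> exp (\<beta> * s) * W H s" "exp (\<beta> * s) * W H s \<le> c2" if "H \<in> B" for H s
  proof -
    show "c1 \<le> exp (\<beta> * s) * W H s"
      using W_lo[OF that, of s] by (simp add: exp_minus field_simps)
    show "exp (\<beta> * s) * W H s \<le> c2"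
      using W_hi[OF that, of s] by (simp add: exp_minus field_simps)
  qed
  have J_bound: "\<bar>J H s\<bar> \<le> L * exp (- \<theta> * s)" if "H \<in> B" for H s
  proof -
    have "(exp (\<beta> * s) * W H s) powr q \<le> c2 powr q"
      by (rule powr_mono2) (use y[OF that, of s] c pos in auto)
    also have "\<dots> \<le> L" using K K' pos by (simp add: L_def)
    finally have "exp (- \<theta> * s) * (exp (\<beta> * s) * W H s) powr q \<le> exp (- \<theta> * s) * L"
      by (rule mult_left_mono) simp
    then show ?thesis using \<epsilon> unfolding J_def W_powr[OF that] by (auto simp: mult.commute)
  qed
  have J_lip: "\<bar>J H s - J H' s\<bar> \<le> L * D * exp (- \<theta> * s)"
    if H: "H \<in> B" "H' \<in> B" and D: "\<And>t. \<bar>H t - H' t\<bar> \<le> D" for H H' D s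
  proof -
    have D0: "D \<ge> 0" using D[of 0] by linarith
    have e: "exp (\<beta> * s) * exp (- \<beta> * s) = 1" by (simp flip: exp_add)
    have "\<bar>exp (\<beta> * s) * W H s - exp (\<beta> * s) * W H' s\<bar> = exp (\<beta> * s) * \<bar>W H s - W H' s\<bar>"
      by (rule abs_exp_mult_diff)
    also have "\<dots> \<le> exp (\<beta> * s) * (K * D / \<beta> * exp (- \<beta> * s))"
      by (rule mult_left_mono[OF W_lip[OF H D]]) simp
    also have "\<dots> = K * D / \<beta> * (exp (\<beta> * s) * exp (- \<beta> * s))" by (simp only: ac_simps)
    finally have "\<bar>exp (\<beta> * s) * W H s - exp (\<beta> * s) * W H' s\<bar> \<le> K * D / \<beta>" unfolding e by simp
    then have "K' * \<bar>exp (\<beta> * s) * W H s - exp (\<beta> * s) * W H' s\<bar> \<le> K' * (K * D / \<beta>)"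
      using K' by (intro mult_left_mono) auto
    then have "\<bar>(exp (\<beta> * s) * W H s) powr q - (exp (\<beta> * s) * W H' s) powr q\<bar> \<le> K' * (K * D / \<beta>)"
      using K'(2)[OF y[OF H(1), of s] y[OF H(2), of s]] by linarith
    also have "\<dots> = K' * K / \<beta> * D" by simp
    also have "\<dots> \<le> L * D"
      by (rule mult_right_mono) (use D0 in \<open>auto simp: L_def\<close>)
    finally have "exp (- \<theta> * s) * \<bar>(exp (\<beta> * s) * W H s) powr q - (exp (\<beta> * s) * W H' s) powr q\<bar>
        \<le> exp (- \<theta> * s) * (L * D)"
      by (rule mult_left_mono) simp
    moreover have "\<bar>J H s - J H' s\<bar>
        = exp (- \<theta> * s) * \<bar>(exp (\<beta> * s) * W H s) powr q - (exp (\<beta> * s) * W H' s) powr q\<bar>"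
    proof -
      have "\<bar>- \<epsilon> * x - - \<epsilon> * y\<bar> = \<bar>x - y\<bar>" for x y :: real
        using \<epsilon> by (auto simp: abs_minus_commute)
      then show ?thesis
        unfolding J_def W_powr[OF H(1)] W_powr[OF H(2)] by (simp only: abs_exp_mult_diff)
    qed
    ultimately show ?thesis by (simp add: ac_simps)
  qed
  have Wpos: "W H s > 0" if "H \<in> B" for H s
  proof -
    have "0 < c1 * exp (- \<beta> * s)" using c by simp
    then show ?thesis using W_lo[OF that, of s] by linarith
  qed
  have W_cont: "continuous_on A (W H)" if "H \<in> B" for H A
    using W_deriv[OF that]
    by (intro DERIV_continuous_on[of A _ "\<lambda>s. - (exp (- \<beta> * s) * H s powr m)"])
       (blast intro: has_field_derivative_at_within)
  have J_cont: "continuous_on A (J H)" if "H \<in> B" for H A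
    unfolding J_def using Wpos[OF that]
    by (intro continuous_intros W_cont that) (auto simp: less_imp_neq[symmetric])
  have "((\<lambda>T. L / \<theta> * exp (- \<theta> * (T + 1))) \<longlongrightarrow> 0) at_top"
    using \<theta>L by real_asymp
  moreover have "0 < min (d / 2) (1 / 2)" using pos by simp
  ultimately have "\<forall>\<^sub>F T in at_top. L / \<theta> * exp (- \<theta> * (T + 1)) < min (d / 2) (1 / 2)"
    by (rule order_tendstoD(2))
  then obtain T where T: "L / \<theta> * exp (- \<theta> * (T + 1)) < min (d / 2) (1 / 2)"
    by (auto simp: eventually_at_top_linorder)
  obtain H where H: "H \<in> B" "\<And>t. T + 1 \<le> t \<Longrightarrow> H t = d + tail (J H) t"
  proof (rule tail_fixed_point[of \<theta> L "d / 2" d T J, folded B_def])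
    show "d / 2 \<ge> 0" "L / \<theta> * exp (- \<theta> * (T + 1)) \<le> d / 2" "L / \<theta> * exp (- \<theta> * (T + 1)) \<le> 1 / 2"
      using pos T by auto
  qed (use \<theta>L J_bound J_lip J_cont in auto)
  interpret J: tail_majorant "{S<..}" "\<lambda>s. L * exp (- \<theta> * s)" "\<lambda>s. L / \<theta> * exp (- \<theta> * s)" for S
    by (rule exponential_majorant) (use \<theta>L in auto)
  show thesis
  proof
    fix t assume t: "T + 1 < t"
    show "0 < W H t \<and> 0 < H t" using Wpos B(3) H(1) by auto
    show "(W H has_real_derivative - exp (- \<beta> * t) * H t powr m) (at t)"
      using W_deriv[OF H(1), of t] by simp
    have "((\<lambda>t. d + tail (J H) t) has_real_derivative 0 + - J H t) (at t)"
      by (intro DERIV_add DERIV_const J.tail_has_derivative[where S = "T + 1"])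
         (use t J_cont J_bound H in auto)
    then have "((\<lambda>t. d + tail (J H) t) has_real_derivative \<epsilon> * W H t powr q) (at t)"
      by (simp add: J_def)
    then show "(H has_real_derivative \<epsilon> * W H t powr q) (at t)"
      by (rule has_field_derivative_transform_within_open[of _ _ _ "{T + 1<..}"]) (use t H(2) in auto)
  next
    have Hd: "\<bar>H t - d\<bar> \<le> L / \<theta> * exp (- \<theta> * t)" if "T + 1 < t" for t
      using J.tail_abs[where S = "T + 1" and t = t, OF _ J_cont[OF H(1)] J_bound[OF H(1)]] H(2)[of t] that
      by simp
    show "(H \<longlongrightarrow> d) at_top"
    proof (rule LIM_zero_cancel, rule Lim_null_comparison)
      show "\<forall>\<^sub>F t in at_top. norm (H t - d) \<le> L / \<theta> * exp (- \<theta> * t)"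
        using Hd by (auto intro!: eventually_mono[OF eventually_gt_at_top[of "T + 1"]])
      show "((\<lambda>t. L / \<theta> * exp (- \<theta> * t)) \<longlongrightarrow> 0) at_top"
        using \<theta>L by real_asymp
    qed
    \<comment> \<open>As \<open>H\<close> differs from \<open>d\<close> by the order of \<open>exp (- \<theta> t)\<close>, so does \<open>W H\<close>, relative to \<open>exp (- \<beta> t)\<close>, from the
    explicit solution for the constant flux \<open>d\<close>.\<close>
    define Z where "Z = K * (L / \<theta>)"
    have Z: "Z \<ge> 0" using K \<theta>L by (simp add: Z_def)
    define \<kappa> where "\<kappa> = \<beta> + \<theta>"
    have \<kappa>: "\<kappa> > 0" using pos \<theta>L by (simp add: \<kappa>_def)
    have est: "\<bar>exp (\<beta> * t) * W H t - d powr m / \<beta>\<bar> \<le> Z / \<kappa> * exp (- \<theta> * t)" if t: "T + 1 < t" for t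
    proof -
      have d_B: "(\<lambda>_. d) \<in> B" using pos by (auto simp: B_def)
      have Wd: "W (\<lambda>_. d) t = d powr m / \<beta> * exp (- \<beta> * t)"
        using tail_exp[OF pos(1), of "d powr m" t] by (simp add: W_def mult.commute)
      have "\<bar>W H t - W (\<lambda>_. d) t\<bar> \<le> Z / \<kappa> * exp (- \<kappa> * t)"
        unfolding W_def
      proof (rule tail_exp_Lipschitz[OF pos(1), where T = "T + 1" and M = "hi powr m"])
        fix x assume "T + 1 < x"
        then have "\<bar>H x powr m - d powr m\<bar> \<le> Z * exp (- \<theta> * x)"
          using K(2)[of "H x" d] B(1-3)[OF H(1), of x] B(1-3)[OF d_B] Hd[of x] K(1)
            mult_left_mono[OF Hd[of x], of K] by (simp add: Z_def)
        then have "exp (- \<beta> * x) * \<bar>H x powr m - d powr m\<bar> \<le> exp (- \<beta> * x) * (Z * exp (- \<theta> * x))"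
          by (rule mult_left_mono) simp
        also have "\<dots> = Z * exp (- \<kappa> * x)" by (simp add: \<kappa>_def algebra_simps flip: exp_add)
        finally show "\<bar>exp (- \<beta> * x) * H x powr m - exp (- \<beta> * x) * d powr m\<bar> \<le> Z * exp (- \<kappa> * x)"
          unfolding abs_exp_mult_diff .
      qed (use t \<kappa> contk abs_k[OF H(1)] abs_k[OF d_B] H(1) d_B in auto)
      then have "exp (\<beta> * t) * \<bar>W H t - W (\<lambda>_. d) t\<bar> \<le> exp (\<beta> * t) * (Z / \<kappa> * exp (- \<kappa> * t))"
        by (rule mult_left_mono) simp
      also have "\<dots> = Z / \<kappa> * exp (- \<theta> * t)" by (simp add: \<kappa>_def algebra_simps flip: exp_add)
      also have "exp (\<beta> * t) * \<bar>W H t - W (\<lambda>_. d) t\<bar> = \<bar>exp (\<beta> * t) * W H t - exp (\<beta> * t) * W (\<lambda>_. d) t\<bar>"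
        by (simp only: abs_exp_mult_diff)
      also have "exp (\<beta> * t) * W (\<lambda>_. d) t = d powr m / \<beta> * (exp (\<beta> * t) * exp (- \<beta> * t))"
        unfolding Wd by (simp only: ac_simps)
      also have "exp (\<beta> * t) * exp (- \<beta> * t) = 1" by (simp flip: exp_add)
      finally show ?thesis by simp
    qed
    show "((\<lambda>t. exp (\<beta> * t) * W H t) \<longlongrightarrow> d powr m / \<beta>) at_top"
    proof (rule LIM_zero_cancel, rule Lim_null_comparison)
      show "\<forall>\<^sub>F t in at_top. norm (exp (\<beta> * t) * W H t - d powr m / \<beta>) \<le> Z / \<kappa> * exp (- \<theta> * t)"
        using est by (auto intro!: eventually_mono[OF eventually_gt_at_top[of "T + 1"]])
      show "((\<lambda>t. Z / \<kappa> * exp (- \<theta> * t)) \<longlongrightarrow> 0) at_top"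
        using \<theta>L \<kappa> by real_asymp
    qed
  qed
qed

section \<open>Solutions with a positive limit\<close>

text \<open>The power of a flux comparable to \<open>s\<close>, and its Lipschitz constant, are absorbed by a small part of the exponential
weight; \<open>k\<close> will be \<open>\<beta> / 2\<close>.\<close>

lemma power_growth_bound:
  fixes k m :: real
  assumes "k > 0" "m > 0"
  obtains M where "M > 0"
    "\<And>s x. 1 \<le> s \<Longrightarrow> s / 2 \<le> x \<Longrightarrow> x \<le> 2 * s \<Longrightarrow> x powr m \<le> M * exp (k * s)"
    "\<And>s x y. 1 \<le> s \<Longrightarrow> s / 2 \<le> x \<Longrightarrow> x \<le> 2 * s \<Longrightarrow> s / 2 \<le> y \<Longrightarrow> y \<le> 2 * s \<Longrightarrow>
      \<bar>x powr m - y powr m\<bar> \<le> M * \<bar>x - y\<bar> * exp (k * s)"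
proof -
  obtain K where K: "K > 0"
    "\<And>x y. 1 / 2 \<le> x \<Longrightarrow> x \<le> 2 \<Longrightarrow> 1 / 2 \<le> y \<Longrightarrow> y \<le> 2 \<Longrightarrow> \<bar>x powr m - y powr m\<bar> \<le> K * \<bar>x - y\<bar>"
    using powr_Lipschitz_on_interval[of "1 / 2" 2 m] by (metis half_gt_zero zero_less_one)
  define c where "c = k / m"
  define A where "A = exp (- m * ln c)"
  have c: "c > 0" using assms by (simp add: c_def)
  have A: "A > 0" by (simp add: A_def)
  have pw: "s powr m \<le> A * exp (k * s)" if "1 \<le> s" for s :: real
  proof -
    have "ln (c * s) \<le> c * s"
      using ln_le_minus_one[of "c * s"] c that by simp
    then have "ln s \<le> c * s - ln c" using c that by (simp add: ln_mult)
    then have "m * ln s \<le> m * (c * s - ln c)" using assms by (intro mult_left_mono) auto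
    also have "\<dots> = - m * ln c + k * s" using assms by (simp add: c_def algebra_simps)
    finally show ?thesis using that by (simp add: powr_def A_def flip: exp_add)
  qed
  define M where "M = max (2 powr m) K * A"
  have M: "2 powr m * A \<le> M" "K * A \<le> M" "M > 0"
    using A K by (auto simp: M_def intro!: mult_right_mono mult_pos_pos)
  show thesis
  proof
    fix s x :: real assume s: "1 \<le> s" "s / 2 \<le> x" "x \<le> 2 * s"
    have "x powr m \<le> (2 * s) powr m" using s assms by (intro powr_mono2) auto
    also have "\<dots> = 2 powr m * s powr m" using s by (simp add: powr_mult)
    also have "\<dots> \<le> 2 powr m * (A * exp (k * s))" using pw s by (intro mult_left_mono) auto
    also have "\<dots> = (2 powr m * A) * exp (k * s)" by simp
    also have "\<dots> \<le> M * exp (k * s)" by (intro mult_right_mono M) simp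
    finally show "x powr m \<le> M * exp (k * s)" .
    fix y assume y: "s / 2 \<le> y" "y \<le> 2 * s"
    have "\<bar>x powr m - y powr m\<bar> = s powr m * \<bar>(x / s) powr m - (y / s) powr m\<bar>"
    proof -
      have e: "z powr m = s powr m * (z / s) powr m" if "z \<ge> 0" for z
        using powr_mult[of s "z / s" m] that s by simp
      have "x powr m - y powr m = s powr m * ((x / s) powr m - (y / s) powr m)"
        unfolding right_diff_distrib using e[of x] e[of y] s y by simp
      then show ?thesis by (simp add: abs_mult)
    qed
    also have "\<bar>(x / s) powr m - (y / s) powr m\<bar> \<le> K * \<bar>x / s - y / s\<bar>"
      using s y by (intro K(2)) (auto simp: field_simps)
    also have "\<bar>x / s - y / s\<bar> \<le> \<bar>x - y\<bar>"
    proof -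
      have "\<bar>x / s - y / s\<bar> = \<bar>x - y\<bar> / s" using s by (simp flip: diff_divide_distrib)
      also have "\<dots> \<le> \<bar>x - y\<bar> / 1" using s by (intro divide_left_mono) auto
      finally show ?thesis by simp
    qed
    also have "s powr m * (K * \<bar>x - y\<bar>) \<le> (A * exp (k * s)) * (K * \<bar>x - y\<bar>)"
      using pw s K by (intro mult_right_mono) auto
    also have "\<dots> = (K * A) * (\<bar>x - y\<bar> * exp (k * s))" by simp
    also have "\<dots> \<le> M * (\<bar>x - y\<bar> * exp (k * s))" by (intro mult_right_mono M) simp
    finally show "\<bar>x powr m - y powr m\<bar> \<le> M * \<bar>x - y\<bar> * exp (k * s)"
      using K by (simp add: mult_left_mono mult.assoc)
  qed (rule M)
qed

text \<open>The solutions with \<open>w\<close> tending to \<open>1\<close>. Then \<open>G' = w powr q\<close> tends to \<open>1\<close> as well, so \<open>G\<close> is written as \<open>s + H s\<close> with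
\<open>H\<close> converging to the parameter \<open>d\<close>. Given \<open>H\<close>, the function \<open>W H\<close> is the solution of the first equation with limit
\<open>1\<close>, and the second equation becomes \<open>H = d + tail (J H)\<close>.\<close>

locale slow_flux =
  fixes k m q \<epsilon> M K :: real
  assumes pos: "k > 0" "m > 0" "q > 0" "M > 0" "K > 0" and \<epsilon>: "\<epsilon> = 1 \<or> \<epsilon> = -1"
    and growth: "\<And>s x. 1 \<le> s \<Longrightarrow> s / 2 \<le> x \<Longrightarrow> x \<le> 2 * s \<Longrightarrow> x powr m \<le> M * exp (k * s)"
    and Lipschitz_m: "\<And>s x y. 1 \<le> s \<Longrightarrow> s / 2 \<le> x \<Longrightarrow> x \<le> 2 * s \<Longrightarrow> s / 2 \<le> y \<Longrightarrow> y \<le> 2 * s \<Longrightarrow>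
      \<bar>x powr m - y powr m\<bar> \<le> M * \<bar>x - y\<bar> * exp (k * s)"
    and Lipschitz_q: "\<And>x y. 1 / 2 \<le> x \<Longrightarrow> x \<le> 3 / 2 \<Longrightarrow> 1 / 2 \<le> y \<Longrightarrow> y \<le> 3 / 2 \<Longrightarrow>
      \<bar>x powr q - y powr q\<bar> \<le> K * \<bar>x - y\<bar>"
begin

definition kernel :: "(real \<Rightarrow> real) \<Rightarrow> real \<Rightarrow> real" where
  "kernel H s = exp (- (2 * k) * s) * (s + H s) powr m"

definition W :: "(real \<Rightarrow> real) \<Rightarrow> real \<Rightarrow> real" where
  "W H s = 1 + \<epsilon> * tail (kernel H) s"

definition J :: "(real \<Rightarrow> real) \<Rightarrow> real \<Rightarrow> real" where
  "J H s = 1 - W H s powr q"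

text \<open>The estimates only need \<open>G\<close> to be comparable with \<open>s\<close>. This condition, unlike a ball around \<open>d\<close>, is shared by
the fluxes of different parameters on a common half-line, so the same estimates serve to compare them.\<close>

definition moderate :: "real \<Rightarrow> (real \<Rightarrow> real) set" where
  "moderate S = {H. continuous_on {S<..} H \<and> (\<forall>s>S. s / 2 \<le> s + H s \<and> s + H s \<le> 2 * s)}"

text \<open>From such an \<open>S\<close> on, \<open>W H\<close> lies in the interval from \<open>1/2\<close> to \<open>3/2\<close> on which \<open>K\<close> is a Lipschitz constant.\<close>

definition late :: "real \<Rightarrow> bool" where
  "late S \<longleftrightarrow> 1 \<le> S \<and> M / k * exp (- k * S) \<le> 1 / 2"

abbreviation "L \<equiv> K * (M / k)"

lemma majorant: "tail_majorant {S<..} (\<lambda>s. M * exp (- k * s)) (\<lambda>s. M / k * exp (- k * s))"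
  by (rule exponential_majorant) (use pos in auto)

lemma J_majorant: "tail_majorant {S<..} (\<lambda>s. L * exp (- k * s)) (\<lambda>s. L / k * exp (- k * s))"
  by (rule exponential_majorant) (use pos in auto)

lemma late_mono: "late S \<Longrightarrow> S \<le> S' \<Longrightarrow> late S'"
proof -
  assume S: "late S" "S \<le> S'"
  then have "M / k * exp (- k * S') \<le> M / k * exp (- k * S)"
    using pos by (intro mult_left_mono) auto
  then show ?thesis using S unfolding late_def by (intro conjI) linarith+
qed

lemma moderate_mono: "H \<in> moderate S \<Longrightarrow> S \<le> S' \<Longrightarrow> H \<in> moderate S'"
  by (auto simp: moderate_def intro: continuous_on_subset)

lemma exp_halve: "exp (- (2 * k) * s) * exp (k * s) = exp (- k * s)"
  by (simp flip: exp_add)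

context
  fixes S assumes S: "late S"
begin

interpretation E: tail_majorant "{S<..}" "\<lambda>s. M * exp (- k * s)" "\<lambda>s. M / k * exp (- k * s)"
  by (rule majorant)

lemma kernel_cont:
  assumes "H \<in> moderate S"
  shows "continuous_on {S<..} (kernel H)"
proof -
  have "s + H s \<noteq> 0" if "S < s" for s
  proof -
    have "s / 2 \<le> s + H s" "1 \<le> S" using assms S that by (auto simp: moderate_def late_def)
    then show ?thesis using that by linarith
  qed
  then show ?thesis
    using assms unfolding kernel_def moderate_def by (auto intro!: continuous_intros)
qed

lemma kernel_abs:
  assumes "H \<in> moderate S" "S < s"
  shows "\<bar>kernel H s\<bar> \<le> M * exp (- k * s)"
proof -
  have "(s + H s) powr m \<le> M * exp (k * s)"
    using assms S by (intro growth) (auto simp: moderate_def late_def)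
  then have "exp (- (2 * k) * s) * (s + H s) powr m \<le> exp (- (2 * k) * s) * (M * exp (k * s))"
    by (rule mult_left_mono) simp
  also have "\<dots> = M * exp (- k * s)" using exp_halve[of s] by (simp add: ac_simps)
  finally show ?thesis by (simp add: kernel_def abs_mult)
qed

lemma W_near_one:
  assumes "H \<in> moderate S" "S < s"
  shows "\<bar>W H s - 1\<bar> \<le> M / k * exp (- k * s)" "1 / 2 \<le> W H s" "W H s \<le> 3 / 2"
proof -
  have "\<bar>tail (kernel H) s\<bar> \<le> M / k * exp (- k * s)"
    by (rule E.tail_abs) (use assms kernel_cont kernel_abs in auto)
  then show 1: "\<bar>W H s - 1\<bar> \<le> M / k * exp (- k * s)"
    using \<epsilon> by (auto simp: W_def)
  have "late s" using late_mono S assms by auto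
  then show "1 / 2 \<le> W H s" "W H s \<le> 3 / 2"
    using 1 unfolding late_def abs_le_iff by linarith+
qed

lemma W_deriv:
  assumes "H \<in> moderate S" "S < s"
  shows "(W H has_real_derivative - \<epsilon> * exp (- (2 * k) * s) * (s + H s) powr m) (at s)"
proof -
  have "(W H has_real_derivative 0 + \<epsilon> * (- kernel H s)) (at s)"
    unfolding W_def
    by (intro DERIV_add DERIV_const DERIV_cmult E.tail_has_derivative)
       (use assms kernel_cont kernel_abs in auto)
  then show ?thesis by (simp add: kernel_def mult.assoc)
qed

lemma W_cont: "H \<in> moderate S \<Longrightarrow> continuous_on {S<..} (W H)"
  using W_deriv
  by (intro DERIV_continuous_on[of _ _ "\<lambda>s. - \<epsilon> * exp (- (2 * k) * s) * (s + H s) powr m"])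
     (auto intro: has_field_derivative_at_within)

lemma W_Lipschitz:
  assumes H: "H \<in> moderate S" "H' \<in> moderate S" and D: "\<And>t. S < t \<Longrightarrow> \<bar>H t - H' t\<bar> \<le> D" and s: "S < s"
  shows "\<bar>W H s - W H' s\<bar> \<le> M * D / k * exp (- k * s)"
proof -
  have "\<bar>tail (kernel H) s - tail (kernel H') s\<bar> \<le> M * D / k * exp (- k * s)"
  proof (rule tail_exp_Lipschitz[OF pos(1) s _ _ _ _ pos(1)])
    fix x assume "S < x"
    then have x: "S < x" "1 \<le> x" using S by (auto simp: late_def)
    have "\<bar>(x + H x) powr m - (x + H' x) powr m\<bar> \<le> M * \<bar>(x + H x) - (x + H' x)\<bar> * exp (k * x)"
      using H x by (intro Lipschitz_m) (auto simp: moderate_def)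
    also have "\<dots> \<le> M * D * exp (k * x)"
      using D[OF x(1)] pos by (intro mult_right_mono mult_left_mono) auto
    finally have "exp (- (2 * k) * x) * \<bar>(x + H x) powr m - (x + H' x) powr m\<bar>
        \<le> exp (- (2 * k) * x) * (M * D * exp (k * x))"
      by (rule mult_left_mono) simp
    also have "\<dots> = M * D * (exp (- (2 * k) * x) * exp (k * x))" by (simp only: ac_simps)
    finally show "\<bar>kernel H x - kernel H' x\<bar> \<le> M * D * exp (- k * x)"
      unfolding kernel_def exp_halve by (simp add: abs_mult flip: right_diff_distrib)
  qed (use s kernel_cont kernel_abs H in auto)
  moreover have "\<bar>W H s - W H' s\<bar> = \<bar>tail (kernel H) s - tail (kernel H') s\<bar>"
    using \<epsilon> by (auto simp: W_def)
  ultimately show ?thesis by simp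
qed

lemma J_cont:
  assumes "H \<in> moderate S"
  shows "continuous_on {S<..} (J H)"
proof -
  have "W H s \<noteq> 0" if "S < s" for s
    using W_near_one(2)[OF assms that] by linarith
  then show ?thesis
    unfolding J_def by (intro continuous_intros W_cont assms) auto
qed

lemma J_abs:
  assumes "H \<in> moderate S" "S < s"
  shows "\<bar>J H s\<bar> \<le> L * exp (- k * s)"
proof -
  have "\<bar>W H s powr q - 1 powr q\<bar> \<le> K * \<bar>W H s - 1\<bar>"
    by (rule Lipschitz_q) (use W_near_one[OF assms] in auto)
  also have "\<dots> \<le> K * (M / k * exp (- k * s))"
    using W_near_one(1)[OF assms] pos by (intro mult_left_mono) auto
  finally show ?thesis by (simp add: J_def abs_minus_commute mult.assoc)
qed

lemma J_Lipschitz: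
  assumes H: "H \<in> moderate S" "H' \<in> moderate S" and D: "\<And>t. S < t \<Longrightarrow> \<bar>H t - H' t\<bar> \<le> D" and s: "S < s"
  shows "\<bar>J H s - J H' s\<bar> \<le> L * D * exp (- k * s)"
proof -
  have "\<bar>J H s - J H' s\<bar> = \<bar>W H s powr q - W H' s powr q\<bar>"
    by (simp add: J_def abs_minus_commute)
  also have "\<dots> \<le> K * \<bar>W H s - W H' s\<bar>"
    by (rule Lipschitz_q) (use W_near_one H s in auto)
  also have "\<dots> \<le> K * (M * D / k * exp (- k * s))"
    using W_Lipschitz[OF H D s] pos by (intro mult_left_mono) auto
  finally show ?thesis by (simp add: mult.assoc)
qed

end

definition T0 :: real where
  "T0 = (SOME T. 2 \<le> T \<and> late T \<and> L / k * exp (- k * T) \<le> 1 / 2)"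

lemma T0: "2 \<le> T0" "late T0" "L / k * exp (- k * T0) \<le> 1 / 2"
proof -
  have p: "(1 / 2 :: real) > 0" by simp
  have "((\<lambda>T. M / k * exp (- k * T)) \<longlongrightarrow> 0) at_top" "((\<lambda>T. L / k * exp (- k * T)) \<longlongrightarrow> 0) at_top"
    using pos by real_asymp+
  then have "\<forall>\<^sub>F T in at_top. M / k * exp (- k * T) < 1 / 2"
    "\<forall>\<^sub>F T in at_top. L / k * exp (- k * T) < 1 / 2"
    using order_tendstoD(2)[OF _ p] by blast+
  then have "\<forall>\<^sub>F T in at_top. 2 \<le> T \<and> late T \<and> L / k * exp (- k * T) \<le> 1 / 2"
    using eventually_ge_at_top[of 2] by eventually_elim (auto simp: late_def)
  then have "\<exists>T. 2 \<le> T \<and> late T \<and> L / k * exp (- k * T) \<le> 1 / 2"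
    by (auto simp: eventually_at_top_linorder)
  from someI_ex[OF this] show "2 \<le> T0" "late T0" "L / k * exp (- k * T0) \<le> 1 / 2"
    unfolding T0_def by auto
qed

text \<open>The summand \<open>2 * \<bar>d\<bar>\<close> makes \<open>s + H s\<close> comparable with \<open>s\<close> for all \<open>H\<close> within distance \<open>1\<close> of \<open>d\<close>, and keeps the
beginning of the half-line continuous in \<open>d\<close>.\<close>

definition start :: "real \<Rightarrow> real" where "start d = T0 + 2 * \<bar>d\<bar>"

lemma start: "late (start d)" "2 + 2 * \<bar>d\<bar> \<le> start d" "L / k * exp (- k * (start d + 1)) \<le> 1 / 2"
proof -
  show "late (start d)" using late_mono[OF T0(2)] by (simp add: start_def)
  show "2 + 2 * \<bar>d\<bar> \<le> start d" using T0(1) by (simp add: start_def)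
  have "L / k * exp (- k * (start d + 1)) \<le> L / k * exp (- k * T0)"
    using pos by (intro mult_left_mono) (auto simp: start_def)
  then show "L / k * exp (- k * (start d + 1)) \<le> 1 / 2" using T0(3) by linarith
qed

lemma exists_flux:
  "\<exists>H. continuous_on UNIV H \<and> (\<forall>t. \<bar>H t - d\<bar> \<le> 1) \<and> (\<forall>t\<ge>start d + 1. H t = d + tail (J H) t)"
proof -
  define B where "B = {H :: real \<Rightarrow> real. continuous_on UNIV H \<and> (\<forall>t. \<bar>H t - d\<bar> \<le> 1)}"
  have BC: "H \<in> moderate (start d)" if "H \<in> B" for H
  proof -
    have "s / 2 \<le> s + H s \<and> s + H s \<le> 2 * s" if "start d < s" for s
    proof -
      have "\<bar>H s - d\<bar> \<le> 1" using \<open>H \<in> B\<close> by (auto simp: B_def)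
      then show ?thesis using start(2)[of d] that by (auto simp: abs_le_iff)
    qed
    moreover have "continuous_on {start d<..} H"
      using \<open>H \<in> B\<close> by (auto simp: B_def intro: continuous_on_subset)
    ultimately show ?thesis by (auto simp: moderate_def)
  qed
  obtain H where "H \<in> B" "\<And>t. start d + 1 \<le> t \<Longrightarrow> H t = d + tail (J H) t"
  proof (rule tail_fixed_point[of k L 1 d "start d" J, folded B_def])
    show "L / k * exp (- k * (start d + 1)) \<le> 1" "L / k * exp (- k * (start d + 1)) \<le> 1 / 2"
      using start(3)[of d] by linarith+
  qed (use pos J_cont[OF start(1) BC] J_abs[OF start(1) BC] J_Lipschitz[OF start(1) BC BC] in auto)
  then show ?thesis by (auto simp: B_def)
qed

definition H :: "real \<Rightarrow> real \<Rightarrow> real" where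
  "H d = (SOME H. continuous_on UNIV H \<and> (\<forall>t. \<bar>H t - d\<bar> \<le> 1) \<and> (\<forall>t\<ge>start d + 1. H t = d + tail (J H) t))"

lemma H: "continuous_on UNIV (H d)" "\<bar>H d t - d\<bar> \<le> 1" "start d + 1 \<le> t \<Longrightarrow> H d t = d + tail (J (H d)) t"
  using someI_ex[OF exists_flux[of d]] unfolding H_def[symmetric] by auto

lemma H_moderate: "H d \<in> moderate (start d)"
proof -
  have "s / 2 \<le> s + H d s \<and> s + H d s \<le> 2 * s" if "start d < s" for s
    using H(2)[of d s] start(2)[of d] that by (auto simp: abs_le_iff)
  then show ?thesis
    using H(1) by (auto simp: moderate_def intro: continuous_on_subset)
qed

lemma H_lim: "(H d \<longlongrightarrow> d) at_top"
proof -
  interpret J: tail_majorant "{start d<..}" "\<lambda>s. L * exp (- k * s)" "\<lambda>s. L / k * exp (- k * s)"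
    by (rule J_majorant)
  have "((\<lambda>t. d + tail (J (H d)) t) \<longlongrightarrow> d + 0) at_top"
    by (intro tendsto_add tendsto_const J.tail_lim)
       (use J_cont[OF start(1) H_moderate] J_abs[OF start(1) H_moderate] in auto)
  moreover have "\<forall>\<^sub>F t in at_top. d + tail (J (H d)) t = H d t"
    using H(3) by (auto intro!: eventually_mono[OF eventually_ge_at_top[of "start d + 1"]])
  ultimately show ?thesis by (auto intro: Lim_transform_eventually)
qed

text \<open>The parameter enters the fixed point equation as a translation, and the integral operator has Lipschitz
constant \<open>1/2\<close>. Hence the supremum \<open>D\<close> of the differences satisfies \<open>D \<le> \<bar>d - e\<bar> + D / 2\<close>.\<close>

lemma H_Lipschitz:
  assumes "start d + 1 \<le> S" "start e + 1 \<le> S" "S < t"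
  shows "\<bar>H d t - H e t\<bar> \<le> 2 * \<bar>d - e\<bar>"
proof -
  have S: "late S" "H d \<in> moderate S" "H e \<in> moderate S" "L / k * exp (- k * S) \<le> 1 / 2"
  proof -
    show "late S" "H d \<in> moderate S" "H e \<in> moderate S"
      using late_mono[OF start(1)[of d]] moderate_mono[OF H_moderate] assms by auto
    have "L / k * exp (- k * S) \<le> L / k * exp (- k * (start d + 1))"
      using pos assms by (intro mult_left_mono) auto
    then show "L / k * exp (- k * S) \<le> 1 / 2" using start(3)[of d] by linarith
  qed
  define D where "D = (SUP t\<in>{S<..}. \<bar>H d t - H e t\<bar>)"
  have bdd: "bdd_above ((\<lambda>t. \<bar>H d t - H e t\<bar>) ` {S<..})"
  proof (rule bdd_aboveI2)
    show "\<bar>H d t - H e t\<bar> \<le> \<bar>d - e\<bar> + 2" for t using H(2)[of d t] H(2)[of e t] by linarith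
  qed
  have leD: "\<bar>H d t - H e t\<bar> \<le> D" if "S < t" for t
    unfolding D_def by (rule cSUP_upper[OF _ bdd]) (use that in auto)
  have D0: "D \<ge> 0" using leD[OF assms(3)] by linarith
  have "\<bar>H d t - H e t\<bar> \<le> \<bar>d - e\<bar> + 1 / 2 * D" if t: "S < t" for t
  proof -
    have "\<bar>tail (J (H d)) t - tail (J (H e)) t\<bar> \<le> L * D / k * exp (- k * t)"
      by (rule tail_exp_Lipschitz[OF pos(1) t _ _ _ _ pos(1), where M = L])
         (use J_cont[OF S(1)] J_abs[OF S(1)] J_Lipschitz[OF S(1-3) leD] S in auto)
    also have "\<dots> \<le> L * D / k * exp (- k * S)"
      using pos D0 t by (intro mult_left_mono) auto
    also have "\<dots> = (L / k * exp (- k * S)) * D" by simp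
    also have "\<dots> \<le> 1 / 2 * D" by (rule mult_right_mono[OF S(4) D0])
    finally show ?thesis using H(3)[of d t] H(3)[of e t] assms t by linarith
  qed
  then have "D \<le> \<bar>d - e\<bar> + 1 / 2 * D"
    unfolding D_def by (intro cSUP_least) auto
  then have "D \<le> 2 * \<bar>d - e\<bar>" by simp
  with leD[OF assms(3)] show ?thesis by (rule order_trans)
qed

text \<open>Lipschitz continuity in \<open>d\<close>, uniform in \<open>t\<close>, together with continuity in \<open>t\<close>.\<close>

lemma W_family_continuous:
  "continuous_on {(d, t). start d + 1 < t} (\<lambda>(d, t). W (H d) t)"
proof -
  let ?A = "{(d, t). start d + 1 < t}"
  have "((\<lambda>x. W (H (fst x)) (snd x)) \<longlongrightarrow> W (H d) t) (at (d, t) within ?A)"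
    if dt: "start d + 1 < t" for d t
  proof -
    let ?F = "at (d, t) within ?A"
    define S where "S = start d + 1"
    have S: "late S" "H d \<in> moderate S"
      using late_mono[OF start(1), of d S] moderate_mono[OF H_moderate, of d S] by (auto simp: S_def)
    have fst: "((\<lambda>x. fst x) \<longlongrightarrow> d) ?F"
      using tendsto_fst[OF tendsto_ident_at, of "(d, t)" ?A] by simp
    have snd: "((\<lambda>x. snd x) \<longlongrightarrow> t) ?F"
      using tendsto_snd[OF tendsto_ident_at, of "(d, t)" ?A] by simp
    have "isCont (W (H d)) t"
      using W_deriv[OF S] dt DERIV_isCont by (auto simp: S_def)
    then have 1: "((\<lambda>x. W (H d) (snd x)) \<longlongrightarrow> W (H d) t) ?F"
      by (rule isCont_tendsto_compose[OF _ snd])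
    have "((\<lambda>x. W (H (fst x)) (snd x) - W (H d) (snd x)) \<longlongrightarrow> 0) ?F"
    proof (rule Lim_null_comparison)
      have "((\<lambda>x. 2 * M / k * \<bar>fst x - d\<bar>) \<longlongrightarrow> 2 * M / k * \<bar>d - d\<bar>) ?F"
        by (intro tendsto_intros fst)
      then show "((\<lambda>x. 2 * M / k * \<bar>fst x - d\<bar>) \<longlongrightarrow> 0) ?F" by simp
      have "\<forall>\<^sub>F x in ?F. snd x > S"
        using order_tendstoD(1)[OF snd] dt by (auto simp: S_def)
      moreover have "\<forall>\<^sub>F x in ?F. x \<in> ?A"
        by (simp add: eventually_at_filter)
      ultimately show "\<forall>\<^sub>F x in ?F. norm (W (H (fst x)) (snd x) - W (H d) (snd x)) \<le> 2 * M / k * \<bar>fst x - d\<bar>"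
      proof eventually_elim
        case (elim x)
        define S' where "S' = max S (start (fst x) + 1)"
        have S': "late S'" "H d \<in> moderate S'" "H (fst x) \<in> moderate S'" "S' < snd x"
          using late_mono[OF S(1)] moderate_mono[OF S(2)] moderate_mono[OF H_moderate] elim
          by (auto simp: S'_def)
        have "norm (W (H (fst x)) (snd x) - W (H d) (snd x))
            \<le> M * (2 * \<bar>fst x - d\<bar>) / k * exp (- k * snd x)"
          unfolding real_norm_def
          by (rule W_Lipschitz[OF S'(1,3,2) H_Lipschitz[of "fst x" S' d] S'(4)]) (auto simp: S'_def S_def)
        also have "\<dots> \<le> M * (2 * \<bar>fst x - d\<bar>) / k * 1"
        proof (rule mult_left_mono)
          have "snd x \<ge> 0" using S' by (auto simp: late_def)
          then show "exp (- k * snd x) \<le> 1" using pos by simp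
        qed (use pos in auto)
        finally show ?case by (simp add: ac_simps)
      qed
    qed
    from tendsto_add[OF this 1] show ?thesis by simp
  qed
  then show ?thesis by (auto simp: continuous_on_def split_beta)
qed

lemma family:
  assumes "start d + 1 < t"
  shows "1 / 2 \<le> W (H d) t" "0 < t + H d t"
    "(W (H d) has_real_derivative - \<epsilon> * exp (- (2 * k) * t) * (t + H d t) powr m) (at t)"
    "((\<lambda>t. t + H d t) has_real_derivative W (H d) t powr q) (at t)"
proof -
  have t: "start d < t" using assms by simp
  show "1 / 2 \<le> W (H d) t" "(W (H d) has_real_derivative - \<epsilon> * exp (- (2 * k) * t) * (t + H d t) powr m) (at t)"
    using W_near_one[OF start(1) H_moderate t] W_deriv[OF start(1) H_moderate t] by auto
  show "0 < t + H d t"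
  proof -
    have "t / 2 \<le> t + H d t" using H_moderate[of d] t by (simp add: moderate_def)
    then show ?thesis using start(2)[of d] t by linarith
  qed
  interpret J: tail_majorant "{start d<..}" "\<lambda>s. L * exp (- k * s)" "\<lambda>s. L / k * exp (- k * s)"
    by (rule J_majorant)
  have "((\<lambda>t. t + (d + tail (J (H d)) t)) has_real_derivative 1 + (0 + - J (H d) t)) (at t)"
    by (intro DERIV_add DERIV_ident DERIV_const J.tail_has_derivative)
       (use t J_cont[OF start(1) H_moderate] J_abs[OF start(1) H_moderate] in auto)
  then have "((\<lambda>t. t + (d + tail (J (H d)) t)) has_real_derivative W (H d) t powr q) (at t)"
    by (simp add: J_def)
  then show "((\<lambda>t. t + H d t) has_real_derivative W (H d) t powr q) (at t)"
    by (rule has_field_derivative_transform_within_open[of _ _ _ "{start d + 1<..}"])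
       (use assms H(3) in auto)
qed

lemma W_lim: "(W (H d) \<longlongrightarrow> 1) at_top"
proof (rule LIM_zero_cancel, rule Lim_null_comparison)
  show "\<forall>\<^sub>F t in at_top. norm (W (H d) t - 1) \<le> M / k * exp (- k * t)"
    using W_near_one(1)[OF start(1) H_moderate]
    by (auto intro!: eventually_mono[OF eventually_gt_at_top[of "start d"]])
  show "((\<lambda>t. M / k * exp (- k * t)) \<longlongrightarrow> 0) at_top"
    using pos by real_asymp
qed

end

text \<open>Here \<open>a = \<epsilon>\<close>: when \<open>w\<close> tends to \<open>1\<close>, the derivative of \<open>F\<close> tends to \<open>- \<epsilon>\<close>, and \<open>F\<close> takes this sign. The limit
of \<open>G d t - t\<close> is what distinguishes the members of the family.\<close>

lemma constant_limit_family:
  fixes \<beta> m q \<epsilon> :: real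
  assumes pos: "\<beta> > 0" "m > 0" "q > 0" and \<epsilon>: "\<epsilon> = 1 \<or> \<epsilon> = -1"
  obtains T V G where
    "continuous_on UNIV (T :: real \<Rightarrow> real)"
    "continuous_on {(d, t). T d < t} (\<lambda>(d, t). V d t)"
    "\<And>d t. T d < t \<Longrightarrow> 0 < V d t \<and> 0 < G d t"
    "\<And>d t. T d < t \<Longrightarrow> (V d has_real_derivative - \<epsilon> * exp (- \<beta> * t) * G d t powr m) (at t)"
    "\<And>d t. T d < t \<Longrightarrow> (G d has_real_derivative V d t powr q) (at t)"
    "\<And>d. (V d \<longlongrightarrow> 1) at_top" "\<And>d. ((\<lambda>t. G d t - t) \<longlongrightarrow> d) at_top"
proof -
  obtain M where M: "M > 0"
    "\<And>s x. 1 \<le> s \<Longrightarrow> s / 2 \<le> x \<Longrightarrow> x \<le> 2 * s \<Longrightarrow> x powr m \<le> M * exp (\<beta> / 2 * s)"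
    "\<And>s x y. 1 \<le> s \<Longrightarrow> s / 2 \<le> x \<Longrightarrow> x \<le> 2 * s \<Longrightarrow> s / 2 \<le> y \<Longrightarrow> y \<le> 2 * s \<Longrightarrow>
      \<bar>x powr m - y powr m\<bar> \<le> M * \<bar>x - y\<bar> * exp (\<beta> / 2 * s)"
    using power_growth_bound[of "\<beta> / 2" m] pos by (metis half_gt_zero)
  obtain K where K: "K > 0"
    "\<And>x y. 1 / 2 \<le> x \<Longrightarrow> x \<le> 3 / 2 \<Longrightarrow> 1 / 2 \<le> y \<Longrightarrow> y \<le> 3 / 2 \<Longrightarrow> \<bar>x powr q - y powr q\<bar> \<le> K * \<bar>x - y\<bar>"
    using powr_Lipschitz_on_interval[of "1 / 2" "3 / 2" q] by (metis half_gt_zero zero_less_one)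
  interpret F: slow_flux "\<beta> / 2" m q \<epsilon> M K
    by unfold_locales (use pos \<epsilon> M K in auto)
  show thesis
  proof
    show "continuous_on UNIV (\<lambda>d. F.start d + 1)"
      unfolding F.start_def by (intro continuous_intros)
    show "continuous_on {(d, t). F.start d + 1 < t} (\<lambda>(d, t). F.W (F.H d) t)"
      by (rule F.W_family_continuous)
    fix d
    show "0 < F.W (F.H d) t \<and> 0 < t + F.H d t" if "F.start d + 1 < t" for t
      using F.family[OF that] by auto
    show "(F.W (F.H d) has_real_derivative - \<epsilon> * exp (- \<beta> * t) * (t + F.H d t) powr m) (at t)"
      if "F.start d + 1 < t" for t
      using F.family(3)[OF that] by simp
    show "((\<lambda>t. t + F.H d t) has_real_derivative F.W (F.H d) t powr q) (at t)"
      if "F.start d + 1 < t" for t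
      by (rule F.family(4)[OF that])
    show "(F.W (F.H d) \<longlongrightarrow> 1) at_top" by (rule F.W_lim)
    show "((\<lambda>t. t + F.H d t - t) \<longlongrightarrow> d) at_top" using F.H_lim by simp
  qed
qed

section \<open>The saddle of the normal form\<close>

text \<open>In the variables \<open>u exp (- t)\<close>, \<open>v exp (- q t)\<close> the linearisation at \<open>(1, 1)\<close> has the rows \<open>(- 1, m)\<close> and
\<open>(q\<^sup>2, - q)\<close>; the equation is its characteristic equation. The other eigenvalue is \<open>- (\<nu> + 1 + q)\<close>, by the trace.\<close>

lemma saddle_eigenvalue:
  fixes m q :: real
  assumes "q > 0" "q * m > 1"
  obtains \<nu> where "\<nu> > 0" "(\<nu> + 1) * (\<nu> + q) = q\<^sup>2 * m"
proof -
  define D where "D = (1 + q)\<^sup>2 + 4 * (q\<^sup>2 * m - q)"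
  have "q * 1 < q * (q * m)" using assms by (intro mult_strict_left_mono) auto
  then have qm: "q\<^sup>2 * m - q > 0" by (simp add: power2_eq_square mult.assoc)
  then have D: "D > (1 + q)\<^sup>2" by (simp add: D_def)
  then have "sqrt D > 1 + q" using assms by (intro real_less_rsqrt) auto
  moreover define \<nu> where "\<nu> = (sqrt D - (1 + q)) / 2"
  ultimately have "\<nu> > 0" by simp
  have "2 * \<nu> + (1 + q) = sqrt D" by (simp add: \<nu>_def field_simps)
  moreover have "(sqrt D)\<^sup>2 = D"
    using D by (intro real_sqrt_pow2 less_imp_le order.strict_trans1[OF zero_le_power2])
  ultimately have "(2 * \<nu> + (1 + q))\<^sup>2 = D" by simp
  with \<open>\<nu> > 0\<close> show thesis
    by (intro that[of \<nu>]) (auto simp: D_def power2_eq_square algebra_simps)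
qed

lemma exp_convex_combination:
  fixes x \<theta> :: real
  assumes "0 \<le> \<theta>" "\<theta> \<le> 1"
  shows "exp (\<theta> * x) \<le> 1 - \<theta> * (1 - exp x)"
proof -
  have "exp ((1 - \<theta>) *\<^sub>R 0 + \<theta> *\<^sub>R x) \<le> (1 - \<theta>) * exp 0 + \<theta> * exp x"
    by (rule convex_onD[OF exp_convex]) (use assms in auto)
  then show ?thesis by (simp add: algebra_simps)
qed

lemma ln_one_plus_ge:
  fixes x :: real
  assumes "x \<ge> 0"
  shows "x / (1 + x) \<le> ln (1 + x)"
proof -
  have "ln (1 / (1 + x)) \<le> 1 / (1 + x) - 1"
    using assms by (intro ln_le_minus_one) auto
  moreover have "1 / (1 + x) - 1 = - (x / (1 + x))" using assms by (simp add: field_simps)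
  ultimately show ?thesis using assms by (simp add: ln_div)
qed

lemma ln_affine_has_derivative:
  fixes c k :: real
  assumes s: "(s has_real_derivative - k * s t) (at t)" and c: "c \<noteq> 0" and pos: "1 + c * s t > 0"
  shows "((\<lambda>t. ln (1 + c * s t) / c) has_real_derivative - (k * s t / (1 + c * s t))) (at t)"
proof -
  have "((\<lambda>t. 1 + c * s t) has_real_derivative 0 + c * (- k * s t)) (at t)"
    by (intro DERIV_add DERIV_const DERIV_cmult s)
  then have "((\<lambda>t. ln (1 + c * s t) / c) has_real_derivative
      (1 / (1 + c * s t) * (0 + c * (- k * s t))) / c) (at t)"
    by (intro DERIV_cdivide DERIV_chain2[where f = ln and g = "\<lambda>t. 1 + c * s t" and x = t, OF DERIV_ln_divide[OF pos]])
  then show ?thesis using c by simp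
qed

text \<open>The fields of the normal form are powers with a nonnegative weight. The sign \<open>\<delta>\<close> allows for the second unknown
\<open>- v\<close>, in which the field of the first equation is again increasing.\<close>

lemma power_barrier:
  fixes f :: "real \<Rightarrow> real \<Rightarrow> real" and below above :: "real \<Rightarrow> real"
  assumes f: "\<And>t y. f t y = \<delta> * (h t * (\<delta> * y) powr k)"
    and h: "continuous_on I h" "\<And>t. 0 \<le> h t" and k: "k > 0" and \<delta>: "\<delta> = 1 \<or> \<delta> = -1"
    and pos: "\<And>t. t \<in> I \<Longrightarrow> 0 < \<delta> * below t \<and> 0 < \<delta> * above t"
    and "open I" "\<And>s t. t \<in> I \<Longrightarrow> t \<le> s \<Longrightarrow> s \<in> I"
    and "\<And>t. t \<in> I \<Longrightarrow> (lower has_real_derivative - lower' t) (at t)"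
    and "\<And>t. t \<in> I \<Longrightarrow> (upper has_real_derivative - upper' t) (at t)"
    and "continuous_on I lower'" "continuous_on I upper'"
    and "((\<lambda>t. upper t - lower t) \<longlongrightarrow> 0) at_top"
    and "\<And>t. t \<in> I \<Longrightarrow> below t \<le> above t"
    and "\<And>t. t \<in> I \<Longrightarrow> lower' t \<le> f t (below t)"
    and "\<And>t. t \<in> I \<Longrightarrow> f t (above t) \<le> upper' t"
  shows "barrier I f lower upper lower' upper' below above"
proof
  have y: "\<delta> * y > 0" if "t \<in> I" "below t \<le> y" "y \<le> above t" for t y
    using \<delta> pos[OF that(1)] that by auto
  show "f t x \<le> f t y" if t: "t \<in> I" and xy: "below t \<le> x" "x \<le> y" "y \<le> above t" for t x y
  proof -
    have "0 < \<delta> * x" "0 < \<delta> * y" using y[OF t, of x] y[OF t, of y] xy by auto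
    with \<delta> have "\<delta> * (\<delta> * x) powr k \<le> \<delta> * (\<delta> * y) powr k"
      using k xy by (elim disjE) (simp_all add: powr_mono2)
    then have "h t * (\<delta> * (\<delta> * x) powr k) \<le> h t * (\<delta> * (\<delta> * y) powr k)"
      by (rule mult_left_mono[OF _ h(2)])
    then show ?thesis by (simp add: f ac_simps)
  qed
  let ?D = "{(t, y). t \<in> I \<and> below t \<le> y \<and> y \<le> above t}"
  have "continuous_on ?D (\<lambda>x. h (fst x))"
    by (rule continuous_on_compose2[OF h(1)]) (auto intro!: continuous_intros)
  moreover have "\<delta> * snd x \<noteq> 0" if "x \<in> ?D" for x using y[of "fst x" "snd x"] that by auto
  ultimately have "continuous_on ?D (\<lambda>x. \<delta> * (h (fst x) * (\<delta> * snd x) powr k))"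
    by (intro continuous_intros) auto
  then show "continuous_on ?D (\<lambda>(t, y). f t y)" by (simp add: f case_prod_unfold)
qed (use assms in auto)

text \<open>The branch of the unstable manifold of the saddle that runs to the origin. Time is reversed, so that the saddle
is reached at infinity. With \<open>s = exp (- \<nu> t)\<close>, where \<open>\<nu>\<close> is the positive eigenvalue and \<open>(1, \<eta>)\<close> its
eigenvector, the pairs \<open>(U \<phi>, V \<phi>)\<close> are the curves whose logarithmic coordinates relative to the explicit
solution are \<open>- \<phi>\<close> and \<open>- \<eta> \<phi>\<close>. For \<open>\<phi> = s\<close> this is the linearised solution, and it is a subsolution because
\<open>exp z \<ge> 1 + z\<close>. The choice \<open>\<psi> = ln (1 + \<nu> s) / \<nu>\<close> solves the first equation exactly and is a supersolution of
the second one by convexity, since \<open>\<eta> \<le> q\<close>. For \<open>t\<close> tending to minus infinity, \<open>\<psi> t + t\<close> tends to \<open>ln \<nu> / \<nu>\<close>, so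
the upper barrier \<open>U \<psi>\<close> stays bounded there; this is what bounds \<open>u\<close>.\<close>

lemma connecting_orbit:
  fixes m q :: real
  assumes m: "m > 0" and q: "q > 0" and qm: "q * m > 1"
  obtains u v where
    "\<And>t. (u has_real_derivative exp (- (q * m - 1) * t) * v t powr m) (at t)"
    "\<And>t. (v has_real_derivative q * u t powr q) (at t)"
    "\<And>t. 0 < u t \<and> u t < exp t" "\<And>t. 0 < v t"
    "((\<lambda>t. u t / exp t) \<longlongrightarrow> 1) at_bot"
    "\<exists>C>0. (u \<longlongrightarrow> C) at_top"
proof -
  obtain \<nu> where \<nu>: "\<nu> > 0" "(\<nu> + 1) * (\<nu> + q) = q\<^sup>2 * m"
    by (rule saddle_eigenvalue[OF q qm])
  define \<eta> where "\<eta> = (\<nu> + 1) / m"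
  have \<eta>: "\<eta> > 0" "m * \<eta> = \<nu> + 1" using \<nu> m by (auto simp: \<eta>_def)
  have "\<eta> * (\<nu> + q) = q\<^sup>2" using \<nu>(2) m by (simp add: \<eta>_def)
  then have q\<eta>: "q - \<eta> = \<nu> * \<eta> / q" using q by (simp add: field_simps power2_eq_square)
  have "\<eta> \<le> q"
  proof -
    have "\<nu> * \<eta> / q > 0" using \<nu> \<eta> q by simp
    then show ?thesis using q\<eta> by linarith
  qed
  define f g where "f t y = exp ((q * m - 1) * t) * y powr m" and "g t x = q * x powr q"
    for t x y :: real
  define U V where "U \<phi> t = exp (- t - \<phi> t)" and "V \<phi> t = exp (- q * t - \<eta> * \<phi> t)"
    for \<phi> :: "real \<Rightarrow> real" and t
  have fV: "f t (V \<phi> t) = U \<phi> t * exp (- \<nu> * \<phi> t)" for \<phi> t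
  proof -
    have "V \<phi> t powr m = exp (m * (- q * t - \<eta> * \<phi> t))" by (simp add: V_def powr_def)
    also have "m * (- q * t - \<eta> * \<phi> t) = - (q * m) * t - (m * \<eta>) * \<phi> t" by (simp add: algebra_simps)
    finally show ?thesis unfolding f_def U_def \<eta>(2) by (simp add: algebra_simps flip: exp_add)
  qed
  have gU: "g t (U \<phi> t) = q * V \<phi> t * exp (- (\<nu> * \<eta> / q) * \<phi> t)" for \<phi> t
  proof -
    have "U \<phi> t powr q = exp (q * (- t - \<phi> t))" by (simp add: U_def powr_def)
    also have "q * (- t - \<phi> t) = (- q * t - \<eta> * \<phi> t) + (- (q - \<eta>) * \<phi> t)" by (simp add: algebra_simps)
    finally have "U \<phi> t powr q = V \<phi> t * exp (- (q - \<eta>) * \<phi> t)"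
      by (simp only: V_def exp_add)
    then show ?thesis unfolding g_def q\<eta> by (simp only: mult.assoc)
  qed
  have U_deriv: "(U \<phi> has_real_derivative - (U \<phi> t * (1 - \<phi>' t))) (at t)"
    and V_deriv: "(V \<phi> has_real_derivative - (V \<phi> t * (q - \<eta> * \<phi>' t))) (at t)"
    if "(\<phi> has_real_derivative - \<phi>' t) (at t)" for \<phi> \<phi>' t
    unfolding U_def[abs_def] V_def[abs_def]
    by (auto intro!: derivative_eq_intros that simp: algebra_simps)
  define s where "s t = exp (- \<nu> * t)" for t
  have s: "s t > 0" "(s has_real_derivative - \<nu> * s t) (at t)" for t
    unfolding s_def[abs_def] by (auto intro!: derivative_eq_intros)
  define \<phi> \<phi>' where "\<phi> = s" and "\<phi>' t = \<nu> * s t" for t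
  define \<psi> \<psi>' where "\<psi> t = ln (1 + \<nu> * s t) / \<nu>" and "\<psi>' t = \<nu> * s t / (1 + \<nu> * s t)" for t
  have pos: "1 + \<nu> * s t > 0" for t using mult_pos_pos[OF \<nu>(1) s(1)[of t]] by linarith
  have d\<phi>: "(\<phi> has_real_derivative - \<phi>' t) (at t)" for t using s by (simp add: \<phi>_def \<phi>'_def)
  have d\<psi>: "(\<psi> has_real_derivative - \<psi>' t) (at t)" for t
    unfolding \<psi>_def[abs_def] \<psi>'_def
    by (rule ln_affine_has_derivative[OF s(2) _ pos]) (use \<nu> in simp)
  have cont: "continuous_on UNIV \<phi>" "continuous_on UNIV \<psi>" "continuous_on UNIV \<phi>'" "continuous_on UNIV \<psi>'"
    unfolding \<phi>_def \<psi>_def[abs_def] \<phi>'_def[abs_def] \<psi>'_def[abs_def] s_def[abs_def]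
    using \<nu>(1) pos unfolding s_def by (auto intro!: continuous_intros simp: less_imp_neq[symmetric])
  have \<psi>\<phi>: "0 < \<psi> t" "\<psi> t \<le> \<phi> t" for t
  proof -
    have ls: "\<nu> * s t > 0" using \<nu> s by simp
    then show "0 < \<psi> t" using \<nu> by (simp add: \<psi>_def)
    have "ln (1 + \<nu> * s t) \<le> \<nu> * s t" using ls by (intro ln_add_one_self_le_self) auto
    then show "\<psi> t \<le> \<phi> t" using \<nu> by (simp add: \<psi>_def \<phi>_def field_simps)
  qed
  have e\<psi>: "exp (- \<nu> * \<psi> t) = 1 - \<psi>' t" for t
    using \<nu> pos[of t] by (simp add: \<psi>_def \<psi>'_def exp_minus field_simps)
  have subU: "U \<phi> t * (1 - \<phi>' t) \<le> f t (V \<phi> t)" for t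
    unfolding fV
    by (rule mult_left_mono)
       (use exp_ge_add_one_self[of "- \<nu> * \<phi> t"] in \<open>auto simp: \<phi>_def \<phi>'_def U_def\<close>)
  have superU: "f t (V \<psi> t) \<le> U \<psi> t * (1 - \<psi>' t)" for t
    unfolding fV e\<psi> by simp
  have subV: "V \<phi> t * (q - \<eta> * \<phi>' t) \<le> g t (U \<phi> t)" for t
  proof -
    have "q * (1 - \<nu> * \<eta> / q * s t) \<le> q * exp (- (\<nu> * \<eta> / q) * s t)"
      by (rule mult_left_mono)
         (use exp_ge_add_one_self[of "- (\<nu> * \<eta> / q) * s t"] q in auto)
    moreover have "q * (1 - \<nu> * \<eta> / q * s t) = q - \<eta> * (\<nu> * s t)" using q by (simp add: algebra_simps)
    ultimately have "V \<phi> t * (q - \<eta> * \<phi>' t) \<le> V \<phi> t * (q * exp (- (\<nu> * \<eta> / q) * \<phi> t))"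
      by (intro mult_left_mono) (auto simp: \<phi>_def \<phi>'_def V_def)
    then show ?thesis unfolding gU by (simp add: ac_simps)
  qed
  have superV: "g t (U \<psi> t) \<le> V \<psi> t * (q - \<eta> * \<psi>' t)" for t
  proof -
    have "exp (\<eta> / q * (- \<nu> * \<psi> t)) \<le> 1 - \<eta> / q * (1 - exp (- \<nu> * \<psi> t))"
      by (rule exp_convex_combination) (use \<eta> q \<open>\<eta> \<le> q\<close> in auto)
    then have "q * exp (\<eta> / q * (- \<nu> * \<psi> t)) \<le> q * (1 - \<eta> / q * \<psi>' t)"
      unfolding e\<psi> using q by (intro mult_left_mono) auto
    moreover have "q * (1 - \<eta> / q * \<psi>' t) = q - \<eta> * \<psi>' t" using q by (simp add: algebra_simps)
    ultimately have "V \<psi> t * (q * exp (- (\<nu> * \<eta> / q) * \<psi> t)) \<le> V \<psi> t * (q - \<eta> * \<psi>' t)"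
      by (intro mult_left_mono) (auto simp: V_def ac_simps)
    then show ?thesis unfolding gU by (simp add: ac_simps)
  qed
  have lim_exp: "((\<lambda>t. exp (- c * t)) \<longlongrightarrow> 0) at_top" if "c > 0" for c :: real
    using that by real_asymp
  have gapU: "((\<lambda>t. U \<psi> t - U \<phi> t) \<longlongrightarrow> 0) at_top"
  proof (rule Lim_null_comparison[OF _ lim_exp[of 1]])
    have "norm (U \<psi> t - U \<phi> t) \<le> exp (- 1 * t)" for t
    proof -
      have "U \<phi> t \<le> U \<psi> t" "U \<psi> t \<le> exp (- 1 * t)" "U \<phi> t > 0"
        using \<psi>\<phi>[of t] by (auto simp: U_def)
      then show ?thesis by simp
    qed
    then show "\<forall>\<^sub>F t in at_top. norm (U \<psi> t - U \<phi> t) \<le> exp (- 1 * t)" by simp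
  qed simp
  have gapV: "((\<lambda>t. V \<psi> t - V \<phi> t) \<longlongrightarrow> 0) at_top"
  proof (rule Lim_null_comparison[OF _ lim_exp[OF q]])
    have "norm (V \<psi> t - V \<phi> t) \<le> exp (- q * t)" for t
    proof -
      have "V \<phi> t \<le> V \<psi> t" "V \<psi> t \<le> exp (- q * t)" "V \<phi> t > 0"
        using \<psi>\<phi>[of t] \<eta> by (auto simp: V_def)
      then show ?thesis by simp
    qed
    then show "\<forall>\<^sub>F t in at_top. norm (V \<psi> t - V \<phi> t) \<le> exp (- q * t)" by simp
  qed
  have U_pos: "U \<omega> t > 0" and V_pos: "V \<omega> t > 0" for \<omega> t by (simp_all add: U_def V_def)
  have bU: "barrier UNIV f (U \<phi>) (U \<psi>) (\<lambda>t. U \<phi> t * (1 - \<phi>' t)) (\<lambda>t. U \<psi> t * (1 - \<psi>' t)) (V \<phi>) (V \<psi>)"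
  proof (rule power_barrier[where h = "\<lambda>t. exp ((q * m - 1) * t)" and k = m and \<delta> = "1"])
    show "V \<phi> t \<le> V \<psi> t" for t using \<psi>\<phi>[of t] \<eta> by (simp add: V_def)
    show "continuous_on UNIV (\<lambda>t. U \<phi> t * (1 - \<phi>' t))" "continuous_on UNIV (\<lambda>t. U \<psi> t * (1 - \<psi>' t))"
      unfolding U_def by (intro continuous_intros cont)+
    show "(U \<phi> has_real_derivative - (U \<phi> t * (1 - \<phi>' t))) (at t)" for t by (rule U_deriv[OF d\<phi>])
    show "(U \<psi> has_real_derivative - (U \<psi> t * (1 - \<psi>' t))) (at t)" for t by (rule U_deriv[OF d\<psi>])
  qed (use gapU subU superU V_pos m q in \<open>auto simp: f_def intro!: continuous_intros\<close>)
  have bV: "barrier UNIV g (V \<phi>) (V \<psi>) (\<lambda>t. V \<phi> t * (q - \<eta> * \<phi>' t)) (\<lambda>t. V \<psi> t * (q - \<eta> * \<psi>' t)) (U \<phi>) (U \<psi>)"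
  proof (rule power_barrier[where h = "\<lambda>t. q" and k = q and \<delta> = "1"])
    show "U \<phi> t \<le> U \<psi> t" for t using \<psi>\<phi>[of t] by (simp add: U_def)
    show "continuous_on UNIV (\<lambda>t. V \<phi> t * (q - \<eta> * \<phi>' t))" "continuous_on UNIV (\<lambda>t. V \<psi> t * (q - \<eta> * \<psi>' t))"
      unfolding V_def by (intro continuous_intros cont)+
    show "(V \<phi> has_real_derivative - (V \<phi> t * (q - \<eta> * \<phi>' t))) (at t)" for t by (rule V_deriv[OF d\<phi>])
    show "(V \<psi> has_real_derivative - (V \<psi> t * (q - \<eta> * \<psi>' t))) (at t)" for t by (rule V_deriv[OF d\<psi>])
  qed (use gapV subV superV U_pos m q in \<open>auto simp: g_def intro!: continuous_intros\<close>)
  obtain X Y where XY: "\<And>t. (X has_real_derivative - f t (Y t)) (at t)"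
    "\<And>t. (Y has_real_derivative - g t (X t)) (at t)"
    "\<And>t. U \<phi> t \<le> X t \<and> X t \<le> U \<psi> t" "\<And>t. V \<phi> t \<le> Y t \<and> Y t \<le> V \<psi> t"
    using solution_between_barriers[OF bU bV] by (metis UNIV_I)
  have dm: "((\<lambda>t. - t) has_real_derivative - 1) (at t)" for t :: real
    by (auto intro!: derivative_eq_intros)
  define u v where "u t = X (- t)" and "v t = Y (- t)" for t
  have du: "(u has_real_derivative exp (- (q * m - 1) * t) * v t powr m) (at t)" for t
  proof -
    have "(q * m - 1) * - t = - (q * m - 1) * t" by (simp add: algebra_simps)
    then show ?thesis
      using DERIV_chain2[OF XY(1) dm, of t] unfolding u_def[abs_def] v_def f_def by simp
  qed
  have dv: "(v has_real_derivative q * u t powr q) (at t)" for t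
    using DERIV_chain2[OF XY(2) dm, of t] unfolding u_def v_def[abs_def] by (simp add: g_def)
  have up: "0 < u t" "u t < exp t" "0 < v t" for t
  proof -
    have "U \<psi> (- t) < exp t" using \<psi>\<phi>[of "- t"] by (simp add: U_def)
    then show "0 < u t" "u t < exp t" "0 < v t"
      using XY(3)[of "- t"] XY(4)[of "- t"] U_pos[of \<phi> "- t"] V_pos[of \<phi> "- t"]
      by (auto simp: u_def v_def)
  qed
  have lim_bot: "((\<lambda>t. u t / exp t) \<longlongrightarrow> 1) at_bot"
  proof (rule tendsto_sandwich)
    show "\<forall>\<^sub>F t in at_bot. exp (- exp (\<nu> * t)) \<le> u t / exp t"
    proof (intro always_eventually allI)
      fix t
      have "exp (t - exp (\<nu> * t)) \<le> u t" using XY(3)[of "- t"] by (simp add: u_def U_def \<phi>_def s_def)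
      then show "exp (- exp (\<nu> * t)) \<le> u t / exp t" by (simp add: exp_diff exp_minus field_simps)
    qed
    show "\<forall>\<^sub>F t in at_bot. u t / exp t \<le> 1"
      using up by (auto intro!: always_eventually simp: less_imp_le)
    show "((\<lambda>t. exp (- exp (\<nu> * t))) \<longlongrightarrow> 1) at_bot" using \<nu> by real_asymp
  qed simp
  have u_bound: "u t \<le> exp (- ln \<nu> / \<nu>)" for t
  proof -
    have "ln (\<nu> * s (- t)) \<le> ln (1 + \<nu> * s (- t))"
      using \<nu> s[of "- t"] pos[of "- t"] by (intro ln_mono) auto
    moreover have "ln (\<nu> * s (- t)) = ln \<nu> + \<nu> * t" using \<nu> by (simp add: s_def ln_mult)
    ultimately have "(ln \<nu> + \<nu> * t) / \<nu> \<le> \<psi> (- t)" using \<nu> by (simp add: \<psi>_def divide_right_mono)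
    then have "t - \<psi> (- t) \<le> - ln \<nu> / \<nu>" using \<nu> by (simp add: field_simps)
    then have "U \<psi> (- t) \<le> exp (- ln \<nu> / \<nu>)" by (simp add: U_def)
    then show ?thesis using XY(3)[of "- t"] by (simp add: u_def)
  qed
  have u_mono: "u s \<le> u t" if "s \<le> t" for s t
    by (rule DERIV_nonneg_imp_nondecreasing[OF that])
       (use du in \<open>meson exp_ge_zero mult_nonneg_nonneg powr_ge_zero\<close>)
  define C where "C = (SUP t. u t)"
  have bdd: "bdd_above (range u)" using u_bound by (auto intro!: bdd_aboveI2)
  have uC: "u t \<le> C" for t unfolding C_def by (rule cSUP_upper[OF _ bdd]) simp
  have lim_top: "(u \<longlongrightarrow> C) at_top"
  proof (rule order_tendstoI)
    fix a assume "a < C"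
    then obtain t where "a < u t" unfolding C_def by (meson less_cSUP_iff[OF _ bdd] UNIV_not_empty)
    then show "\<forall>\<^sub>F x in at_top. a < u x"
      using u_mono by (intro eventually_mono[OF eventually_ge_at_top[of t]]) (auto intro: less_le_trans)
  next
    fix a assume "C < a"
    then show "\<forall>\<^sub>F x in at_top. u x < a"
      by (intro always_eventually allI le_less_trans[OF uC])
  qed
  have "C > 0" using uC[of 0] up(1)[of 0] by linarith
  then have "\<exists>C>0. (u \<longlongrightarrow> C) at_top" using lim_top by blast
  moreover have "0 < u t \<and> u t < exp t" for t using up by simp
  ultimately show thesis by (intro that[OF du dv _ up(3) lim_bot])
qed

text \<open>The branch of the stable manifold with \<open>u > exp t\<close>. The negative eigenvalue \<open>- \<mu>\<close> has the eigenvector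
\<open>(1, - \<eta>)\<close>: its entries have opposite signs, which is why the monotone pair is \<open>(u, - v)\<close>. The curves
\<open>(U \<phi>, V \<phi>)\<close> have the logarithmic coordinates \<open>\<phi>\<close> and \<open>- \<eta> \<phi>\<close>. With \<open>s = exp (- \<mu> t)\<close>, the function
\<open>\<phi> = ln (1 + \<mu> s) / \<mu>\<close> solves the first equation and is a subsolution of the second one, whereas
\<open>\<psi> = - ln (1 - \<kappa> s) / \<kappa>\<close> solves the second one and is a supersolution of the first. The barriers are unbounded,
but their gaps are bounded by multiples of \<open>exp t * s\<close> and \<open>exp (q t) * s\<close>, which tend to \<open>0\<close> because \<open>\<mu>\<close>
exceeds \<open>1\<close> and \<open>q\<close>.\<close>

lemma stable_orbit:
  fixes m q :: real
  assumes m: "m > 0" and q: "q > 0" and qm: "q * m > 1"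
  obtains T u v where
    "\<And>t. T < t \<Longrightarrow> (u has_real_derivative exp (- (q * m - 1) * t) * v t powr m) (at t)"
    "\<And>t. T < t \<Longrightarrow> (v has_real_derivative q * u t powr q) (at t)"
    "\<And>t. T < t \<Longrightarrow> exp t < u t" "\<And>t. T < t \<Longrightarrow> 0 < v t"
    "((\<lambda>t. u t / exp t) \<longlongrightarrow> 1) at_top"
proof -
  obtain \<nu> where \<nu>: "\<nu> > 0" "(\<nu> + 1) * (\<nu> + q) = q\<^sup>2 * m"
    by (rule saddle_eigenvalue[OF q qm])
  define \<mu> \<eta> \<kappa> where "\<mu> = \<nu> + 1 + q" and "\<eta> = (\<nu> + q) / m" and "\<kappa> = (\<nu> + 1 + q) * ((\<nu> + q) / m) / q"
  have \<mu>: "\<mu> > 1" "\<mu> > q" "\<mu> > 0" using \<nu> q by (auto simp: \<mu>_def)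
  have \<eta>: "\<eta> > 0" "m * \<eta> + 1 = \<mu>" using \<nu> m q by (auto simp: \<eta>_def \<mu>_def)
  have \<kappa>: "\<kappa> > 0" "\<kappa> = \<mu> * \<eta> / q" using \<nu> m q by (auto simp: \<eta>_def \<mu>_def \<kappa>_def)
  have "\<eta> * (\<nu> + 1) = q\<^sup>2" using \<nu>(2) m by (simp add: \<eta>_def ac_simps)
  then have q\<eta>: "q + \<eta> = \<kappa>" using q by (simp add: \<kappa>(2) \<mu>_def field_simps power2_eq_square)
  \<comment> \<open>At this time \<open>\<kappa> s = 1\<close>; the upper barrier exists only to the right of it.\<close>
  define T where "T = ln \<kappa> / \<mu>"
  define f g where "f t y = - (exp (- (q * m - 1) * t) * (- y) powr m)" and "g t x = q * x powr q"
    for t x y :: real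
  define U V where "U \<phi> t = exp (t + \<phi> t)" and "V \<phi> t = - exp (q * t - \<eta> * \<phi> t)"
    for \<phi> :: "real \<Rightarrow> real" and t
  have fV: "f t (V \<phi> t) = - (U \<phi> t * exp (- \<mu> * \<phi> t))" for \<phi> t
  proof -
    have "(- V \<phi> t) powr m = exp (m * (q * t - \<eta> * \<phi> t))" by (simp add: V_def powr_def)
    also have "m * (q * t - \<eta> * \<phi> t) = (q * m) * t - (m * \<eta>) * \<phi> t" by (simp add: algebra_simps)
    finally show ?thesis unfolding f_def U_def \<eta>(2)[symmetric] by (simp add: algebra_simps flip: exp_add)
  qed
  have gU: "g t (U \<phi> t) = q * (- V \<phi> t) * exp (\<kappa> * \<phi> t)" for \<phi> t
  proof -
    have "U \<phi> t powr q = exp (q * (t + \<phi> t))" by (simp add: U_def powr_def)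
    also have "q * (t + \<phi> t) = (q * t - \<eta> * \<phi> t) + (q + \<eta>) * \<phi> t" by (simp add: algebra_simps)
    finally have "U \<phi> t powr q = (- V \<phi> t) * exp ((q + \<eta>) * \<phi> t)"
      by (simp only: V_def exp_add minus_minus)
    then show ?thesis unfolding g_def q\<eta> by (simp only: mult.assoc)
  qed
  have U_deriv: "(U \<phi> has_real_derivative - (U \<phi> t * (\<phi>' t - 1))) (at t)"
    and V_deriv: "(V \<phi> has_real_derivative - ((- V \<phi> t) * (q + \<eta> * \<phi>' t))) (at t)"
    if "(\<phi> has_real_derivative - \<phi>' t) (at t)" for \<phi> \<phi>' t
    unfolding U_def[abs_def] V_def[abs_def]
    by (auto intro!: derivative_eq_intros that simp: algebra_simps)
  define s where "s t = exp (- \<mu> * t)" for t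
  have s: "s t > 0" "(s has_real_derivative - \<mu> * s t) (at t)" for t
    unfolding s_def[abs_def] by (auto intro!: derivative_eq_intros)
  define \<phi> \<phi>' where "\<phi> t = ln (1 + \<mu> * s t) / \<mu>" and "\<phi>' t = \<mu> * s t / (1 + \<mu> * s t)" for t
  define \<psi> \<psi>' where "\<psi> t = - (ln (1 - \<kappa> * s t) / \<kappa>)" and "\<psi>' t = \<mu> * s t / (1 - \<kappa> * s t)" for t
  have pos: "1 + \<mu> * s t > 0" for t using mult_pos_pos[OF \<mu>(3) s(1)[of t]] by linarith
  have pos': "1 - \<kappa> * s t > 0" if "T < t" for t
  proof -
    have "ln \<kappa> < \<mu> * t" using that \<mu> by (simp add: T_def field_simps)
    then have "\<kappa> < exp (\<mu> * t)" using \<kappa> by (metis exp_less_mono exp_ln)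
    then show ?thesis by (simp add: s_def exp_minus field_simps)
  qed
  have d\<phi>: "(\<phi> has_real_derivative - \<phi>' t) (at t)" for t
    unfolding \<phi>_def[abs_def] \<phi>'_def
    by (rule ln_affine_has_derivative[OF s(2) _ pos]) (use \<mu> in simp)
  have d\<psi>: "(\<psi> has_real_derivative - \<psi>' t) (at t)" if "T < t" for t
    unfolding \<psi>_def[abs_def] \<psi>'_def
    using ln_affine_has_derivative[OF s(2), where c = "- \<kappa>", of t] pos'[OF that] \<kappa>(1) by simp
  have c_s: "continuous_on {T<..} s" unfolding s_def[abs_def] by (intro continuous_intros)
  have cont: "continuous_on {T<..} \<phi>" "continuous_on {T<..} \<psi>" "continuous_on {T<..} \<phi>'" "continuous_on {T<..} \<psi>'"
    unfolding \<phi>_def[abs_def] \<psi>_def[abs_def] \<phi>'_def[abs_def] \<psi>'_def[abs_def]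
    using \<mu>(3) \<kappa>(1) pos pos' by (auto intro!: continuous_intros c_s simp: less_imp_neq[symmetric])
  have \<phi>\<psi>: "0 < \<phi> t" "\<phi> t \<le> s t" "\<phi>' t \<le> \<mu> * \<phi> t" for t
  proof -
    have ms: "\<mu> * s t > 0" using \<mu> s by simp
    then show "0 < \<phi> t" using \<mu> by (simp add: \<phi>_def)
    have "ln (1 + \<mu> * s t) \<le> \<mu> * s t" using ms by (intro ln_add_one_self_le_self) auto
    then show "\<phi> t \<le> s t" using \<mu> by (simp add: \<phi>_def field_simps)
    show "\<phi>' t \<le> \<mu> * \<phi> t" using ln_one_plus_ge[of "\<mu> * s t"] ms \<mu> by (simp add: \<phi>_def \<phi>'_def)
  qed
  have \<psi>b: "s t \<le> \<psi> t" "\<mu> * \<psi> t \<le> \<psi>' t" "\<psi> t \<le> s t / (1 - \<kappa> * s t)" if "T < t" for t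
  proof -
    have "ln (1 - \<kappa> * s t) \<le> (1 - \<kappa> * s t) - 1" using pos'[OF that] by (rule ln_le_minus_one)
    then show "s t \<le> \<psi> t" using \<kappa>(1) by (simp add: \<psi>_def field_simps)
    have "ln (1 / (1 - \<kappa> * s t)) \<le> 1 / (1 - \<kappa> * s t) - 1"
      using pos'[OF that] by (intro ln_le_minus_one) auto
    moreover have "1 / (1 - \<kappa> * s t) - 1 = \<kappa> * (s t / (1 - \<kappa> * s t))"
      using pos'[OF that] by (simp add: field_simps)
    ultimately have "- ln (1 - \<kappa> * s t) \<le> \<kappa> * (s t / (1 - \<kappa> * s t))"
      using pos'[OF that] by (simp add: ln_div)
    then have "\<kappa> * \<psi> t \<le> \<kappa> * (s t / (1 - \<kappa> * s t))"
      using \<kappa>(1) by (simp add: \<psi>_def)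
    then show 1: "\<psi> t \<le> s t / (1 - \<kappa> * s t)"
      using \<kappa>(1) by (simp only: mult_le_cancel_left_pos)
    show "\<mu> * \<psi> t \<le> \<psi>' t"
      using mult_left_mono[OF 1, of \<mu>] \<mu> by (simp add: \<psi>'_def)
  qed
  have order: "\<phi> t \<le> \<psi> t" if "T < t" for t using \<phi>\<psi>(2)[of t] \<psi>b(1)[OF that] by linarith
  have U_pos: "U \<omega> t > 0" and V_neg: "V \<omega> t < 0" for \<omega> t by (simp_all add: U_def V_def)
  have e\<phi>: "exp (- \<mu> * \<phi> t) = 1 - \<phi>' t" for t
    using \<mu> pos[of t] by (simp add: \<phi>_def \<phi>'_def exp_minus field_simps)
  have e\<psi>: "q * exp (\<kappa> * \<psi> t) = q + \<eta> * \<psi>' t" if "T < t" for t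
  proof -
    have "exp (\<kappa> * \<psi> t) = 1 / (1 - \<kappa> * s t)"
      using \<kappa>(1) pos'[OF that] by (simp add: \<psi>_def exp_minus field_simps)
    moreover have "q * (1 / (1 - \<kappa> * s t)) = q + (q * \<kappa>) * s t / (1 - \<kappa> * s t)"
      using pos'[OF that] by (simp add: field_simps)
    moreover have "q * \<kappa> = \<eta> * \<mu>" using \<kappa>(2) q by simp
    ultimately show ?thesis by (simp add: \<psi>'_def)
  qed
  have subU: "U \<phi> t * (\<phi>' t - 1) \<le> f t (V \<phi> t)" for t
    unfolding fV e\<phi> by (simp add: algebra_simps)
  have superU: "f t (V \<psi> t) \<le> U \<psi> t * (\<psi>' t - 1)" if "T < t" for t
  proof -
    have "1 - \<psi>' t \<le> exp (- \<mu> * \<psi> t)"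
      using exp_ge_add_one_self[of "- \<mu> * \<psi> t"] \<psi>b(2)[OF that] by simp
    then have "U \<psi> t * (1 - \<psi>' t) \<le> U \<psi> t * exp (- \<mu> * \<psi> t)"
      using U_pos[of \<psi> t] by (intro mult_left_mono) auto
    then show ?thesis unfolding fV by (simp add: algebra_simps)
  qed
  have subV: "(- V \<phi> t) * (q + \<eta> * \<phi>' t) \<le> g t (U \<phi> t)" for t
  proof -
    have "\<eta> * \<phi>' t \<le> \<eta> * (\<mu> * \<phi> t)" using \<phi>\<psi>(3) \<eta> by (intro mult_left_mono) auto
    also have "\<dots> = q * (\<kappa> * \<phi> t)" using \<kappa>(2) q by simp
    also have "q + q * (\<kappa> * \<phi> t) \<le> q * exp (\<kappa> * \<phi> t)"
      using mult_left_mono[OF exp_ge_add_one_self[of "\<kappa> * \<phi> t"], of q] q by (simp add: algebra_simps)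
    ultimately have "q + \<eta> * \<phi>' t \<le> q * exp (\<kappa> * \<phi> t)" by linarith
    then have "(- V \<phi> t) * (q + \<eta> * \<phi>' t) \<le> (- V \<phi> t) * (q * exp (\<kappa> * \<phi> t))"
      using V_neg[of \<phi> t] by (intro mult_left_mono) auto
    then show ?thesis unfolding gU by (simp add: ac_simps)
  qed
  have superV: "g t (U \<psi> t) \<le> (- V \<psi> t) * (q + \<eta> * \<psi>' t)" if "T < t" for t
    unfolding gU e\<psi>[OF that, symmetric] by simp
  have small: "\<forall>\<^sub>F t in at_top. T < t \<and> \<psi> t \<le> 2 * s t \<and> 2 * s t \<le> 1"
  proof -
    have "(s \<longlongrightarrow> 0) at_top" unfolding s_def[abs_def] using \<mu>(3) by real_asymp
    moreover have "0 < min (1 / 2) (1 / (2 * \<kappa>))" using \<kappa>(1) by simp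
    ultimately have "\<forall>\<^sub>F t in at_top. s t < min (1 / 2) (1 / (2 * \<kappa>))" by (rule order_tendstoD(2))
    then show ?thesis using eventually_gt_at_top[of T]
    proof eventually_elim
      case (elim t)
      then have "1 - \<kappa> * s t \<ge> 1 / 2" using \<kappa>(1) by (simp add: field_simps)
      then have "s t / (1 - \<kappa> * s t) \<le> s t / (1 / 2)" using s(1)[of t] by (intro divide_left_mono) auto
      then show ?case using elim \<psi>b(3)[of t] by simp
    qed
  qed
  have U_close: "\<forall>\<^sub>F t in at_top. U \<psi> t - exp t \<le> 4 * exp ((1 - \<mu>) * t)"
    using small
  proof eventually_elim
    case (elim t)
    have "\<psi> t \<ge> 0" using \<psi>b(1)[of t] s(1)[of t] elim by linarith
    then have "exp (\<psi> t) \<le> 1 + \<psi> t + (\<psi> t)\<^sup>2" using elim by (intro exp_bound) auto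
    also have "(\<psi> t)\<^sup>2 \<le> \<psi> t" using \<open>\<psi> t \<ge> 0\<close> elim by (intro power_le_one_iff[THEN iffD1] | simp add: power2_eq_square mult_left_le)+
    finally have "exp (\<psi> t) - 1 \<le> 4 * s t" using elim by linarith
    then have "exp t * (exp (\<psi> t) - 1) \<le> exp t * (4 * s t)" by (rule mult_left_mono) simp
    moreover have "exp t * (exp (\<psi> t) - 1) = U \<psi> t - exp t"
      by (simp add: U_def exp_add right_diff_distrib)
    moreover have "exp t * (4 * s t) = 4 * exp ((1 - \<mu>) * t)"
      by (simp add: s_def algebra_simps flip: exp_add)
    ultimately show ?case by simp
  qed
  have gapU: "((\<lambda>t. U \<psi> t - U \<phi> t) \<longlongrightarrow> 0) at_top"
  proof (rule Lim_null_comparison)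
    show "\<forall>\<^sub>F t in at_top. norm (U \<psi> t - U \<phi> t) \<le> 4 * exp ((1 - \<mu>) * t)"
      using U_close eventually_gt_at_top[of T]
    proof eventually_elim
      case (elim t)
      have "exp t \<le> U \<phi> t" "U \<phi> t \<le> U \<psi> t" using \<phi>\<psi>(1)[of t] order elim by (auto simp: U_def)
      then show ?case using elim by simp
    qed
    show "((\<lambda>t. 4 * exp ((1 - \<mu>) * t)) \<longlongrightarrow> 0) at_top" using \<mu> by real_asymp
  qed
  have gapV: "((\<lambda>t. V \<psi> t - V \<phi> t) \<longlongrightarrow> 0) at_top"
  proof (rule Lim_null_comparison)
    show "\<forall>\<^sub>F t in at_top. norm (V \<psi> t - V \<phi> t) \<le> 2 * \<eta> * exp ((q - \<mu>) * t)"
      using small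
    proof eventually_elim
      case (elim t)
      have "V \<phi> t \<le> V \<psi> t" using order elim \<eta> by (simp add: V_def)
      moreover have "- V \<phi> t \<le> exp (q * t)" using \<phi>\<psi>(1)[of t] \<eta> by (simp add: V_def)
      moreover have "- V \<psi> t = exp (q * t) * exp (- \<eta> * \<psi> t)"
        by (simp add: V_def flip: exp_add)
      moreover have "exp (q * t) * (1 - 2 * \<eta> * s t) \<le> exp (q * t) * exp (- \<eta> * \<psi> t)"
      proof (rule mult_left_mono)
        have "\<eta> * \<psi> t \<le> \<eta> * (2 * s t)" using elim \<eta> by (intro mult_left_mono) auto
        then show "1 - 2 * \<eta> * s t \<le> exp (- \<eta> * \<psi> t)"
          using exp_ge_add_one_self[of "- \<eta> * \<psi> t"] by simp
      qed simp
      moreover have "exp (q * t) * (1 - 2 * \<eta> * s t) = exp (q * t) - 2 * \<eta> * exp ((q - \<mu>) * t)"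
        by (simp add: s_def algebra_simps flip: exp_add)
      ultimately show ?case by simp
    qed
    show "((\<lambda>t. 2 * \<eta> * exp ((q - \<mu>) * t)) \<longlongrightarrow> 0) at_top" using \<mu> by real_asymp
  qed
  have bU: "barrier {T<..} f (U \<phi>) (U \<psi>) (\<lambda>t. U \<phi> t * (\<phi>' t - 1)) (\<lambda>t. U \<psi> t * (\<psi>' t - 1)) (V \<phi>) (V \<psi>)"
  proof (rule power_barrier[where h = "\<lambda>t. exp (- (q * m - 1) * t)" and k = m and \<delta> = "-1"])
    show "V \<phi> t \<le> V \<psi> t" if "t \<in> {T<..}" for t using order that \<eta> by (simp add: V_def)
    show "continuous_on {T<..} (\<lambda>t. U \<phi> t * (\<phi>' t - 1))" "continuous_on {T<..} (\<lambda>t. U \<psi> t * (\<psi>' t - 1))"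
      unfolding U_def by (intro continuous_intros cont)+
    show "(U \<phi> has_real_derivative - (U \<phi> t * (\<phi>' t - 1))) (at t)" for t by (rule U_deriv[OF d\<phi>])
    show "(U \<psi> has_real_derivative - (U \<psi> t * (\<psi>' t - 1))) (at t)" if "t \<in> {T<..}" for t
      by (rule U_deriv[OF d\<psi>]) (use that in simp)
  qed (use gapU subU superU V_neg m q in \<open>auto simp: f_def intro!: continuous_intros\<close>)
  have bV: "barrier {T<..} g (V \<phi>) (V \<psi>) (\<lambda>t. (- V \<phi> t) * (q + \<eta> * \<phi>' t))
      (\<lambda>t. (- V \<psi> t) * (q + \<eta> * \<psi>' t)) (U \<phi>) (U \<psi>)"
  proof (rule power_barrier[where h = "\<lambda>t. q" and k = q and \<delta> = "1"])
    show "U \<phi> t \<le> U \<psi> t" if "t \<in> {T<..}" for t using order that by (simp add: U_def)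
    show "continuous_on {T<..} (\<lambda>t. (- V \<phi> t) * (q + \<eta> * \<phi>' t))"
      "continuous_on {T<..} (\<lambda>t. (- V \<psi> t) * (q + \<eta> * \<psi>' t))"
      unfolding V_def by (intro continuous_intros cont)+
    show "(V \<phi> has_real_derivative - ((- V \<phi> t) * (q + \<eta> * \<phi>' t))) (at t)" for t
      by (rule V_deriv[OF d\<phi>])
    show "(V \<psi> has_real_derivative - ((- V \<psi> t) * (q + \<eta> * \<psi>' t))) (at t)" if "t \<in> {T<..}" for t
      by (rule V_deriv[OF d\<psi>]) (use that in simp)
  qed (use gapV subV superV U_pos m q in \<open>auto simp: g_def intro!: continuous_intros\<close>)
  obtain X Y where XY: "\<And>t. T < t \<Longrightarrow> (X has_real_derivative - f t (Y t)) (at t)"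
    "\<And>t. T < t \<Longrightarrow> (Y has_real_derivative - g t (X t)) (at t)"
    "\<And>t. T < t \<Longrightarrow> U \<phi> t \<le> X t \<and> X t \<le> U \<psi> t" "\<And>t. T < t \<Longrightarrow> V \<phi> t \<le> Y t \<and> Y t \<le> V \<psi> t"
    using solution_between_barriers[OF bU bV] by (metis greaterThan_iff)
  have X: "exp t < X t" if "T < t" for t
  proof -
    have "exp t < U \<phi> t" using \<phi>\<psi>(1)[of t] by (simp add: U_def)
    then show ?thesis using XY(3)[OF that] by linarith
  qed
  show thesis
  proof (rule that[of T X "\<lambda>t. - Y t"])
    fix t assume t: "T < t"
    show "(X has_real_derivative exp (- (q * m - 1) * t) * (- Y t) powr m) (at t)"
      using XY(1)[OF t] by (simp add: f_def)
    show "((\<lambda>t. - Y t) has_real_derivative q * X t powr q) (at t)"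
      using DERIV_minus[OF XY(2)[OF t]] by (simp add: g_def)
    show "exp t < X t" by (rule X[OF t])
    show "0 < - Y t" using XY(4)[OF t] V_neg[of \<psi> t] by linarith
  next
    show "((\<lambda>t. X t / exp t) \<longlongrightarrow> 1) at_top"
    proof (rule tendsto_sandwich)
      show "\<forall>\<^sub>F t in at_top. 1 \<le> X t / exp t"
        using X by (auto intro!: eventually_mono[OF eventually_gt_at_top[of T]] simp: less_imp_le)
      show "\<forall>\<^sub>F t in at_top. X t / exp t \<le> 1 + 4 * exp (- \<mu> * t)"
        using U_close eventually_gt_at_top[of T]
      proof eventually_elim
        case (elim t)
        have "X t \<le> exp t + 4 * exp ((1 - \<mu>) * t)" using XY(3)[of t] elim by linarith
        also have "\<dots> = exp t * (1 + 4 * exp (- \<mu> * t))" by (simp add: algebra_simps flip: exp_add)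
        finally show ?case by (simp add: pos_divide_le_eq mult.commute)
      qed
      show "((\<lambda>t. 1 + 4 * exp (- \<mu> * t)) \<longlongrightarrow> 1) at_top" using \<mu>(3) by real_asymp
    qed simp
  qed
qed

section \<open>Solutions near infinity for N > p\<close>

lemma limit_at_top_compose_ln:
  assumes "((f :: real \<Rightarrow> real) \<longlongrightarrow> l) at_top"
  shows "((\<lambda>r. f (ln r)) \<longlongrightarrow> l) at_top"
  by (rule filterlim_compose[OF assms ln_at_top])

text \<open>Linear growth of the flux in \<open>t = ln r\<close> is compensated by the power of \<open>ln r\<close>.\<close>

lemma slope_limit:
  fixes p a L :: real
  assumes p: "p > 1"
    and slope: "\<forall>\<^sub>F r in at_top. slope N p w r = a * G (ln r) powr (1 / (p - 1))"
    and G: "((\<lambda>t. G t / t) \<longlongrightarrow> L) at_top" and L: "L > 0"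
  shows "(log_slope N p w \<longlongrightarrow> a * L powr (1 / (p - 1))) at_top"
proof -
  have "((\<lambda>r. a * (G (ln r) / ln r) powr (1 / (p - 1))) \<longlongrightarrow> a * L powr (1 / (p - 1))) at_top"
    by (rule limit_at_top_compose_ln[where f = "\<lambda>t. a * (G t / t) powr (1 / (p - 1))"])
       (intro tendsto_intros G, use L in auto)
  moreover have "\<forall>\<^sub>F t in at_top. 0 < G t"
  proof -
    have "\<forall>\<^sub>F t in at_top. G t / t > 0" by (rule order_tendstoD(1)[OF G L])
    then show ?thesis using eventually_gt_at_top[of 0]
      by eventually_elim (simp add: zero_less_divide_iff)
  qed
  then have "\<forall>\<^sub>F r in at_top. 0 < G (ln r)"
    using ln_at_top by (auto simp: filterlim_iff)
  with slope eventually_gt_at_top[of 1]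
  have "\<forall>\<^sub>F r in at_top. a * (G (ln r) / ln r) powr (1 / (p - 1))
      = log_slope N p w r"
  proof eventually_elim
    case (elim r)
    have "(G (ln r) / ln r) powr (1 / (p - 1)) = G (ln r) powr (1 / (p - 1)) * ln r powr (- (1 / (p - 1)))"
      using elim by (simp add: powr_divide powr_minus_divide)
    then have "a * (G (ln r) / ln r) powr (1 / (p - 1))
        = ln r powr (- (1 / (p - 1))) * (a * G (ln r) powr (1 / (p - 1)))" by simp
    also have "\<dots> = ln r powr (- (1 / (p - 1))) * (slope N p w r)"
      unfolding elim(1) ..
    finally show ?case by (simp only: ac_simps)
  qed
  ultimately show ?thesis by (rule Lim_transform_eventually)
qed

lemma exp_less_iff_ln: "exp T < r \<longleftrightarrow> 0 < r \<and> T < ln r" for r T :: real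
  by (metis exp_gt_zero exp_less_cancel_iff exp_ln order_less_trans)

lemma log_solution_on_ray:
  fixes N p q \<epsilon> a :: real
  defines "m \<equiv> 1 / (p - 1)" and "\<beta> \<equiv> (N - p) / (p - 1)"
  assumes "p > 1" and "a = 1 \<or> a = -1"
    and "\<And>t. T < t \<Longrightarrow> 0 < w t \<and> 0 < G t"
    and "\<And>t. T < t \<Longrightarrow> (w has_real_derivative - a * exp (- \<beta> * t) * G t powr m) (at t)"
    and "\<And>t. T < t \<Longrightarrow> (G has_real_derivative a * \<epsilon> * w t powr q) (at t)"
  shows "solution_on N p q \<epsilon> {exp T<..} (\<lambda>r. w (ln r))"
    and "\<And>r. exp T < r \<Longrightarrow>
      r powr ((N - 1) / (p - 1)) * deriv (\<lambda>r. w (ln r)) r = - a * G (ln r) powr m"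
proof -
  have ray: "{exp T<..} = {r. 0 < r \<and> ln r \<in> {T<..}}" by (auto simp: exp_less_iff_ln)
  note sol = log_solution[of p a "{T<..}" w G N \<epsilon> q, folded \<beta>_def m_def]
  show "solution_on N p q \<epsilon> {exp T<..} (\<lambda>r. w (ln r))"
    unfolding ray by (rule sol(1)) (use assms in auto)
  show "r powr ((N - 1) / (p - 1)) * deriv (\<lambda>r. w (ln r)) r = - a * G (ln r) powr m"
    if "exp T < r" for r
    by (rule sol(2)) (use assms that in \<open>auto simp: exp_less_iff_ln\<close>)
qed

text \<open>Needed because the formulas for the explicit solution agree for positive radii only.\<close>

lemma positive_solution_on_cong:
  assumes sol: "positive_solution_on N \<sigma> p q \<epsilon> I w" and I: "open I" and eq: "\<And>r. r \<in> I \<Longrightarrow> w r = w' r"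
  shows "positive_solution_on N \<sigma> p q \<epsilon> I w'"
proof -
  have ev: "\<forall>\<^sub>F s in nhds r. w s = w' s" if "r \<in> I" for r
    using eventually_nhds_in_open[OF I that] by eventually_elim (rule eq)
  have d: "deriv w r = deriv w' r" if "r \<in> I" for r
    by (rule deriv_cong_ev[OF ev[OF that] refl])
  have ev': "\<forall>\<^sub>F s in nhds r. p_flux p (deriv w s) = p_flux p (deriv w' s)" if "r \<in> I" for r
    using eventually_nhds_in_open[OF I that] by eventually_elim (simp add: d)
  have dd: "deriv (\<lambda>s. p_flux p (deriv w s)) r = deriv (\<lambda>s. p_flux p (deriv w' s)) r" if "r \<in> I" for r
    by (rule deriv_cong_ev[OF ev'[OF that] refl])
  have diff: "g differentiable (at r)"
    if f: "f differentiable (at r)" and r: "r \<in> I" and fg: "\<And>s. s \<in> I \<Longrightarrow> f s = g s" for f g :: "real \<Rightarrow> real" and r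
  proof -
    obtain D where "(f has_real_derivative D) (at r)"
      using f unfolding real_differentiable_def by blast
    then have "(g has_real_derivative D) (at r)"
      by (rule has_field_derivative_transform_within_open[OF _ I r]) (rule fg)
    then show ?thesis unfolding real_differentiable_def by blast
  qed
  show ?thesis
    unfolding positive_solution_on_def
  proof
    fix r assume r: "r \<in> I"
    have "w differentiable (at r)" "(\<lambda>s. p_flux p (deriv w s)) differentiable (at r)" "w r > 0"
      "- deriv (\<lambda>s. p_flux p (deriv w s)) r - (N - 1) / r * p_flux p (deriv w r)
        = \<epsilon> * r powr \<sigma> * w r powr q"
      using sol r by (auto simp: positive_solution_on_def)
    then show "w' r > 0 \<and> w' differentiable (at r) \<and>
        (\<lambda>s. p_flux p (deriv w' s)) differentiable (at r) \<and>
        - deriv (\<lambda>s. p_flux p (deriv w' s)) r - (N - 1) / r * p_flux p (deriv w' r)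
          = \<epsilon> * r powr \<sigma> * w' r powr q"
      using diff[of w r w'] diff[of "\<lambda>s. p_flux p (deriv w s)" r "\<lambda>s. p_flux p (deriv w' s)"] r
      by (simp add: d dd eq)
  qed
qed

lemma decaying_solution_radial:
  fixes N p q \<epsilon> k :: real
  assumes p: "p > 1" and q: "q > 0" and N: "N > p" and \<epsilon>: "\<epsilon> = 1 \<or> \<epsilon> = -1" and k: "k > 0"
  shows "\<exists>w. \<exists>r0>0. solution_on N p q \<epsilon> {r0<..} w \<and>
    ((\<lambda>r. r powr ((N - p) / (p - 1)) * w r) \<longlongrightarrow> k) at_top \<and>
    (slope N p w \<longlongrightarrow> - ((N - p) / (p - 1) * k)) at_top"
proof -
  define \<beta> m where "\<beta> = (N - p) / (p - 1)" and "m = 1 / (p - 1)"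
  have pos: "\<beta> > 0" "m > 0" using p N by (auto simp: \<beta>_def m_def)
  define d where "d = (\<beta> * k) powr (p - 1)"
  have d: "d > 0" "d powr m = \<beta> * k"
    using pos k p by (auto simp: d_def powr_powr m_def)
  obtain T w G where wG: "\<And>t. T < t \<Longrightarrow> 0 < w t \<and> 0 < G t"
    "\<And>t. T < t \<Longrightarrow> (w has_real_derivative - exp (- \<beta> * t) * G t powr m) (at t)"
    "\<And>t. T < t \<Longrightarrow> (G has_real_derivative \<epsilon> * w t powr q) (at t)"
    "((\<lambda>t. exp (\<beta> * t) * w t) \<longlongrightarrow> d powr m / \<beta>) at_top" "(G \<longlongrightarrow> d) at_top"
    by (rule decaying_solution[OF pos q d(1) \<epsilon>]) blast
  have sol: "solution_on N p q \<epsilon> {exp T<..} (\<lambda>r. w (ln r))"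
    "\<And>r. exp T < r \<Longrightarrow> r powr ((N - 1) / (p - 1)) * deriv (\<lambda>r. w (ln r)) r = - 1 * G (ln r) powr m"
    using log_solution_on_ray[of p 1 T w G N \<epsilon> q, folded \<beta>_def m_def] p wG by simp_all
  show ?thesis
  proof (intro exI conjI)
    show "exp T > 0" by simp
    show "solution_on N p q \<epsilon> {exp T<..} (\<lambda>r. w (ln r))" by (rule sol)
    have "((\<lambda>r. exp (\<beta> * ln r) * w (ln r)) \<longlongrightarrow> d powr m / \<beta>) at_top"
      by (rule limit_at_top_compose_ln[OF wG(4)])
    moreover have "d powr m / \<beta> = k" using d pos by simp
    moreover have "\<forall>\<^sub>F r in at_top. exp (\<beta> * ln r) * w (ln r) = r powr \<beta> * w (ln r)"
      using eventually_gt_at_top[of 0] by eventually_elim (simp add: powr_def)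
    ultimately show "((\<lambda>r. r powr ((N - p) / (p - 1)) * w (ln r)) \<longlongrightarrow> k) at_top"
      unfolding \<beta>_def[symmetric] by (auto intro: Lim_transform_eventually)
    have "((\<lambda>r. - 1 * G (ln r) powr m) \<longlongrightarrow> - 1 * d powr m) at_top"
      by (intro tendsto_intros limit_at_top_compose_ln[OF wG(5)]) (use d in auto)
    moreover have "\<forall>\<^sub>F r in at_top. - 1 * G (ln r) powr m
        = r powr ((N - 1) / (p - 1)) * deriv (\<lambda>r. w (ln r)) r"
      using eventually_gt_at_top[of "exp T"] by eventually_elim (simp add: sol(2))
    ultimately show "((\<lambda>r. r powr ((N - 1) / (p - 1)) * deriv (\<lambda>r. w (ln r)) r)
        \<longlongrightarrow> - ((N - p) / (p - 1) * k)) at_top"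
      unfolding d(2) \<beta>_def[symmetric] by (auto intro: Lim_transform_eventually)
  qed
qed

text \<open>Equal germs have equal derivatives, hence equal fluxes, and the flux determines its additive constant.\<close>

lemma germ_determines_flux_constant:
  fixes \<beta> m \<epsilon> d d' :: real
  assumes m: "m > 0" and \<epsilon>: "\<epsilon> = 1 \<or> \<epsilon> = -1"
    and G: "\<And>t. T < t \<Longrightarrow> 0 < G t" "((\<lambda>t. G t - t) \<longlongrightarrow> d) at_top"
    and G': "\<And>t. T < t \<Longrightarrow> 0 < G' t" "((\<lambda>t. G' t - t) \<longlongrightarrow> d') at_top"
    and V: "\<And>t. T < t \<Longrightarrow> (V has_real_derivative - \<epsilon> * exp (- \<beta> * t) * G t powr m) (at t)"
    and V': "\<And>t. T < t \<Longrightarrow> (V' has_real_derivative - \<epsilon> * exp (- \<beta> * t) * G' t powr m) (at t)"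
    and eq: "\<forall>\<^sub>F t in at_top. V t = V' t"
  shows "d = d'"
proof -
  obtain S where S: "\<And>t. S \<le> t \<Longrightarrow> V t = V' t" using eq by (auto simp: eventually_at_top_linorder)
  have "G t = G' t" if t: "max S T < t" for t
  proof -
    have "(V' has_real_derivative - \<epsilon> * exp (- \<beta> * t) * G t powr m) (at t)"
      by (rule has_field_derivative_transform_within_open[OF V, of _ "{S<..}"]) (use t S in auto)
    from DERIV_unique[OF this V'] have "G t powr m = G' t powr m" using t \<epsilon> by auto
    then have "(G t powr m) powr (1 / m) = (G' t powr m) powr (1 / m)" by simp
    then show ?thesis using m G(1)[of t] G'(1)[of t] t by (simp add: powr_powr)
  qed
  then have "\<forall>\<^sub>F t in at_top. G t - t = G' t - t"
    by (auto intro!: eventually_mono[OF eventually_gt_at_top[of "max S T"]])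
  then have "((\<lambda>t. G' t - t) \<longlongrightarrow> d) at_top"
    using G(2) by (rule Lim_transform_eventually[rotated])
  then show ?thesis using tendsto_unique[OF _ _ G'(2)] by simp
qed

text \<open>If \<open>(w, G)\<close> solves the system in logarithmic time, then so does \<open>(C w(t + \<tau>), C powr q G(t + \<tau>))\<close>, provided that
\<open>C exp (- \<beta> \<tau>) = C powr (q m)\<close>. This transports the family with limit \<open>1\<close> to all limits \<open>C > 0\<close>, with \<open>\<tau>\<close> and
therefore the domain depending continuously on \<open>C\<close>. The limit recovers \<open>C\<close> from the germ, and the flux recovers \<open>d\<close>.\<close>

lemma constant_limit_family_radial:
  fixes N p q \<epsilon> :: real
  assumes p: "p > 1" and q: "q > p - 1" and N: "N > p" and \<epsilon>: "\<epsilon> = 1 \<or> \<epsilon> = -1"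
  shows "\<exists>W R. two_parameter_family_at_infinity W R \<and>
    (\<forall>C>0. \<forall>d. solution_on N p q \<epsilon> {R C d<..} (W C d) \<and>
      (W C d \<longlongrightarrow> C) at_top \<and>
      (log_slope N p (W C d) \<longlongrightarrow> - \<epsilon> * C powr (q / (p - 1))) at_top)"
proof -
  define \<beta> m where "\<beta> = (N - p) / (p - 1)" and "m = 1 / (p - 1)"
  have pos: "\<beta> > 0" "m > 0" "q > 0" using p N q by (auto simp: \<beta>_def m_def)
  obtain T V G where T: "continuous_on UNIV (T :: real \<Rightarrow> real)"
    and VG: "continuous_on {(d, t). T d < t} (\<lambda>(d, t). V d t)"
    "\<And>d t. T d < t \<Longrightarrow> 0 < V d t \<and> 0 < G d t"
    "\<And>d t. T d < t \<Longrightarrow> (V d has_real_derivative - \<epsilon> * exp (- \<beta> * t) * G d t powr m) (at t)"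
    "\<And>d t. T d < t \<Longrightarrow> (G d has_real_derivative V d t powr q) (at t)"
    "\<And>d. (V d \<longlongrightarrow> 1) at_top" "\<And>d. ((\<lambda>t. G d t - t) \<longlongrightarrow> d) at_top"
    by (rule constant_limit_family[OF pos \<epsilon>]) blast
  define \<tau> where "\<tau> C = (1 - q * m) * ln C / \<beta>" for C
  have \<tau>: "C * exp (- \<beta> * \<tau> C) = C powr (q * m)" if "C > 0" for C
  proof -
    have "- \<beta> * \<tau> C = (q * m - 1) * ln C" using pos by (simp add: \<tau>_def left_diff_distrib)
    then have "exp (- \<beta> * \<tau> C) = C powr (q * m - 1)" using that by (simp add: powr_def)
    then show ?thesis using that powr_add[of C "q * m - 1" 1] by simp
  qed
  define w where "w C d t = C * V d (t + \<tau> C)" for C d t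
  define g where "g C d t = C powr q * G d (t + \<tau> C)" for C d t
  define W where "W C d r = w C d (ln r)" for C d r
  define R where "R C d = exp (T d - \<tau> C)" for C d
  have shift: "((\<lambda>t. t + c) has_real_derivative 1) (at t)" for c t :: real
    by (auto intro!: derivative_eq_intros)
  have top: "filterlim (\<lambda>t. t + c) at_top at_top" for c :: real
    by real_asymp
  have dw: "(w C d has_real_derivative - \<epsilon> * exp (- \<beta> * t) * g C d t powr m) (at t)"
    and dg: "(g C d has_real_derivative \<epsilon> * \<epsilon> * w C d t powr q) (at t)"
    and wg: "0 < w C d t \<and> 0 < g C d t"
    if C: "C > 0" and t: "t \<in> {T d - \<tau> C<..}" for C d t
  proof -
    have t': "T d < t + \<tau> C" using t by simp
    show "0 < w C d t \<and> 0 < g C d t" using VG(2)[OF t'] C by (simp add: w_def g_def)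
    have D: "(w C d has_real_derivative C * ((- \<epsilon> * exp (- \<beta> * (t + \<tau> C)) * G d (t + \<tau> C) powr m) * 1)) (at t)"
      unfolding w_def[abs_def] by (intro DERIV_cmult DERIV_chain2[OF VG(3)[OF t'] shift])
    have gm: "g C d t powr m = (C * exp (- \<beta> * \<tau> C)) * G d (t + \<tau> C) powr m"
      using VG(2)[OF t'] C unfolding \<tau>[OF C] by (simp add: g_def powr_mult powr_powr)
    have e: "exp (- \<beta> * (t + \<tau> C)) = exp (- \<beta> * t) * exp (- \<beta> * \<tau> C)"
      by (simp add: algebra_simps flip: exp_add)
    have "C * ((- \<epsilon> * exp (- \<beta> * (t + \<tau> C)) * G d (t + \<tau> C) powr m) * 1)
        = - \<epsilon> * exp (- \<beta> * t) * g C d t powr m"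
      unfolding gm e by (simp only: ac_simps mult_1_right)
    from D[unfolded this]
    show "(w C d has_real_derivative - \<epsilon> * exp (- \<beta> * t) * g C d t powr m) (at t)" .
    have "(g C d has_real_derivative C powr q * (V d (t + \<tau> C) powr q * 1)) (at t)"
      unfolding g_def[abs_def] by (intro DERIV_cmult DERIV_chain2[OF VG(4)[OF t'] shift])
    moreover have "w C d t powr q = C powr q * V d (t + \<tau> C) powr q"
      using VG(2)[OF t'] C by (simp add: w_def powr_mult)
    moreover have "\<epsilon> * \<epsilon> = 1" using \<epsilon> by auto
    ultimately show "(g C d has_real_derivative \<epsilon> * \<epsilon> * w C d t powr q) (at t)" by simp
  qed
  have W_sol: "solution_on N p q \<epsilon> {R C d<..} (W C d)"
    and W_slope: "\<And>r. R C d < r \<Longrightarrow> slope N p (W C d) r = - \<epsilon> * g C d (ln r) powr m"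
    if C: "C > 0" for C d
    using log_solution_on_ray[of p \<epsilon> "T d - \<tau> C" "w C d" "g C d" N \<epsilon> q, folded \<beta>_def m_def]
      p \<epsilon> wg[OF C] dw[OF C] dg[OF C]
    unfolding W_def[abs_def] R_def by simp_all
  have W_lim: "(W C d \<longlongrightarrow> C) at_top" for C d
  proof -
    have "((\<lambda>t. C * V d (t + \<tau> C)) \<longlongrightarrow> C * 1) at_top"
      by (intro tendsto_intros filterlim_compose[OF VG(5) top])
    then show ?thesis unfolding W_def[abs_def] w_def by (intro limit_at_top_compose_ln) simp
  qed
  have g_lim: "((\<lambda>t. g C d t / t) \<longlongrightarrow> C powr q) at_top" for C d
  proof -
    have "((\<lambda>t. G d (t + \<tau> C) - (t + \<tau> C)) \<longlongrightarrow> d) at_top"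
      by (rule filterlim_compose[OF VG(6) top])
    moreover have "((\<lambda>t :: real. 1 / t) \<longlongrightarrow> 0) at_top" by real_asymp
    moreover have "((\<lambda>t. (t + \<tau> C) / t) \<longlongrightarrow> 1) at_top" by real_asymp
    ultimately have "((\<lambda>t. C powr q * ((G d (t + \<tau> C) - (t + \<tau> C)) * (1 / t) + (t + \<tau> C) / t))
        \<longlongrightarrow> C powr q * (d * 0 + 1)) at_top"
      by (intro tendsto_intros)
    moreover have "C powr q * ((G d (t + \<tau> C) - (t + \<tau> C)) * (1 / t) + (t + \<tau> C) / t) = g C d t / t" for t
      by (cases "t = 0") (simp_all add: g_def field_simps)
    ultimately show ?thesis by simp
  qed
  have W_slope_lim: "(log_slope N p (W C d) \<longlongrightarrow> - \<epsilon> * C powr (q / (p - 1))) at_top" if C: "C > 0" for C d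
  proof -
    have "(C powr q) powr (1 / (p - 1)) = C powr (q / (p - 1))" by (simp add: powr_powr)
    moreover have "\<forall>\<^sub>F r in at_top. slope N p (W C d) r
        = - \<epsilon> * g C d (ln r) powr (1 / (p - 1))"
      using eventually_gt_at_top[of "R C d"]
      by eventually_elim (rule W_slope[OF C, unfolded m_def])
    ultimately show ?thesis
      using slope_limit[OF p _ g_lim, of N "W C d" "- \<epsilon>" C d] C by simp
  qed
  have \<tau>_cont: "continuous_on {0<..} \<tau>"
    unfolding \<tau>_def[abs_def] using pos by (auto intro!: continuous_intros)
  have "two_parameter_family_at_infinity W R"
    unfolding two_parameter_family_at_infinity_def
  proof (intro conjI allI impI)
    show "R C d > 0" for C d by (simp add: R_def)
    have "continuous_on {x :: real \<times> real. fst x > 0} (\<lambda>x. exp (T (snd x) - \<tau> (fst x)))"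
      by (intro continuous_intros continuous_on_compose2[OF T] continuous_on_compose2[OF \<tau>_cont]) auto
    then show "continuous_on {(C, d). C > 0} (\<lambda>(C, d). R C d)"
      by (simp add: case_prod_unfold R_def)
    let ?D = "{x :: real \<times> real \<times> real. fst x > 0 \<and> R (fst x) (fst (snd x)) < snd (snd x)}"
    have r0: "snd (snd x) > 0" "T (fst (snd x)) < ln (snd (snd x)) + \<tau> (fst x)" if "x \<in> ?D" for x
    proof -
      have "exp (T (fst (snd x)) - \<tau> (fst x)) < snd (snd x)" using that by (simp add: R_def)
      then show "snd (snd x) > 0" "T (fst (snd x)) < ln (snd (snd x)) + \<tau> (fst x)"
        by (auto simp: exp_less_iff_ln)
    qed
    have "\<not> R C d < 0" for C d by (simp add: R_def not_less)
    then have "continuous_on ?D (\<lambda>x. (fst (snd x), ln (snd (snd x)) + \<tau> (fst x)))"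
      by (intro continuous_intros continuous_on_compose2[OF \<tau>_cont]) (use r0 in auto)
    then have "continuous_on ?D (\<lambda>x. (\<lambda>(d, t). V d t) (fst (snd x), ln (snd (snd x)) + \<tau> (fst x)))"
      by (rule continuous_on_compose2[OF VG(1)]) (use r0 in auto)
    then have "continuous_on ?D (\<lambda>x. fst x * V (fst (snd x)) (ln (snd (snd x)) + \<tau> (fst x)))"
      by (intro continuous_intros) auto
    then show "continuous_on {(C, d, r). C > 0 \<and> R C d < r} (\<lambda>(C, d, r). W C d r)"
      by (simp add: case_prod_unfold W_def w_def)
    fix C C' d d' :: real
    assume C: "C > 0" "C' > 0" and ne: "(C, d) \<noteq> (C', d')"
    show "\<not> (\<forall>\<^sub>F r in at_top. W C d r = W C' d' r)"
    proof
      assume eq: "\<forall>\<^sub>F r in at_top. W C d r = W C' d' r"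
      then have "(W C' d' \<longlongrightarrow> C) at_top"
        using W_lim[of C d] by (rule Lim_transform_eventually[rotated])
      then have CC: "C = C'" using tendsto_unique[OF _ _ W_lim[of C' d']] by simp
      have "filterlim (\<lambda>t. exp (t - \<tau> C)) at_top at_top" by real_asymp
      with eq have "\<forall>\<^sub>F t in at_top. W C d (exp (t - \<tau> C)) = W C' d' (exp (t - \<tau> C))"
        by (auto simp: filterlim_iff)
      then have "\<forall>\<^sub>F t in at_top. V d t = V d' t"
      proof eventually_elim
        case (elim t)
        then show ?case using C by (simp add: W_def w_def CC)
      qed
      then have "d = d'"
        using germ_determines_flux_constant[of m \<epsilon> "max (T d) (T d')" "G d" d "G d'" d' "V d" \<beta> "V d'"]
          pos \<epsilon> VG by auto
      with CC ne show False by simp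
    qed
  qed
  then show ?thesis using W_sol W_lim W_slope_lim by blast
qed

section \<open>Solutions asymptotic to the explicit solution\<close>

text \<open>The scaling exponent is \<open>- \<alpha>\<close> and \<open>\<alpha> (q + 1 - p) = N - p\<close>, so the last factor in the definition is \<open>\<alpha> q\<close>.\<close>

lemma a_star_explicit:
  assumes p: "p > 1" and q: "q > p - 1" and N: "N > p"
  defines "\<alpha> \<equiv> (N - p) / (q + 1 - p)"
  shows "a_star N p q > 0" and "a_star N p q powr (q - p + 1) = \<alpha> powr p * q"
proof -
  have \<alpha>: "\<alpha> > 0" using assms by (simp add: \<alpha>_def)
  have g: "scaling_exponent N p q = - \<alpha>"
    unfolding scaling_exponent_def \<alpha>_def by (simp add: minus_divide_left)
  show "a_star N p q > 0" using a_star(1)[of p q N] assms by simp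
  have "a_star N p q powr (q - p + 1)
      = (-1) * \<bar>- \<alpha>\<bar> powr (p - 2) * (- \<alpha>) * (N - p - (p - 1) * (- \<alpha>))"
    using a_star(2)[of p q N] assms unfolding g by simp
  also have "N - p - (p - 1) * (- \<alpha>) = \<alpha> * q"
  proof -
    have "\<alpha> * (q + 1 - p) = N - p" using q by (simp add: \<alpha>_def)
    then show ?thesis by (simp add: algebra_simps)
  qed
  also have "(-1) * \<bar>- \<alpha>\<bar> powr (p - 2) * (- \<alpha>) * (\<alpha> * q) = (\<alpha> powr (p - 2) * \<alpha> ^ 2) * q"
    using \<alpha> by (simp add: power2_eq_square)
  also have "\<alpha> powr (p - 2) * \<alpha> ^ 2 = \<alpha> powr p"
    using \<alpha> powr_add[of \<alpha> "p - 2" 2] by (simp add: powr_numeral)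
  finally show "a_star N p q powr (q - p + 1) = \<alpha> powr p * q" .
qed

text \<open>The constants are chosen such that \<open>(exp t, exp (q t))\<close> corresponds to \<open>w_star\<close> and its flux. With \<open>A = a_star N p q\<close>,
the equation for the flux amounts to \<open>A powr (q - p + 1) = \<alpha> powr p * q\<close>, and \<open>(q m - 1) \<alpha> = \<beta>\<close> matches the weights.\<close>

lemma normal_form_solution:
  fixes N p q :: real
  assumes p: "p > 1" and q: "q > p - 1" and N: "N > p"
  defines "m \<equiv> 1 / (p - 1)" and "\<alpha> \<equiv> (N - p) / (q + 1 - p)"
  assumes J: "open J"
    and du: "\<And>t. t \<in> J \<Longrightarrow> (u has_real_derivative exp (- (q * m - 1) * t) * v t powr m) (at t)"
    and dv: "\<And>t. t \<in> J \<Longrightarrow> (v has_real_derivative q * u t powr q) (at t)"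
    and uv: "\<And>t. t \<in> J \<Longrightarrow> 0 < u t \<and> 0 < v t"
  shows "solution_on N p q (-1) {r. 0 < r \<and> \<alpha> * ln r \<in> J} (\<lambda>r. a_star N p q * u (\<alpha> * ln r))"
    and "\<And>r. 0 < r \<Longrightarrow> \<alpha> * ln r \<in> J \<Longrightarrow>
      r powr ((N - 1) / (p - 1)) * deriv (\<lambda>r. a_star N p q * u (\<alpha> * ln r)) r
        = ((a_star N p q * \<alpha>) powr (p - 1) * v (\<alpha> * ln r)) powr m"
    and "\<And>t. \<alpha> * t \<in> J \<Longrightarrow> ((\<lambda>t. (a_star N p q * \<alpha>) powr (p - 1) * v (\<alpha> * t))
        has_real_derivative (a_star N p q * u (\<alpha> * t)) powr q) (at t)"
proof -
  define A where "A = a_star N p q"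
  define \<beta> where "\<beta> = (N - p) / (p - 1)"
  have A: "A > 0" "A powr (q - p + 1) = \<alpha> powr p * q"
    using a_star_explicit[OF p q N] by (simp_all add: A_def \<alpha>_def)
  have \<alpha>: "\<alpha> > 0" using q N by (simp add: \<alpha>_def)
  have \<beta>: "(q * m - 1) * \<alpha> = \<beta>"
  proof -
    have "q * m - 1 = (q + 1 - p) / (p - 1)" using p by (simp add: m_def field_simps)
    then show ?thesis using q by (simp add: \<alpha>_def \<beta>_def)
  qed
  define w G where "w t = A * u (\<alpha> * t)" and "G t = (A * \<alpha>) powr (p - 1) * v (\<alpha> * t)" for t
  define I where "I = {t. \<alpha> * t \<in> J}"
  have I: "open I"
  proof -
    have "open ((\<lambda>t. \<alpha> * t) -` J)" by (intro open_vimage J continuous_intros)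
    then show ?thesis by (simp add: I_def vimage_def)
  qed
  have scale: "((\<lambda>t. \<alpha> * t) has_real_derivative \<alpha>) (at t)" for t
    by (auto intro!: derivative_eq_intros)
  have dw: "(w has_real_derivative - (-1) * exp (- \<beta> * t) * G t powr m) (at t)" if "t \<in> I" for t
  proof -
    have t: "\<alpha> * t \<in> J" using that by (simp add: I_def)
    have "(w has_real_derivative A * ((exp (- (q * m - 1) * (\<alpha> * t)) * v (\<alpha> * t) powr m) * \<alpha>)) (at t)"
      unfolding w_def[abs_def] by (intro DERIV_cmult DERIV_chain2[OF du[OF t] scale])
    moreover have "G t powr m = (A * \<alpha>) * v (\<alpha> * t) powr m"
      using uv[OF t] A \<alpha> p by (simp add: G_def powr_mult powr_powr m_def)
    moreover have "- (q * m - 1) * (\<alpha> * t) = - \<beta> * t"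
      unfolding \<beta>[symmetric] by (simp add: algebra_simps)
    ultimately show ?thesis by (simp add: ac_simps)
  qed
  have dG: "(G has_real_derivative w t powr q) (at t)" if "t \<in> I" for t
  proof -
    have t: "\<alpha> * t \<in> J" using that by (simp add: I_def)
    have "(G has_real_derivative (A * \<alpha>) powr (p - 1) * ((q * u (\<alpha> * t) powr q) * \<alpha>)) (at t)"
      unfolding G_def[abs_def] by (intro DERIV_cmult DERIV_chain2[OF dv[OF t] scale])
    moreover have "(A * \<alpha>) powr (p - 1) * ((q * u (\<alpha> * t) powr q) * \<alpha>) = w t powr q"
    proof -
      have "\<alpha> powr (p - 1) * \<alpha> = \<alpha> powr p" using \<alpha> powr_add[of \<alpha> "p - 1" 1] by simp
      then have "(A * \<alpha>) powr (p - 1) * ((q * u (\<alpha> * t) powr q) * \<alpha>)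
          = A powr (p - 1) * (\<alpha> powr p * q) * u (\<alpha> * t) powr q"
        using A(1) \<alpha> by (simp add: powr_mult)
      also have "A powr (p - 1) * (\<alpha> powr p * q) = A powr q"
        unfolding A(2)[symmetric] by (simp flip: powr_add)
      finally show ?thesis using A(1) uv[OF t] by (simp add: w_def powr_mult)
    qed
    ultimately show ?thesis by simp
  qed
  have "0 < w t \<and> 0 < G t" if "t \<in> I" for t
    using that uv A \<alpha> by (auto simp: w_def G_def I_def)
  note sol = log_solution[of p "-1" I w G N "-1" q, folded \<beta>_def m_def, OF p _ I this dw]
  show "solution_on N p q (-1) {r. 0 < r \<and> \<alpha> * ln r \<in> J} (\<lambda>r. a_star N p q * u (\<alpha> * ln r))"
    using sol(1) dG by (simp add: w_def I_def A_def)
  show "r powr ((N - 1) / (p - 1)) * deriv (\<lambda>r. a_star N p q * u (\<alpha> * ln r)) r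
        = ((a_star N p q * \<alpha>) powr (p - 1) * v (\<alpha> * ln r)) powr m" if "0 < r" "\<alpha> * ln r \<in> J" for r
    using sol(2)[of r] dG that by (simp add: w_def G_def I_def A_def)
  show "((\<lambda>t. (a_star N p q * \<alpha>) powr (p - 1) * v (\<alpha> * t))
        has_real_derivative (a_star N p q * u (\<alpha> * t)) powr q) (at t)" if "\<alpha> * t \<in> J" for t
    using dG[of t] that by (simp add: w_def G_def[abs_def] I_def A_def)
qed

lemma w_star_eq_exp: "0 < r \<Longrightarrow> w_star N p q r = a_star N p q * exp ((N - p) / (q + 1 - p) * ln r)"
  by (simp add: w_star_def powr_def)

lemma w_star_solution:
  assumes p: "p > 1" and q: "q > p - 1" and N: "N > p"
  shows "solution_on N p q (-1) {0<..} (w_star N p q)"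
proof -
  define m where "m = 1 / (p - 1)"
  have du: "(exp has_real_derivative exp (- (q * m - 1) * t) * exp (q * t) powr m) (at t)" for t
  proof -
    have "exp (- (q * m - 1) * t) * exp (q * t) powr m = exp t"
      by (simp add: powr_def algebra_simps flip: exp_add)
    then show ?thesis by (metis DERIV_exp)
  qed
  have dv: "((\<lambda>t. exp (q * t)) has_real_derivative q * exp t powr q) (at t)" for t
    by (auto intro!: derivative_eq_intros simp: powr_def)
  have "solution_on N p q (-1) {r. 0 < r} (\<lambda>r. a_star N p q * exp ((N - p) / (q + 1 - p) * ln r))"
    using normal_form_solution(1)[OF p q N, of UNIV exp "\<lambda>t. exp (q * t)"] du dv
    by (simp add: m_def)
  then have sol: "solution_on N p q (-1) {0<..} (\<lambda>r. a_star N p q * exp ((N - p) / (q + 1 - p) * ln r))"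
    by (simp add: greaterThan_def)
  show ?thesis
    by (rule positive_solution_on_cong[OF sol]) (simp_all add: w_star_eq_exp)
qed

lemma w_star_C0_regular:
  assumes p: "p > 1" and q: "q > p - 1" and N: "N > p"
  shows "C0_regular_solution N (- N) p q (-1) \<rho> (w_star N p q)"
proof -
  define A \<alpha> where "A = a_star N p q" and "\<alpha> = (N - p) / (q + 1 - p)"
  have \<alpha>: "\<alpha> > 0" using q N by (simp add: \<alpha>_def)
  have w: "w_star N p q = (\<lambda>r. A * r powr \<alpha>)" by (simp add: w_star_def A_def \<alpha>_def fun_eq_iff)
  have pw: "((\<lambda>r. c * r powr e) has_real_derivative c * (e * r powr (e - 1))) (at r)"
    if "r > 0" for c e r :: real
    by (intro DERIV_cmult has_real_derivative_powr that)
  have d1: "deriv (w_star N p q) r = A * \<alpha> * r powr (\<alpha> - 1)" if "r > 0" for r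
    using DERIV_imp_deriv[OF pw[OF that]] unfolding w by simp
  have d2: "(deriv (w_star N p q) has_real_derivative A * \<alpha> * ((\<alpha> - 1) * r powr (\<alpha> - 1 - 1))) (at r)"
    if "r > 0" for r
    by (rule has_field_derivative_transform_within_open[OF pw[OF that], of "{0<..}"])
       (use that d1 in auto)
  have "C2_on {0<..<\<rho>} (w_star N p q)"
    unfolding C2_on_def
  proof (intro conjI ballI)
    fix r assume "r \<in> {0<..<\<rho>}"
    then have r: "r > 0" by simp
    show "w_star N p q differentiable (at r)"
      using pw[OF r, of A \<alpha>] unfolding w real_differentiable_def by blast
    show "deriv (w_star N p q) differentiable (at r)"
      using d2[OF r] unfolding real_differentiable_def by blast
  next
    have "continuous_on {0<..<\<rho>} (\<lambda>r. A * \<alpha> * ((\<alpha> - 1) * r powr (\<alpha> - 1 - 1)))"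
      by (intro continuous_intros) auto
    then show "continuous_on {0<..<\<rho>} (deriv (deriv (w_star N p q)))"
      using DERIV_imp_deriv[OF d2] by (auto cong: continuous_on_cong_simp)
  qed
  moreover have "solution_on N p q (-1) {0<..<\<rho>} (w_star N p q)"
    using w_star_solution[OF p q N] by (auto simp: positive_solution_on_def)
  moreover have "(w_star N p q \<longlongrightarrow> 0) (at_right 0)"
    unfolding w using \<alpha> by real_asymp
  ultimately show ?thesis unfolding C0_regular_solution_def by blast
qed

text \<open>The normal form is invariant under \<open>(u, v) \<mapsto> (exp (- \<tau>) u(t + \<tau>), exp (- q \<tau>) v(t + \<tau>))\<close>, and
\<open>(exp t, exp (q t))\<close> is fixed by this action. A translation of the connecting orbit therefore keeps its
behaviour at \<open>0\<close> and prescribes the limit at infinity. Since the derivative of the flux is \<open>w powr q\<close>,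
l'Hospital's rule gives its linear growth.\<close>

lemma connecting_solution_radial:
  fixes N p q C :: real
  assumes p: "p > 1" and q: "q > p - 1" and N: "N > p" and C: "C > 0"
  shows "\<exists>w. solution_on N p q (-1) {0<..} w \<and>
    w \<sim>[at_right 0] w_star N p q \<and> (w \<longlongrightarrow> C) at_top \<and>
    (log_slope N p w \<longlongrightarrow> C powr (q / (p - 1))) at_top \<and>
    (\<forall>r>0. w r < w_star N p q r)"
proof -
  define m \<alpha> A where "m = 1 / (p - 1)" and "\<alpha> = (N - p) / (q + 1 - p)" and "A = a_star N p q"
  have A: "A > 0" using a_star_explicit(1)[OF p q N] by (simp add: A_def)
  have \<alpha>: "\<alpha> > 0" using q N by (simp add: \<alpha>_def)
  have pos: "m > 0" "q > 0" "q * m > 1" using p q by (auto simp: m_def field_simps)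
  obtain u v C0 where uv: "\<And>t. (u has_real_derivative exp (- (q * m - 1) * t) * v t powr m) (at t)"
    "\<And>t. (v has_real_derivative q * u t powr q) (at t)"
    "\<And>t. 0 < u t \<and> u t < exp t" "\<And>t. 0 < v t"
    "((\<lambda>t. u t / exp t) \<longlongrightarrow> 1) at_bot" "C0 > 0" "(u \<longlongrightarrow> C0) at_top"
    by (rule connecting_orbit[OF pos]) blast
  define \<tau> where "\<tau> = ln (A * C0 / C)"
  have \<tau>: "exp (- \<tau>) = C / (A * C0)" using A C uv(6) by (simp add: \<tau>_def exp_minus)
  define x y where "x t = exp (- \<tau>) * u (t + \<tau>)" and "y t = exp (- q * \<tau>) * v (t + \<tau>)" for t
  have shift: "((\<lambda>t. t + \<tau>) has_real_derivative 1) (at t)" for t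
    by (auto intro!: derivative_eq_intros)
  have dx: "(x has_real_derivative exp (- (q * m - 1) * t) * y t powr m) (at t)" for t
  proof -
    have D: "(x has_real_derivative exp (- \<tau>) *
        (exp (- (q * m - 1) * (t + \<tau>)) * v (t + \<tau>) powr m * 1)) (at t)"
      unfolding x_def[abs_def] by (intro DERIV_cmult DERIV_chain2[OF uv(1) shift])
    have ym: "y t powr m = exp (- (q * m) * \<tau>) * v (t + \<tau>) powr m"
    proof -
      have "exp (- q * \<tau>) powr m = exp (- (q * m) * \<tau>)" by (simp add: powr_def)
      then show ?thesis using uv(4)[of "t + \<tau>"] by (simp add: y_def powr_mult)
    qed
    have e: "exp (- \<tau>) * exp (- (q * m - 1) * (t + \<tau>)) = exp (- (q * m - 1) * t) * exp (- (q * m) * \<tau>)"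
      by (simp add: algebra_simps flip: exp_add)
    have "exp (- \<tau>) * (exp (- (q * m - 1) * (t + \<tau>)) * v (t + \<tau>) powr m * 1)
        = exp (- (q * m - 1) * t) * y t powr m"
      unfolding ym mult_1_right mult.assoc[symmetric] e ..
    from D[unfolded this] show ?thesis .
  qed
  have dy: "(y has_real_derivative q * x t powr q) (at t)" for t
  proof -
    have "(y has_real_derivative exp (- q * \<tau>) * (q * u (t + \<tau>) powr q * 1)) (at t)"
      unfolding y_def[abs_def] by (intro DERIV_cmult DERIV_chain2[OF uv(2) shift])
    moreover have "x t powr q = exp (- q * \<tau>) * u (t + \<tau>) powr q"
    proof -
      have "exp (- \<tau>) powr q = exp (- q * \<tau>)" by (simp add: powr_def)
      then show ?thesis using uv(3)[of "t + \<tau>"] by (simp add: x_def powr_mult)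
    qed
    ultimately show ?thesis by (simp add: ac_simps)
  qed
  have x: "0 < x t" "x t < exp t" and y: "0 < y t" for t
  proof -
    have "exp (- \<tau>) * u (t + \<tau>) < exp (- \<tau>) * exp (t + \<tau>)"
      using uv(3) by (intro mult_strict_left_mono) auto
    also have "\<dots> = exp t" by (simp flip: exp_add)
    finally show "x t < exp t" by (simp add: x_def)
    show "0 < x t" "0 < y t" using uv(3,4) by (auto simp: x_def y_def)
  qed
  have x_top: "((\<lambda>t. A * x t) \<longlongrightarrow> C) at_top"
  proof -
    have "filterlim (\<lambda>t. t + \<tau>) at_top at_top" by real_asymp
    then have "((\<lambda>t. A * (exp (- \<tau>) * u (t + \<tau>))) \<longlongrightarrow> A * (exp (- \<tau>) * C0)) at_top"
      by (intro tendsto_intros filterlim_compose[OF uv(7)])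
    then show ?thesis using A C uv(6) by (simp add: x_def \<tau>)
  qed
  have x_bot: "((\<lambda>t. x t / exp t) \<longlongrightarrow> 1) at_bot"
  proof -
    have "filterlim (\<lambda>t. t + \<tau>) at_bot at_bot" by real_asymp
    then have "((\<lambda>t. u (t + \<tau>) / exp (t + \<tau>)) \<longlongrightarrow> 1) at_bot"
      by (rule filterlim_compose[OF uv(5)])
    moreover have "u (t + \<tau>) / exp (t + \<tau>) = x t / exp t" for t
      by (simp add: x_def exp_add exp_minus field_simps)
    ultimately show ?thesis by simp
  qed
  define w G where "w r = A * x (\<alpha> * ln r)" and "G t = (A * \<alpha>) powr (p - 1) * y (\<alpha> * t)" for r t
  have sol: "solution_on N p q (-1) {0<..} w"
    "\<And>r. 0 < r \<Longrightarrow> slope N p w r = 1 * G (ln r) powr (1 / (p - 1))"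
    "\<And>t. (G has_real_derivative (A * x (\<alpha> * t)) powr q) (at t)"
  proof -
    note nf = normal_form_solution[OF p q N, of UNIV x y, folded m_def \<alpha>_def A_def, OF open_UNIV dx dy]
    have 1: "0 < x t \<and> 0 < y t" for t using x y by simp
    show "solution_on N p q (-1) {0<..} w"
      using nf(1)[OF 1] by (simp add: w_def[abs_def] greaterThan_def)
    show "slope N p w r = 1 * G (ln r) powr (1 / (p - 1))" if "0 < r" for r
      using nf(2)[OF 1 that] by (simp add: w_def[abs_def] G_def m_def)
    show "(G has_real_derivative (A * x (\<alpha> * t)) powr q) (at t)" for t
      using nf(3)[OF 1, of t] by (simp add: G_def[abs_def])
  qed
  have top: "filterlim (\<lambda>t. \<alpha> * t) at_top at_top" using \<alpha> by real_asymp
  have G_lim: "((\<lambda>t. G t / t) \<longlongrightarrow> C powr q) at_top"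
  proof (rule lhospital_at_top_at_top[where f' = "\<lambda>t. (A * x (\<alpha> * t)) powr q" and g' = "\<lambda>_. 1"])
    show "((\<lambda>t. (A * x (\<alpha> * t)) powr q / 1) \<longlongrightarrow> C powr q) at_top"
      unfolding div_by_1
      by (intro tendsto_powr tendsto_const filterlim_compose[OF x_top top]) (use C in auto)
  qed (use sol(3) in \<open>auto intro!: filterlim_ident always_eventually\<close>)
  have "(C powr q) powr (1 / (p - 1)) = C powr (q / (p - 1))" by (simp add: powr_powr)
  moreover have "\<forall>\<^sub>F r in at_top. slope N p w r = 1 * G (ln r) powr (1 / (p - 1))"
    using eventually_gt_at_top[of 0] by eventually_elim (rule sol(2))
  ultimately have slope: "(log_slope N p w \<longlongrightarrow> C powr (q / (p - 1))) at_top"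
    using slope_limit[OF p _ G_lim, of N w 1] C by simp
  have ws: "w_star N p q r = A * exp (\<alpha> * ln r)" if "r > 0" for r
    using w_star_eq_exp[OF that] by (simp add: A_def \<alpha>_def)
  have "w \<sim>[at_right 0] w_star N p q"
  proof (rule asymp_equivI')
    have "filterlim (\<lambda>r. \<alpha> * ln r) at_bot (at_right 0)" using \<alpha> by real_asymp
    then have "((\<lambda>r. x (\<alpha> * ln r) / exp (\<alpha> * ln r)) \<longlongrightarrow> 1) (at_right 0)"
      by (rule filterlim_compose[OF x_bot])
    moreover have "\<forall>\<^sub>F r in at_right 0. x (\<alpha> * ln r) / exp (\<alpha> * ln r) = w r / w_star N p q r"
      using eventually_at_right_less[of 0] by eventually_elim (use A in \<open>simp add: w_def ws\<close>)
    ultimately show "((\<lambda>r. w r / w_star N p q r) \<longlongrightarrow> 1) (at_right 0)"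
      by (rule Lim_transform_eventually)
  qed
  moreover have "(w \<longlongrightarrow> C) at_top"
    unfolding w_def[abs_def]
    by (rule limit_at_top_compose_ln[where f = "\<lambda>t. A * x (\<alpha> * t)"]) (rule filterlim_compose[OF x_top top])
  moreover have "w r < w_star N p q r" if "r > 0" for r
    using x(2)[of "\<alpha> * ln r"] A by (simp add: w_def ws[OF that])
  ultimately show ?thesis using sol(1) slope by blast
qed

lemma stable_solution_radial:
  fixes N p q :: real
  assumes p: "p > 1" and q: "q > p - 1" and N: "N > p"
  shows "\<exists>w. \<exists>r0>0. solution_on N p q (-1) {r0<..} w \<and>
    w \<sim>[at_top] w_star N p q \<and> (\<forall>r>r0. w_star N p q r < w r)"
proof -
  define m \<alpha> A where "m = 1 / (p - 1)" and "\<alpha> = (N - p) / (q + 1 - p)" and "A = a_star N p q"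
  have A: "A > 0" using a_star_explicit(1)[OF p q N] by (simp add: A_def)
  have \<alpha>: "\<alpha> > 0" using q N by (simp add: \<alpha>_def)
  have pos: "m > 0" "q > 0" "q * m > 1" using p q by (auto simp: m_def field_simps)
  obtain T u v where uv: "\<And>t. T < t \<Longrightarrow> (u has_real_derivative exp (- (q * m - 1) * t) * v t powr m) (at t)"
    "\<And>t. T < t \<Longrightarrow> (v has_real_derivative q * u t powr q) (at t)"
    "\<And>t. T < t \<Longrightarrow> exp t < u t" "\<And>t. T < t \<Longrightarrow> 0 < v t"
    "((\<lambda>t. u t / exp t) \<longlongrightarrow> 1) at_top"
    by (rule stable_orbit[OF pos]) blast
  define w where "w r = A * u (\<alpha> * ln r)" for r
  have ray: "exp (T / \<alpha>) < r \<longleftrightarrow> 0 < r \<and> T < \<alpha> * ln r" for r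
    using \<alpha> by (simp add: exp_less_iff_ln pos_divide_less_eq mult.commute)
  have "solution_on N p q (-1) {r. 0 < r \<and> \<alpha> * ln r \<in> {T<..}} w"
    unfolding w_def[abs_def] A_def \<alpha>_def
  proof (rule normal_form_solution(1)[OF p q N, of "{T<..}" u v, folded m_def])
    show "0 < u t \<and> 0 < v t" if "t \<in> {T<..}" for t
      using uv(3)[of t] uv(4)[of t] that by (auto intro: less_trans[OF exp_gt_zero])
  qed (use uv in auto)
  moreover have "{r. 0 < r \<and> \<alpha> * ln r \<in> {T<..}} = {exp (T / \<alpha>)<..}" by (auto simp: ray)
  ultimately have sol: "solution_on N p q (-1) {exp (T / \<alpha>)<..} w" by simp
  have ws: "w_star N p q r = A * exp (\<alpha> * ln r)" if "r > 0" for r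
    using w_star_eq_exp[OF that] by (simp add: A_def \<alpha>_def)
  have "w \<sim>[at_top] w_star N p q"
  proof (rule asymp_equivI')
    have "filterlim (\<lambda>r. \<alpha> * ln r) at_top at_top" using \<alpha> by real_asymp
    then have "((\<lambda>r. u (\<alpha> * ln r) / exp (\<alpha> * ln r)) \<longlongrightarrow> 1) at_top"
      by (rule filterlim_compose[OF uv(5)])
    moreover have "\<forall>\<^sub>F r in at_top. u (\<alpha> * ln r) / exp (\<alpha> * ln r) = w r / w_star N p q r"
      using eventually_gt_at_top[of 0] by eventually_elim (use A in \<open>simp add: w_def ws\<close>)
    ultimately show "((\<lambda>r. w r / w_star N p q r) \<longlongrightarrow> 1) at_top"
      by (rule Lim_transform_eventually)
  qed
  moreover have "w_star N p q r < w r" if "exp (T / \<alpha>) < r" for r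
    using that uv(3)[of "\<alpha> * ln r"] A by (auto simp: ray w_def ws)
  ultimately show ?thesis using sol exp_gt_zero by blast
qed

section \<open>Inversion and the case p > N\<close>

lemma filterlim_reciprocal_at_right_0: "filterlim (\<lambda>r :: real. 1 / r) at_top (at_right 0)"
  using filterlim_inverse_at_top_right by (simp add: inverse_eq_divide)

lemma filterlim_reciprocal_at_top: "filterlim (\<lambda>r :: real. 1 / r) (at_right 0) at_top"
  using filterlim_inverse_at_right_top by (simp add: inverse_eq_divide)

lemma inverted_solution:
  assumes sol: "solution_on (2 * p - N) p q \<epsilon> I w" and I: "open I" and p: "p > 1"
  shows "solution_on N p q \<epsilon> {r. 0 < r \<and> 1 / r \<in> I} (\<lambda>r. w (1 / r))"
    and "\<And>r. 0 < r \<Longrightarrow> 1 / r \<in> I \<Longrightarrow> slope N p (\<lambda>r. w (1 / r)) r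
      = - slope (2 * p - N) p w (1 / r)"
  using inversion[OF assms] by simp_all

lemma reciprocal_greaterThan: "r0 > 0 \<Longrightarrow> {r. 0 < r \<and> 1 / r \<in> {r0<..}} = {0<..<1 / r0}" for r0 :: real
  by (auto simp: field_simps)

lemma inverted_log_slope_limit:
  fixes N p L r0 :: real
  assumes sol: "solution_on (2 * p - N) p q \<epsilon> {r0<..} w" and p: "p > 1"
    and lim: "(log_slope (2 * p - N) p w \<longlongrightarrow> L) at_top"
  shows "(abs_log_slope N p (\<lambda>r. w (1 / r))
      \<longlongrightarrow> - L) (at_right 0)"
proof -
  have "((\<lambda>r. - ((1 / r) powr ((2 * p - N - 1) / (p - 1)) * ln (1 / r) powr (- (1 / (p - 1))) * deriv w (1 / r)))
      \<longlongrightarrow> - L) (at_right 0)"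
    by (rule tendsto_minus, rule filterlim_compose[OF lim filterlim_reciprocal_at_right_0])
  moreover have "\<forall>\<^sub>F r in at_right 0. 1 / r > max r0 1"
    by (rule filterlim_at_top_dense[THEN iffD1, rule_format, OF filterlim_reciprocal_at_right_0])
  then have "\<forall>\<^sub>F r in at_right 0.
      - ((1 / r) powr ((2 * p - N - 1) / (p - 1)) * ln (1 / r) powr (- (1 / (p - 1))) * deriv w (1 / r))
      = abs_log_slope N p (\<lambda>r. w (1 / r)) r"
    using eventually_at_right_less[of 0]
  proof eventually_elim
    case (elim r)
    have r: "0 < r" "1 / r \<in> {r0<..}" "r < 1" using elim by (auto simp: field_simps)
    then have "\<bar>ln r\<bar> = ln (1 / r)" by (simp add: ln_div)
    moreover have "abs_log_slope N p (\<lambda>r. w (1 / r)) r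
        = \<bar>ln r\<bar> powr (- (1 / (p - 1))) * (slope N p (\<lambda>r. w (1 / r)) r)"
      by (simp only: ac_simps)
    ultimately show ?case
      unfolding inverted_solution(2)[OF sol open_greaterThan p r(1,2)] by simp
  qed
  ultimately show ?thesis by (rule Lim_transform_eventually)
qed

text \<open>The scaling exponent and \<open>N - p\<close> both change sign, so the product defining \<open>a_star\<close> is unchanged.\<close>

lemma w_star_inversion:
  assumes "r > 0"
  shows "w_star (2 * p - N) p q (1 / r) = w_star N p q r"
proof -
  have "scaling_exponent (2 * p - N) p q = - scaling_exponent N p q"
    unfolding scaling_exponent_def by (simp add: minus_divide_left)
  then have "a_star (2 * p - N) p q = a_star N p q"
    unfolding a_star_def by (simp add: algebra_simps)
  moreover have "(1 / r) powr ((2 * p - N - p) / (q + 1 - p)) = r powr ((N - p) / (q + 1 - p))"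
  proof -
    have "(2 * p - N - p) / (q + 1 - p) = - ((N - p) / (q + 1 - p))"
      by (simp add: minus_divide_left)
    then show ?thesis using assms by (simp add: powr_divide powr_minus_divide)
  qed
  ultimately show ?thesis by (simp add: w_star_def)
qed

lemma w_star_solution_inverted:
  assumes p: "p > 1" and q: "q > p - 1" and N: "N < p"
  shows "solution_on N p q (-1) {0<..} (w_star N p q)"
proof -
  have "solution_on N p q (-1) {r. 0 < r \<and> 1 / r \<in> {0<..}} (\<lambda>r. w_star (2 * p - N) p q (1 / r))"
    by (rule inverted_solution(1)[OF w_star_solution open_greaterThan p]) (use p q N in auto)
  moreover have "{r. 0 < r \<and> 1 / r \<in> {0<..}} = {0 :: real<..}" by auto
  ultimately have "solution_on N p q (-1) {0<..} (\<lambda>r. w_star (2 * p - N) p q (1 / r))" by simp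
  then show ?thesis
    by (rule positive_solution_on_cong) (simp_all add: w_star_inversion)
qed

lemma asymp_equiv_w_star_inverted:
  shows "w \<sim>[at_top] w_star (2 * p - N) p q \<Longrightarrow> (\<lambda>r. w (1 / r)) \<sim>[at_right 0] w_star N p q"
    and "w \<sim>[at_right 0] w_star (2 * p - N) p q \<Longrightarrow> (\<lambda>r. w (1 / r)) \<sim>[at_top] w_star N p q"
proof -
  assume "w \<sim>[at_top] w_star (2 * p - N) p q"
  from asymp_equiv_compose'[OF this filterlim_reciprocal_at_right_0]
  show "(\<lambda>r. w (1 / r)) \<sim>[at_right 0] w_star N p q"
    by (rule asymp_equiv_transfer)
       (auto intro!: eventually_mono[OF eventually_at_right_less[of 0]] simp: w_star_inversion)
next
  assume "w \<sim>[at_right 0] w_star (2 * p - N) p q"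
  from asymp_equiv_compose'[OF this filterlim_reciprocal_at_top]
  show "(\<lambda>r. w (1 / r)) \<sim>[at_top] w_star N p q"
    by (rule asymp_equiv_transfer)
       (auto intro!: eventually_mono[OF eventually_gt_at_top[of 0]] simp: w_star_inversion)
qed

lemma decaying_solution_inverted:
  fixes N p q \<epsilon> k :: real
  assumes p: "p > 1" and q: "q > 0" and N: "N < p" and \<epsilon>: "\<epsilon> = 1 \<or> \<epsilon> = -1" and k: "k > 0"
  shows "\<exists>w. \<exists>r0>0. solution_on N p q \<epsilon> {0<..<r0} w \<and>
    ((\<lambda>r. r powr ((N - p) / (p - 1)) * w r) \<longlongrightarrow> k) (at_right 0) \<and>
    (slope N p w \<longlongrightarrow> (p - N) / (p - 1) * k) (at_right 0)"
proof -
  obtain w r0 where r0: "r0 > 0"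
    and sol: "solution_on (2 * p - N) p q \<epsilon> {r0<..} w"
    and lim: "((\<lambda>r. r powr ((2 * p - N - p) / (p - 1)) * w r) \<longlongrightarrow> k) at_top"
    and slope: "(slope (2 * p - N) p w \<longlongrightarrow> - ((2 * p - N - p) / (p - 1) * k)) at_top"
    using decaying_solution_radial[of p q "2 * p - N" \<epsilon> k] assms by auto
  have "solution_on N p q \<epsilon> {0<..<1 / r0} (\<lambda>r. w (1 / r))"
    using inverted_solution(1)[OF sol open_greaterThan p] reciprocal_greaterThan[OF r0] by simp
  moreover have "((\<lambda>r. r powr ((N - p) / (p - 1)) * w (1 / r)) \<longlongrightarrow> k) (at_right 0)"
  proof -
    have "(2 * p - N - p) / (p - 1) = - ((N - p) / (p - 1))" by (simp add: minus_divide_left)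
    then have "\<forall>\<^sub>F r in at_right 0. (1 / r) powr ((2 * p - N - p) / (p - 1)) * w (1 / r)
        = r powr ((N - p) / (p - 1)) * w (1 / r)"
      by (auto intro!: eventually_mono[OF eventually_at_right_less[of 0]] simp: powr_divide powr_minus_divide)
    with filterlim_compose[OF lim filterlim_reciprocal_at_right_0] show ?thesis
      by (rule Lim_transform_eventually)
  qed
  moreover have "(slope N p (\<lambda>r. w (1 / r)) \<longlongrightarrow> (p - N) / (p - 1) * k) (at_right 0)"
  proof -
    have "((\<lambda>r. - (slope (2 * p - N) p w (1 / r)))
        \<longlongrightarrow> - (- ((2 * p - N - p) / (p - 1) * k))) (at_right 0)"
      by (rule tendsto_minus, rule filterlim_compose[OF slope filterlim_reciprocal_at_right_0])
    moreover have "\<forall>\<^sub>F r in at_right 0. 1 / r > r0"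
      by (rule filterlim_at_top_dense[THEN iffD1, rule_format, OF filterlim_reciprocal_at_right_0])
    then have "\<forall>\<^sub>F r in at_right 0. - (slope (2 * p - N) p w (1 / r))
        = slope N p (\<lambda>r. w (1 / r)) r"
      using eventually_at_right_less[of 0]
      by eventually_elim (simp add: inverted_solution(2)[OF sol open_greaterThan p])
    ultimately show ?thesis by (auto intro: Lim_transform_eventually)
  qed
  ultimately show ?thesis using r0 by (intro exI[of _ "\<lambda>r. w (1 / r)"] exI[of _ "1 / r0"]) simp
qed

lemma constant_limit_family_inverted:
  fixes N p q \<epsilon> :: real
  assumes p: "p > 1" and q: "q > p - 1" and N: "N < p" and \<epsilon>: "\<epsilon> = 1 \<or> \<epsilon> = -1"
  shows "\<exists>W R. two_parameter_family_at_0 W R \<and>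
    (\<forall>C>0. \<forall>d. solution_on N p q \<epsilon> {0<..<R C d} (W C d) \<and>
      (W C d \<longlongrightarrow> C) (at_right 0) \<and>
      (abs_log_slope N p (W C d) \<longlongrightarrow> \<epsilon> * C powr (q / (p - 1))) (at_right 0))"
proof -
  obtain W R where fam: "two_parameter_family_at_infinity W R"
    and W: "\<And>C d. C > 0 \<Longrightarrow> solution_on (2 * p - N) p q \<epsilon> {R C d<..} (W C d)"
    "\<And>C d. C > 0 \<Longrightarrow> (W C d \<longlongrightarrow> C) at_top"
    "\<And>C d. C > 0 \<Longrightarrow> (log_slope (2 * p - N) p (W C d) \<longlongrightarrow> - \<epsilon> * C powr (q / (p - 1))) at_top"
    using constant_limit_family_radial[of p q "2 * p - N" \<epsilon>] assms by auto
  have R: "R C d > 0" if "C > 0" for C d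
    using fam that by (auto simp: two_parameter_family_at_infinity_def)
  define W' R' where "W' C d r = W C d (1 / r)" and "R' C d = 1 / R C d" for C d r
  have "two_parameter_family_at_0 W' R'"
    unfolding two_parameter_family_at_0_def
  proof (intro conjI allI impI)
    show "R' C d > 0" if "C > 0" for C d using R[OF that] by (simp add: R'_def)
    have "continuous_on {(C, d). C > 0} (\<lambda>(C, d). R C d)"
      using fam by (simp add: two_parameter_family_at_infinity_def)
    then have "continuous_on {x :: real \<times> real. fst x > 0} (\<lambda>x. 1 / R (fst x) (snd x))"
      by (intro continuous_intros) (use R in \<open>auto simp: case_prod_unfold less_imp_neq[symmetric]\<close>)
    then show "continuous_on {(C, d). C > 0} (\<lambda>(C, d). R' C d)"
      by (simp add: case_prod_unfold R'_def)
    let ?D = "{x :: real \<times> real \<times> real. fst x > 0 \<and> 0 < snd (snd x) \<and> snd (snd x) < R' (fst x) (fst (snd x))}"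
    have inv: "R (fst x) (fst (snd x)) < 1 / snd (snd x)" if "x \<in> ?D" for x
      using that R[of "fst x" "fst (snd x)"] by (simp add: R'_def field_simps)
    have cW: "continuous_on {(C, d, r). C > 0 \<and> R C d < r} (\<lambda>(C, d, r). W C d r)"
      using fam by (simp add: two_parameter_family_at_infinity_def)
    have "continuous_on ?D (\<lambda>x. (fst x, fst (snd x), 1 / snd (snd x)))"
      by (intro continuous_intros) auto
    then have "continuous_on ?D (\<lambda>x. (\<lambda>(C, d, r). W C d r) (fst x, fst (snd x), 1 / snd (snd x)))"
      by (rule continuous_on_compose2[OF cW]) (use inv in auto)
    then show "continuous_on {(C, d, r). C > 0 \<and> 0 < r \<and> r < R' C d} (\<lambda>(C, d, r). W' C d r)"
      by (simp add: case_prod_unfold W'_def)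
    fix C C' d d' :: real
    assume C: "C > 0" "C' > 0" "(C, d) \<noteq> (C', d')"
    then have "\<not> (\<forall>\<^sub>F r in at_top. W C d r = W C' d' r)"
      using fam by (simp add: two_parameter_family_at_infinity_def)
    then show "\<not> (\<forall>\<^sub>F r in at_right 0. W' C d r = W' C' d' r)"
      unfolding eventually_at_right_to_top W'_def by (simp add: inverse_eq_divide)
  qed
  moreover have "solution_on N p q \<epsilon> {0<..<R' C d} (W' C d) \<and>
      (W' C d \<longlongrightarrow> C) (at_right 0) \<and>
      (abs_log_slope N p (W' C d) \<longlongrightarrow> \<epsilon> * C powr (q / (p - 1))) (at_right 0)" if C: "C > 0" for C d
    using inverted_solution(1)[OF W(1)[OF C] open_greaterThan p] reciprocal_greaterThan[OF R[OF C]]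
      filterlim_compose[OF W(2)[OF C] filterlim_reciprocal_at_right_0]
      inverted_log_slope_limit[OF W(1)[OF C] p W(3)[OF C]]
    unfolding W'_def[abs_def] R'_def by simp
  ultimately show ?thesis by blast
qed

lemma connecting_solution_inverted:
  fixes N p q C :: real
  assumes p: "p > 1" and q: "q > p - 1" and N: "N < p" and C: "C > 0"
  shows "\<exists>w. solution_on N p q (-1) {0<..} w \<and>
    w \<sim>[at_top] w_star N p q \<and> (w \<longlongrightarrow> C) (at_right 0) \<and>
    (abs_log_slope N p w \<longlongrightarrow> - (C powr (q / (p - 1)))) (at_right 0) \<and>
    (\<forall>r>0. w r < w_star N p q r)"
proof -
  obtain w where sol: "solution_on (2 * p - N) p q (-1) {0<..} w"
    and w: "w \<sim>[at_right 0] w_star (2 * p - N) p q" "(w \<longlongrightarrow> C) at_top"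
    "(log_slope (2 * p - N) p w \<longlongrightarrow> C powr (q / (p - 1))) at_top" "\<And>r. r > 0 \<Longrightarrow> w r < w_star (2 * p - N) p q r"
    using connecting_solution_radial[of p q "2 * p - N" C] assms by auto
  have "w (1 / r) < w_star N p q r" if "r > 0" for r
    using w(4)[of "1 / r"] that by (simp add: w_star_inversion)
  moreover have "{r. 0 < r \<and> 1 / r \<in> {0<..}} = {0 :: real<..}" by auto
  then have "solution_on N p q (-1) {0<..} (\<lambda>r. w (1 / r))"
    using inverted_solution(1)[OF sol open_greaterThan p] by simp
  ultimately show ?thesis
    using asymp_equiv_w_star_inverted(2)[OF w(1)]
      filterlim_compose[OF w(2) filterlim_reciprocal_at_right_0]
      inverted_log_slope_limit[OF sol p w(3)] by blast
qed

lemma stable_solution_inverted: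
  fixes N p q :: real
  assumes p: "p > 1" and q: "q > p - 1" and N: "N < p"
  shows "\<exists>w. \<exists>r0>0. solution_on N p q (-1) {0<..<r0} w \<and>
    w \<sim>[at_right 0] w_star N p q \<and> (\<forall>r. 0 < r \<and> r < r0 \<longrightarrow> w_star N p q r < w r)"
proof -
  obtain w r0 where r0: "r0 > 0"
    and sol: "solution_on (2 * p - N) p q (-1) {r0<..} w"
    and w: "w \<sim>[at_top] w_star (2 * p - N) p q" "\<And>r. r > r0 \<Longrightarrow> w_star (2 * p - N) p q r < w r"
    using stable_solution_radial[of p q "2 * p - N"] assms by auto
  have "w_star N p q r < w (1 / r)" if "0 < r" "r < 1 / r0" for r
  proof -
    have "r0 < 1 / r" using that r0 by (simp add: field_simps)
    then show ?thesis using w(2)[of "1 / r"] that by (simp add: w_star_inversion)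
  qed
  moreover have "solution_on N p q (-1) {0<..<1 / r0} (\<lambda>r. w (1 / r))"
    using inverted_solution(1)[OF sol open_greaterThan p] reciprocal_greaterThan[OF r0] by simp
  ultimately show ?thesis
    using asymp_equiv_w_star_inverted(1)[OF w(1)] r0
    by (intro exI[of _ "\<lambda>r. w (1 / r)"] exI[of _ "1 / r0"]) auto
qed

section \<open>Both cases together\<close>

lemma strict_imp_not_eventually_eq:
  fixes f g :: "'a \<Rightarrow> real"
  assumes "F \<noteq> bot" "\<forall>\<^sub>F x in F. f x \<noteq> g x"
  shows "\<not> (\<forall>\<^sub>F x in F. f x = g x)"
proof
  assume "\<forall>\<^sub>F x in F. f x = g x"
  with assms(2) have "\<forall>\<^sub>F x in F. False" by eventually_elim simp
  then show False using assms(1) by (simp add: trivial_limit_def)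
qed

lemma powr_cancel_slope:
  fixes p q X :: real
  assumes "p > 1" "q > p - 1"
  shows "(X powr ((p - 1) / (q + 1 - p))) powr (q / (p - 1)) = X powr (q / (q + 1 - p))"
  using assms by (simp add: powr_powr)

text \<open>The constants are \<open>c(k) = \<bar>N - p\<bar> / (p - 1) * k\<close> and \<open>c(C) = C powr (q / (p - 1))\<close>. For the last solution in
each part, \<open>C\<close> is the number at which \<open>c\<close> takes the prescribed value, a power of \<open>X\<close>.\<close>

theorem theorem4p19:
  fixes N p q \<sigma> :: real
  assumes "p - 1 > 0" and "q > p - 1" and "N \<noteq> p" and "\<sigma> = - N"
  shows
    "(N > p \<longrightarrow>
       (\<exists>c. (\<forall>k>0. c k > 0) \<and>
          (\<forall>\<epsilon>\<in>{1, -1}. \<forall>k>0. \<exists>w. local_solution_at_infinity N \<sigma> p q \<epsilon> w \<and>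
             ((\<lambda>r. r powr ((N - p) / (p - 1)) * w r) \<longlongrightarrow> k) at_top \<and>
             ((\<lambda>r. r powr ((N - 1) / (p - 1)) * deriv w r) \<longlongrightarrow> - c k) at_top)) \<and>
       (\<exists>c. (\<forall>C>0. c C > 0) \<and>
          (\<forall>\<epsilon>\<in>{1, -1}. \<exists>W R. two_parameter_family_at_infinity W R \<and>
             (\<forall>C>0. \<forall>d. positive_solution_on N \<sigma> p q \<epsilon> {R C d<..} (W C d) \<and>
                (W C d \<longlongrightarrow> C) at_top \<and>
                ((\<lambda>r. r powr ((N - 1) / (p - 1)) * ln r powr (- (1 / (p - 1))) * deriv (W C d) r)
                   \<longlongrightarrow> - \<epsilon> * c C) at_top)) \<and>
          positive_solution_on N \<sigma> p q (-1) {0<..} (w_star N p q) \<and>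
          (\<forall>\<rho>>0. C0_regular_solution N \<sigma> p q (-1) \<rho> (w_star N p q)) \<and>
          (\<exists>w. local_solution_at_0 N \<sigma> p q (-1) w \<and>
             \<not> (\<forall>\<^sub>F r in at_right 0. w r = w_star N p q r) \<and>
             w \<sim>[at_right 0] w_star N p q) \<and>
          (\<exists>w. local_solution_at_infinity N \<sigma> p q (-1) w \<and>
             \<not> (\<forall>\<^sub>F r in at_top. w r = w_star N p q r) \<and>
             w \<sim>[at_top] w_star N p q) \<and>
          (\<forall>C>0. \<exists>w. positive_solution_on N \<sigma> p q (-1) {0<..} w \<and>
             w \<sim>[at_right 0] w_star N p q \<and>
             (w \<longlongrightarrow> C) at_top \<and>
             ((\<lambda>r. r powr ((N - 1) / (p - 1)) * ln r powr (- (1 / (p - 1))) * deriv w r)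
                \<longlongrightarrow> c C) at_top) \<and>
          (\<exists>C>0. \<exists>w. positive_solution_on N \<sigma> p q (-1) {0<..} w \<and>
             w \<sim>[at_right 0] w_star N p q \<and>
             (w \<longlongrightarrow> C) at_top \<and>
             ((\<lambda>r. r powr ((N - 1) / (p - 1)) * ln r powr (- (1 / (p - 1))) * deriv w r)
                \<longlongrightarrow> ((q + 1 - p) / (N - p)) powr (q / (q + 1 - p))) at_top))) \<and>
     (p > N \<longrightarrow>
       (\<exists>c. (\<forall>k>0. c k > 0) \<and>
          (\<forall>\<epsilon>\<in>{1, -1}. \<forall>k>0. \<exists>w. local_solution_at_0 N \<sigma> p q \<epsilon> w \<and>
             ((\<lambda>r. r powr ((N - p) / (p - 1)) * w r) \<longlongrightarrow> k) (at_right 0) \<and>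
             ((\<lambda>r. r powr ((N - 1) / (p - 1)) * deriv w r) \<longlongrightarrow> c k) (at_right 0))) \<and>
       (\<exists>c. (\<forall>C>0. c C > 0) \<and>
          (\<forall>\<epsilon>\<in>{1, -1}. \<exists>W R. two_parameter_family_at_0 W R \<and>
             (\<forall>C>0. \<forall>d. positive_solution_on N \<sigma> p q \<epsilon> {0<..<R C d} (W C d) \<and>
                (W C d \<longlongrightarrow> C) (at_right 0) \<and>
                ((\<lambda>r. r powr ((N - 1) / (p - 1)) * \<bar>ln r\<bar> powr (- (1 / (p - 1))) * deriv (W C d) r)
                   \<longlongrightarrow> \<epsilon> * c C) (at_right 0))) \<and>
          positive_solution_on N \<sigma> p q (-1) {0<..} (w_star N p q) \<and>
          (\<exists>l. (w_star N p q \<longlongrightarrow> l) at_top) \<and>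
          (\<exists>w. local_solution_at_infinity N \<sigma> p q (-1) w \<and>
             \<not> (\<forall>\<^sub>F r in at_top. w r = w_star N p q r) \<and>
             w \<sim>[at_top] w_star N p q) \<and>
          (\<exists>w. local_solution_at_0 N \<sigma> p q (-1) w \<and>
             \<not> (\<forall>\<^sub>F r in at_right 0. w r = w_star N p q r) \<and>
             w \<sim>[at_right 0] w_star N p q) \<and>
          (\<forall>C>0. \<exists>w. positive_solution_on N \<sigma> p q (-1) {0<..} w \<and>
             w \<sim>[at_top] w_star N p q \<and>
             (w \<longlongrightarrow> C) (at_right 0) \<and>
             ((\<lambda>r. r powr ((N - 1) / (p - 1)) * \<bar>ln r\<bar> powr (- (1 / (p - 1))) * deriv w r)
                \<longlongrightarrow> - c C) (at_right 0)) \<and>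
          (\<exists>C>0. \<exists>w. positive_solution_on N \<sigma> p q (-1) {0<..} w \<and>
             w \<sim>[at_top] w_star N p q \<and>
             (w \<longlongrightarrow> C) (at_right 0) \<and>
             ((\<lambda>r. r powr ((N - 1) / (p - 1)) * \<bar>ln r\<bar> powr (- (1 / (p - 1))) * deriv w r)
                \<longlongrightarrow> - (((q + 1 - p) / (p - N)) powr (q / (q + 1 - p)))) (at_right 0))))"
proof -
  have p: "p > 1" using assms(1) by simp
  have q: "q > p - 1" "q > 0" using assms by auto
  have \<epsilon>: "\<epsilon> = 1 \<or> \<epsilon> = -1" if "\<epsilon> \<in> {1, -1}" for \<epsilon> :: real using that by auto
  define X where "X = (q + 1 - p) / (if N > p then N - p else p - N)"
  define C where "C = X powr ((p - 1) / (q + 1 - p))"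
  have "X > 0" using q assms(3) by (simp add: X_def)
  then have C: "C > 0" "C powr (q / (p - 1)) = X powr (q / (q + 1 - p))"
    using powr_cancel_slope[OF p q(1)] by (simp_all add: C_def)
  show ?thesis
    unfolding assms(4)
  proof (intro conjI impI, goal_cases)
    case N: 1
    show ?case
    proof (rule exI[of _ "\<lambda>k. (N - p) / (p - 1) * k"], intro conjI, goal_cases)
      case 2
      show ?case
        using decaying_solution_radial[OF p q(2) N \<epsilon>] unfolding local_solution_at_infinity_def by blast
    qed (use N p in auto)
  next
    case N: 2
    obtain w r0 where stable: "r0 > 0" "solution_on N p q (-1) {r0<..} w"
      "w \<sim>[at_top] w_star N p q" "\<And>r. r > r0 \<Longrightarrow> w_star N p q r < w r"
      using stable_solution_radial[OF p q(1) N] by blast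
    obtain v where v: "solution_on N p q (-1) {0<..} v"
      "v \<sim>[at_right 0] w_star N p q" "(v \<longlongrightarrow> C) at_top"
      "(log_slope N p v \<longlongrightarrow> C powr (q / (p - 1))) at_top" "\<And>r. r > 0 \<Longrightarrow> v r < w_star N p q r"
      using connecting_solution_radial[OF p q(1) N C(1)] by blast
    have X: "X = (q + 1 - p) / (N - p)" using N by (simp add: X_def)
    show ?case
    proof (rule exI[of _ "\<lambda>C. C powr (q / (p - 1))"], intro conjI, goal_cases)
      case 2
      show ?case using constant_limit_family_radial[OF p q(1) N \<epsilon>] by blast
    next
      case 3
      show ?case by (rule w_star_solution[OF p q(1) N])
    next
      case 4
      show ?case using w_star_C0_regular[OF p q(1) N] by blast
    next
      case 5
      have "local_solution_at_0 N (- N) p q (-1) v"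
        unfolding local_solution_at_0_def using v(1)
        by (intro exI[of _ 1]) (auto simp: positive_solution_on_def)
      moreover have "\<not> (\<forall>\<^sub>F r in at_right 0. v r = w_star N p q r)"
        by (rule strict_imp_not_eventually_eq, simp)
           (rule eventually_mono[OF eventually_at_right_less[of 0]], rule less_imp_neq, rule v(5))
      ultimately show ?case using v(2) by blast
    next
      case 6
      have "\<not> (\<forall>\<^sub>F r in at_top. w r = w_star N p q r)"
        by (rule strict_imp_not_eventually_eq, simp)
           (rule eventually_mono[OF eventually_gt_at_top[of r0]], rule less_imp_neq[symmetric], rule stable(4))
      then show ?case using stable(1-3) unfolding local_solution_at_infinity_def by blast
    next
      case 7
      show ?case using connecting_solution_radial[OF p q(1) N] by blast
    next
      case 8
      show ?case using C(1) v(1-3) v(4)[unfolded C(2) X] by blast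
    qed simp
  next
    case N: 3
    show ?case
    proof (rule exI[of _ "\<lambda>k. (p - N) / (p - 1) * k"], intro conjI, goal_cases)
      case 2
      show ?case
        using decaying_solution_inverted[OF p q(2) N \<epsilon>] unfolding local_solution_at_0_def by blast
    qed (use N p in auto)
  next
    case N: 4
    obtain w r0 where stable: "r0 > 0" "solution_on N p q (-1) {0<..<r0} w"
      "w \<sim>[at_right 0] w_star N p q" "\<And>r. 0 < r \<Longrightarrow> r < r0 \<Longrightarrow> w_star N p q r < w r"
      using stable_solution_inverted[OF p q(1) N] by blast
    obtain v where v: "solution_on N p q (-1) {0<..} v"
      "v \<sim>[at_top] w_star N p q" "(v \<longlongrightarrow> C) (at_right 0)"
      "(abs_log_slope N p v \<longlongrightarrow> - (C powr (q / (p - 1)))) (at_right 0)"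
      "\<And>r. r > 0 \<Longrightarrow> v r < w_star N p q r"
      using connecting_solution_inverted[OF p q(1) N C(1)] by blast
    have X: "X = (q + 1 - p) / (p - N)" using N by (simp add: X_def)
    have \<alpha>: "(N - p) / (q + 1 - p) < 0" using N q by (simp add: divide_neg_pos)
    show ?case
    proof (rule exI[of _ "\<lambda>C. C powr (q / (p - 1))"], intro conjI, goal_cases)
      case 2
      show ?case using constant_limit_family_inverted[OF p q(1) N \<epsilon>] by blast
    next
      case 3
      show ?case by (rule w_star_solution_inverted[OF p q(1) N])
    next
      case 4
      have "((\<lambda>r. a_star N p q * r powr ((N - p) / (q + 1 - p))) \<longlongrightarrow> a_star N p q * 0) at_top"
        by (intro tendsto_mult tendsto_const tendsto_neg_powr[OF \<alpha>] filterlim_ident)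
      then have "(w_star N p q \<longlongrightarrow> 0) at_top" by (simp add: w_star_def[abs_def])
      then show ?case by blast
    next
      case 5
      have "local_solution_at_infinity N (- N) p q (-1) v"
        unfolding local_solution_at_infinity_def using v(1)
        by (intro exI[of _ 1]) (auto simp: positive_solution_on_def)
      moreover have "\<not> (\<forall>\<^sub>F r in at_top. v r = w_star N p q r)"
        by (rule strict_imp_not_eventually_eq, simp)
           (rule eventually_mono[OF eventually_gt_at_top[of 0]], rule less_imp_neq, rule v(5))
      ultimately show ?case using v(2) by blast
    next
      case 6
      have "\<not> (\<forall>\<^sub>F r in at_right 0. w r = w_star N p q r)"
        by (rule strict_imp_not_eventually_eq, simp)
           (rule eventually_mono[OF eventually_at_right_real[OF stable(1)]], rule less_imp_neq[symmetric],
             rule stable(4), simp_all)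
      then show ?case using stable(1-3) unfolding local_solution_at_0_def by blast
    next
      case 7
      show ?case using connecting_solution_inverted[OF p q(1) N] by blast
    next
      case 8
      show ?case using C(1) v(1-3) v(4)[unfolded C(2) X] by blast
    qed simp
  qed
qed

end
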